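(* Let $F\in\mathbb{Q}[x,y]$ be such that $C=\{F(x,y)=0\}\subset\mathbb{A}^2$ is a smooth curve not isomorphic over $\overline{\mathbb{Q}}$ to $\mathbb{A}^1$ or to $\mathbb{A}^1_*$, and suppose there is $G\in\overline{\mathbb{Q}}[x,y]$ such that for $a=0$ and for all but finitely many $a\in\overline{\mathbb{Q}}$, the curve $V(G-a)$ is isomorphic to $\mathbb{A}^1$ and meets $C$ in exactly one point. Then the set $\{(x,y)\in\mathbb{Q}^2: F(x,y)<0\}$ satisfies the weak approximation property.
   Context: $\mathbb{A}^1_*=\mathbb{A}^1\setminus\{0\}$. A set $R\subset\mathbb{Q}^2$ satisfies the weak approximation property if for every $(x_0,y_0)\in\mathbb{Q}^2$ and every positive integer $N$ there exists $(x,y)\in R$ with $x-x_0\in N\mathbb{Z}$ and $y-y_0\in N\mathbb{Z}$. *)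

theory Defs
  imports Complex_Main "HOL-Computational_Algebra.Polynomial"
begin

text \<open>Bivariate polynomials are represented as polynomials in y whose
coefficients are polynomials in x.\<close>

definition eval2 :: "'a::comm_semiring_1 poly poly \<Rightarrow> 'a \<Rightarrow> 'a \<Rightarrow> 'a" where
  "eval2 p x y = poly (map_poly (\<lambda>c. poly c x) p) y"

definition const2 :: "'a::zero \<Rightarrow> 'a poly poly" where
  "const2 a = [:[:a:]:]"

definition X2 :: "'a::comm_ring_1 poly poly" where
  "X2 = [:[:0, 1:]:]"

definition Y2 :: "'a::comm_ring_1 poly poly" where
  "Y2 = pCons 0 (pCons 1 0)"

definition subst2 :: "'a::comm_semiring_1 poly poly \<Rightarrow> 'a poly poly \<Rightarrow> 'a poly poly \<Rightarrow> 'a poly poly" where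
  "subst2 p A B = poly (map_poly (\<lambda>c. poly (map_poly const2 c) A) p) B"

definition coeffs_in :: "'a set \<Rightarrow> 'a::zero poly poly \<Rightarrow> bool" where
  "coeffs_in S p \<longleftrightarrow> (\<forall>i j. coeff (coeff p i) j \<in> S)"

definition dx2 :: "'a::idom poly poly \<Rightarrow> 'a poly poly" where
  "dx2 p = map_poly pderiv p"
definition dy2 :: "'a::idom poly poly \<Rightarrow> 'a poly poly" where
  "dy2 p = pderiv p"

text \<open>Isomorphism over the coefficient field S of the affine plane curves
(schemes) V(F) and V(H): an isomorphism of S-algebras
S[x,y]/(F) \<cong> S[u,v]/(H), given by x \<mapsto> A, y \<mapsto> B and u \<mapsto> C, v \<mapsto> D.\<close>
definition plane_curve_iso :: "'a::comm_ring_1 set \<Rightarrow> 'a poly poly \<Rightarrow> 'a poly poly \<Rightarrow> bool" where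
  "plane_curve_iso S F H \<longleftrightarrow> (\<exists>A B C D.
      coeffs_in S A \<and> coeffs_in S B \<and> coeffs_in S C \<and> coeffs_in S D \<and>
      H dvd subst2 F A B \<and> F dvd subst2 H C D \<and>
      F dvd (subst2 A C D - X2) \<and> F dvd (subst2 B C D - Y2) \<and>
      H dvd (subst2 C A B - X2) \<and> H dvd (subst2 D A B - Y2))"

definition A1_poly :: "'a::comm_ring_1 poly poly" where
  "A1_poly = Y2"
definition A1star_poly :: "'a::comm_ring_1 poly poly" where
  "A1star_poly = X2 * Y2 - 1"

definition Qbar :: "complex set" where
  "Qbar = {z. algebraic z}"

definition ratpoly_to_complex :: "rat poly poly \<Rightarrow> complex poly poly" where
  "ratpoly_to_complex F = map_poly (map_poly of_rat) F"

definition smooth_plane_curve :: "complex poly poly \<Rightarrow> bool" where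
  "smooth_plane_curve F \<longleftrightarrow> (\<forall>c. F \<noteq> const2 c) \<and>
     (\<forall>x\<in>Qbar. \<forall>y\<in>Qbar. eval2 F x y = 0 \<longrightarrow> eval2 (dx2 F) x y \<noteq> 0 \<or> eval2 (dy2 F) x y \<noteq> 0)"

definition weak_approximation :: "(rat \<times> rat) set \<Rightarrow> bool" where
  "weak_approximation R \<longleftrightarrow> (\<forall>x0 y0 (N::nat). N > 0 \<longrightarrow>
     (\<exists>(x,y)\<in>R. (x - x0) / of_nat N \<in> \<int> \<and> (y - y0) / of_nat N \<in> \<int>))"

end

(*
  Let delta be the Jacobian derivation h |-> G_y h_x - G_x h_y.  On a fibre G = a isomorphic to the
  affine line it is a nonzero constant times d/ds, and the degrees of the parametrizations are bounded,
  so delta is locally nilpotent.  Its kernel is k[G] because an element of the kernel is constant on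
  every parametrized fibre.  Hence all G - r are prime, and a polynomial T with delta T = D(G) and D of
  minimal degree gives k[x,y] = k[G,T]: if not, G - r would divide T - c for some r and c, and
  (T - c) / (G - r) would have a smaller D.  (So the Abhyankar-Moh-Suzuki theorem is not needed.)

  In the coordinates u = G, v = T the curve meets almost every line u = a once; by smoothness it is
  l(u) v + b(u) = 0.  Exclude the affine line and the punctured affine line: then either l has two roots
  or l has a multiple root which is a root of b.  In both cases l(U(s)) V(s) + b(U(s)) = s forces U to be
  constant or one fixed linear polynomial.  So through a general point p there is exactly one polynomial
  curve s |-> gamma(s) with F(gamma(s)) = s.  For rational p uniqueness makes gamma rational: write the
  coefficients in a primitive element theta; replacing theta by a conjugate gives another such curve.
  Finally gamma(F(p) - M k) is congruent to p modulo N for suitable M, and F takes the value F(p) - M k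
  there, which is negative for large k.
*)
theory Submission
  imports Defs "HOL-Computational_Algebra.Computational_Algebra" "HOL-Computational_Algebra.Field_as_Ring"
begin

subsection \<open>Ring homomorphisms and evaluation of polynomials\<close>

text \<open>The isomorphisms of the fibres with the affine line are given one fibre at a time, with
  no control of how they vary with a. A degree bound read off from G alone takes the place of such
  control: a parametrization is injective, and a general line x = c or y = c meets a fibre in
  boundedly many points. The excluded curves have too many sections: for F = v every U gives a
  solution (U, s) of F(gamma(s)) = s, and for F = u v - 1 either coordinate can be held constant.
  Only algebraic coefficients are assumed for G, so gamma starts out over the algebraic numbers.
  This is why uniqueness of sections, and not merely existence, is the goal. Since F(gamma(s)) = s,
  the sign of F and the congruences at gamma(s) become conditions on the single number s. Geometry
  and descent are carried out over abstract fields described by type classes; a type of algebraic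
  numbers is built afterwards to instantiate them.\<close>

locale rhom =
  fixes f :: "'a::comm_ring_1 \<Rightarrow> 'b::comm_ring_1"
  assumes zero [simp]: "f 0 = 0" and one [simp]: "f 1 = 1"
    and add: "f (x + y) = f x + f y" and mult: "f (x * y) = f x * f y"
begin

lemma minus: "f (- x) = - f x"
  using add[of "- x" x] by (simp add: eq_neg_iff_add_eq_0)

lemma diff: "f (x - y) = f x - f y"
  using add[of x "- y"] minus[of y] by simp

lemma power: "f (x ^ n) = f x ^ n"
  by (induction n) (simp_all add: mult)

lemma sum: "f (sum g A) = (\<Sum>i\<in>A. f (g i))"
  by (induction A rule: infinite_finite_induct) (simp_all add: add)

lemma of_nat: "f (of_nat n) = of_nat n"
  by (induction n) (simp_all add: add)

lemma dvd: "x dvd y \<Longrightarrow> f x dvd f y"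
  by (auto simp: dvd_def mult)

lemma map_poly_rhom: "rhom (map_poly f)"
proof
  show "map_poly f (p * q) = map_poly f p * map_poly f q" for p q
    by (intro poly_eqI) (simp add: coeff_map_poly coeff_mult sum mult)
qed (auto intro!: poly_eqI simp: coeff_map_poly add)

end

lemma rhom_id: "rhom (\<lambda>x. x)"
  by standard auto

lemma rhom_comp: "rhom f \<Longrightarrow> rhom g \<Longrightarrow> rhom (\<lambda>x. f (g x))"
  by (simp add: rhom_def)

lemma rhom_poly: "rhom (\<lambda>p. poly p u)"
  by standard auto

lemma rhom_const: "rhom (\<lambda>a. [:a:])"
  by standard (auto simp: one_pCons)

lemma rhom_of_rat: "rhom (of_rat :: rat \<Rightarrow> 'a::field_char_0)"
  by standard (auto simp: of_rat_add of_rat_mult)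

lemma const2_conv: "const2 = (\<lambda>a. [:[:a:]:])"
  by (simp add: const2_def fun_eq_iff)

lemma rhom_const2: "rhom const2"
  unfolding const2_conv by (rule rhom_comp[OF rhom_const rhom_const])

definition ev1 :: "('a::comm_ring_1 \<Rightarrow> 'b::comm_ring_1) \<Rightarrow> 'a poly \<Rightarrow> 'b \<Rightarrow> 'b" where
  "ev1 f p u = poly (map_poly f p) u"

text \<open>Point evaluation, substitution and pull-back to a parametrized curve differ only in the
  ring that receives the coefficients. With the coefficient map as an argument,
  \<open>eval2\<close>, \<open>subst2\<close> and \<open>curve\<close> are three instances, and the
  homomorphism laws and naturality are proved once.\<close>

definition ev2 :: "('a::comm_ring_1 \<Rightarrow> 'b::comm_ring_1) \<Rightarrow> 'a poly poly \<Rightarrow> 'b \<Rightarrow> 'b \<Rightarrow> 'b" where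
  "ev2 f p u v = ev1 (\<lambda>c. ev1 f c u) p v"

lemma rhom_ev1: assumes "rhom f" shows "rhom (\<lambda>p. ev1 f p u)"
  unfolding ev1_def by (rule rhom_comp[OF rhom_poly rhom.map_poly_rhom[OF assms]])

lemma rhom_ev2: assumes "rhom f" shows "rhom (\<lambda>p. ev2 f p u v)"
  unfolding ev2_def by (rule rhom_ev1[OF rhom_ev1[OF assms]])

lemma eval2_conv: "eval2 = ev2 (\<lambda>a. a)"
  by (simp add: eval2_def ev2_def ev1_def fun_eq_iff map_poly_id')

lemma subst2_conv: "subst2 = ev2 const2"
  by (simp add: subst2_def ev2_def ev1_def fun_eq_iff)

definition curve :: "'a::comm_ring_1 poly poly \<Rightarrow> 'a poly \<Rightarrow> 'a poly \<Rightarrow> 'a poly" where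
  "curve = ev2 (\<lambda>a. [:a:])"

text \<open>The composite w(C) of a univariate \<open>w\<close> with a bivariate \<open>C\<close>.
  For \<open>C = G\<close> these are the elements of the subring k[G].\<close>

definition ucomp :: "'a::comm_ring_1 poly \<Rightarrow> 'a poly poly \<Rightarrow> 'a poly poly" where
  "ucomp = ev1 const2"

lemma rhom_eval2: "rhom (\<lambda>p. eval2 p u v)"
  unfolding eval2_conv by (rule rhom_ev2[OF rhom_id])
lemma rhom_subst2: "rhom (\<lambda>p. subst2 p u v)"
  unfolding subst2_conv by (rule rhom_ev2[OF rhom_const2])
lemma rhom_curve: "rhom (\<lambda>p. curve p u v)"
  unfolding curve_def by (rule rhom_ev2[OF rhom_const])
lemma rhom_ucomp: "rhom (\<lambda>p. ucomp p u)"
  unfolding ucomp_def by (rule rhom_ev1[OF rhom_const2])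

lemmas eval2_simps = rhom.zero[OF rhom_eval2] rhom.one[OF rhom_eval2] rhom.add[OF rhom_eval2]
  rhom.mult[OF rhom_eval2] rhom.minus[OF rhom_eval2] rhom.diff[OF rhom_eval2] rhom.power[OF rhom_eval2]
lemmas subst2_simps = rhom.zero[OF rhom_subst2] rhom.one[OF rhom_subst2] rhom.add[OF rhom_subst2]
  rhom.mult[OF rhom_subst2] rhom.minus[OF rhom_subst2] rhom.diff[OF rhom_subst2] rhom.power[OF rhom_subst2]
lemmas curve_simps = rhom.zero[OF rhom_curve] rhom.one[OF rhom_curve] rhom.add[OF rhom_curve]
  rhom.mult[OF rhom_curve] rhom.minus[OF rhom_curve] rhom.diff[OF rhom_curve] rhom.power[OF rhom_curve]
lemmas ucomp_simps = rhom.zero[OF rhom_ucomp] rhom.one[OF rhom_ucomp] rhom.add[OF rhom_ucomp]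
  rhom.mult[OF rhom_ucomp] rhom.minus[OF rhom_ucomp] rhom.diff[OF rhom_ucomp] rhom.power[OF rhom_ucomp]

lemma ev1_pCons: "rhom f \<Longrightarrow> ev1 f (pCons a p) u = f a + u * ev1 f p u"
  by (simp add: ev1_def map_poly_pCons rhom.zero)

lemma ev1_0: "ev1 f 0 u = 0"
  by (simp add: ev1_def)

lemma ev2_const2: "rhom f \<Longrightarrow> ev2 f (const2 a) u v = f a"
  by (simp add: ev2_def const2_def ev1_pCons rhom_ev1 ev1_0)

lemma ev2_X2: "rhom f \<Longrightarrow> ev2 f X2 u v = u"
  by (simp add: ev2_def X2_def ev1_pCons rhom_ev1 ev1_0 rhom.one rhom.zero)

lemma ev2_Y2: "rhom f \<Longrightarrow> ev2 f Y2 u v = v"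
  by (simp add: ev2_def Y2_def ev1_pCons rhom_ev1 ev1_0 rhom.one[OF rhom_ev1] rhom.zero)

lemma eval2_gens [simp]:
  "eval2 (const2 a) u v = a" "eval2 X2 u v = u" "eval2 Y2 u v = v"
  unfolding eval2_conv by (simp_all add: ev2_const2 ev2_X2 ev2_Y2 rhom_id)

lemma subst2_gens [simp]:
  "subst2 (const2 a) u v = const2 a" "subst2 X2 u v = u" "subst2 Y2 u v = v"
  unfolding subst2_conv by (simp_all add: ev2_const2 ev2_X2 ev2_Y2 rhom_const2)

lemma curve_gens [simp]:
  "curve (const2 a) u v = [:a:]" "curve X2 u v = u" "curve Y2 u v = v"
  unfolding curve_def by (simp_all add: ev2_const2 ev2_X2 ev2_Y2 rhom_const)

lemma ucomp_pCons [simp]: "ucomp (pCons a p) u = const2 a + u * ucomp p u"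
  unfolding ucomp_def by (simp add: ev1_pCons rhom_const2)

lemma ucomp_0 [simp]: "ucomp 0 u = 0"
  by (simp add: ucomp_def ev1_0)

lemma ucomp_1 [simp]: "ucomp 1 u = 1"
  by (rule rhom.one[OF rhom_ucomp])

lemmas const2_simps [simp] = rhom.zero[OF rhom_const2] rhom.one[OF rhom_const2]

lemmas const2_hom = rhom.add[OF rhom_const2] rhom.mult[OF rhom_const2] rhom.minus[OF rhom_const2]
  rhom.diff[OF rhom_const2] rhom.power[OF rhom_const2]

lemma const2_eq_0_iff [simp]: "const2 a = 0 \<longleftrightarrow> a = 0"
  by (simp add: const2_def)

subsection \<open>Induction over bivariate polynomials\<close>

lemma pCons_conv: "pCons c p = [:c:] + Y2 * p"
  by (simp add: Y2_def)

lemma pCons_const_conv: "[:pCons a q:] = const2 a + X2 * [:q:]"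
  by (simp add: const2_def X2_def)

lemma bipoly_induct [case_names const X Y add mult]:
  assumes c: "\<And>a. P (const2 a)" and x: "P X2" and y: "P Y2"
    and a: "\<And>p q. P p \<Longrightarrow> P q \<Longrightarrow> P (p + q)" and m: "\<And>p q. P p \<Longrightarrow> P q \<Longrightarrow> P (p * q)"
  shows "P p"
proof (induction p)
  case 0
  show ?case using c[of 0] by simp
next
  case (pCons c p)
  have "P [:c:]"
  proof (induction c)
    case 0
    show ?case using assms(1)[of 0] by simp
  next
    case (pCons b q)
    then show ?case
      by (subst pCons_const_conv) (intro a m assms(1) x)
  qed
  then show ?case
    by (subst pCons_conv) (intro a m y pCons)
qed

lemma rhom2_eqI:
  assumes "rhom f" "rhom g"
    and "\<And>a. f (const2 a) = g (const2 a)" "f X2 = g X2" "f Y2 = g Y2"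
  shows "f p = g p"
  by (induction p rule: bipoly_induct) (simp_all add: assms rhom.add rhom.mult)

lemma rhom1_eqI:
  assumes "rhom f" "rhom g"
    and "\<And>a. f [:a:] = g [:a:]" "f [:0,1:] = g [:0,1:]"
  shows "f p = g p"
proof (induction p)
  case 0
  show ?case using assms by (simp add: rhom.zero)
next
  case (pCons a p)
  have *: "pCons a p = [:a:] + [:0,1:] * p" by simp
  show ?case unfolding * using pCons assms
    by (simp only: rhom.add[OF assms(1)] rhom.add[OF assms(2)] rhom.mult[OF assms(1)] rhom.mult[OF assms(2)])
qed

lemma poly_curve: "poly (curve p X Y) s = eval2 p (poly X s) (poly Y s)"
  by (rule rhom2_eqI[where p = p]) (auto intro: rhom_comp[OF rhom_poly rhom_curve] rhom_eval2)

lemma curve_subst2: "curve (subst2 p A B) X Y = curve p (curve A X Y) (curve B X Y)"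
  by (rule rhom2_eqI[where p = p]) (auto intro: rhom_comp[OF rhom_curve rhom_subst2] rhom_curve)

lemma eval2_subst2:
  fixes p A B :: "'a::comm_ring_1 poly poly"
  shows "eval2 (subst2 p A B) x y = eval2 p (eval2 A x y) (eval2 B x y)"
  by (rule rhom2_eqI[where p = p]) (auto intro: rhom_comp[OF rhom_eval2 rhom_subst2] rhom_eval2)

lemma subst2_subst2:
  fixes p A B C D :: "'a::comm_ring_1 poly poly"
  shows "subst2 (subst2 p A B) C D = subst2 p (subst2 A C D) (subst2 B C D)"
  by (rule rhom2_eqI[where p = p]) (auto intro: rhom_comp[OF rhom_subst2 rhom_subst2] rhom_subst2)

lemma subst2_id [simp]: "subst2 p X2 Y2 = p"
  by (rule rhom2_eqI[where p = p]) (auto intro: rhom_subst2 rhom_id)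

lemma rhom_pcompose: "rhom (\<lambda>p. pcompose p q)"
  by standard (auto simp: pcompose_add pcompose_mult pcompose_1)

lemma curve_ucomp: "curve (ucomp w C) X Y = pcompose w (curve C X Y)"
  by (rule rhom1_eqI[where p = w])
    (auto intro: rhom_comp[OF rhom_curve rhom_ucomp] rhom_pcompose simp: pcompose_pCons pcompose_1)

lemma eval2_ucomp [simp]: "eval2 (ucomp w C) x y = poly w (eval2 C x y)"
  by (rule rhom1_eqI[where p = w])
    (auto intro: rhom_comp[OF rhom_eval2 rhom_ucomp] rhom_poly)

lemma subst2_ucomp: "subst2 (ucomp w C) A B = ucomp w (subst2 C A B)"
  by (rule rhom1_eqI[where p = w])
    (auto intro: rhom_comp[OF rhom_subst2 rhom_ucomp] rhom_ucomp)

lemma ucomp_X2: "ucomp w X2 = [:w:]"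
  by (rule rhom1_eqI[where p = w])
    (auto intro: rhom_ucomp rhom_const simp: X2_def const2_def)

text \<open>Modulo \<open>d\<close> both substitutions are the same ring homomorphism. The product
  case rests on p q - p' q' = (p - p') q + (q - q') p'.\<close>

lemma subst2_cong_dvd:
  fixes A B A' B' d :: "'a::comm_ring_1 poly poly"
  assumes "d dvd A - A'" "d dvd B - B'"
  shows "d dvd subst2 p A B - subst2 p A' B'"
proof (induction p rule: bipoly_induct)
  case (add p q)
  then have "d dvd (subst2 p A B - subst2 p A' B') + (subst2 q A B - subst2 q A' B')"
    by (rule dvd_add)
  then show ?case by (simp add: subst2_simps algebra_simps)
next
  case (mult p q)
  then have "d dvd (subst2 p A B - subst2 p A' B') * subst2 q A B
      + (subst2 q A B - subst2 q A' B') * subst2 p A' B'"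
    by simp
  then show ?case by (simp add: subst2_simps algebra_simps)
qed (use assms in simp_all)

subsection \<open>Derivations\<close>

locale derivation =
  fixes d :: "'a::comm_ring_1 \<Rightarrow> 'a"
  assumes add: "d (x + y) = d x + d y"
    and mult: "d (x * y) = d x * y + x * d y"
begin

lemma zero [simp]: "d 0 = 0"
  using add[of 0 0] by simp

lemma one [simp]: "d 1 = 0"
  using mult[of 1 1] by simp

lemma minus: "d (- x) = - d x"
  using add[of "- x" x] by (simp add: eq_neg_iff_add_eq_0)

lemma diff: "d (x - y) = d x - d y"
  using add[of x "- y"] minus[of y] by simp

lemma of_nat [simp]: "d (of_nat n) = 0"
  by (induction n) (simp_all add: add)

lemma power: "d (x ^ n) = of_nat n * x ^ (n - 1) * d x"
proof (induction n)
  case (Suc n)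
  then show ?case by (cases n) (simp_all add: mult algebra_simps)
qed simp

end

lemma derivation_dy2: "derivation dy2"
  by standard (simp_all add: dy2_def pderiv_add pderiv_mult algebra_simps)

lemma coeff_dx2: "coeff (dx2 p) i = pderiv (coeff p i)"
  by (simp add: dx2_def coeff_map_poly)

lemma pderiv_sum: "pderiv (sum f A) = (\<Sum>i\<in>A. pderiv (f i))"
  by (induction A rule: infinite_finite_induct) (simp_all add: pderiv_add)

lemma derivation_dx2: "derivation dx2"
proof
  fix x y :: "'a poly poly"
  show "dx2 (x + y) = dx2 x + dx2 y"
    by (rule poly_eqI) (simp add: coeff_dx2 pderiv_add)
  show "dx2 (x * y) = dx2 x * y + x * dx2 y"
    by (rule poly_eqI)
      (simp add: coeff_dx2 coeff_mult pderiv_mult pderiv_sum sum.distrib mult.commute[of "coeff y _"] add.commute)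
qed

lemma dx2_const2 [simp]: "dx2 (const2 a) = 0"
  by (simp add: dx2_def const2_def map_poly_pCons)

lemma dx2_X2 [simp]: "dx2 X2 = 1"
  by (rule poly_eqI) (auto simp: coeff_dx2 X2_def coeff_pCons pderiv_pCons one_pCons split: nat.splits)

lemma dx2_Y2 [simp]: "dx2 Y2 = 0"
  by (rule poly_eqI) (auto simp: coeff_dx2 Y2_def coeff_pCons split: nat.splits)

lemma dy2_gens [simp]: "dy2 (const2 a) = 0" "dy2 X2 = 0" "dy2 Y2 = 1"
  by (simp_all add: dy2_def const2_def X2_def Y2_def pderiv_pCons)

lemma chain_rule_subst2:
  fixes p :: "'a::idom poly poly"
  assumes "derivation d" "\<And>a. d (const2 a) = 0"
  shows "d (subst2 p A B) = subst2 (dx2 p) A B * d A + subst2 (dy2 p) A B * d B"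
  by (induction p rule: bipoly_induct)
    (simp_all add: assms(2) subst2_simps derivation.add[OF assms(1)] derivation.mult[OF assms(1)]
      derivation.add[OF derivation_dx2] derivation.mult[OF derivation_dx2]
      derivation.add[OF derivation_dy2] derivation.mult[OF derivation_dy2] algebra_simps)

text \<open>Formulated for any derivation killing the constants because it is applied to both
  partial derivatives and to \<open>jac G\<close>.\<close>

lemma chain_rule_ucomp:
  fixes w :: "'a::idom poly"
  assumes "derivation d" "\<And>a. d (const2 a) = 0"
  shows "d (ucomp w C) = ucomp (pderiv w) C * d C"
  by (induction w)
    (simp_all add: assms(2) derivation.add[OF assms(1)] derivation.mult[OF assms(1)]
      derivation.zero[OF assms(1)] pderiv_pCons ucomp_simps algebra_simps)

subsection \<open>Nonvanishing\<close>

text \<open>The leading coefficient in y is a nonzero polynomial in x and has to vanish at every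
  such \<open>c\<close>.\<close>

lemma finite_specialization_zero:
  fixes p :: "'a::idom poly poly"
  assumes "p \<noteq> 0"
  shows "finite {c. map_poly (\<lambda>q. poly q c) p = 0}"
proof (rule finite_subset)
  show "{c. map_poly (\<lambda>q. poly q c) p = 0} \<subseteq> {c. poly (lead_coeff p) c = 0}"
    by (auto simp: poly_eq_iff coeff_map_poly)
  show "finite {c. poly (lead_coeff p) c = 0}"
    using assms by (intro poly_roots_finite) auto
qed

lemma infinite_ex_not: "infinite A \<Longrightarrow> finite {x. P x} \<Longrightarrow> \<exists>x\<in>A. \<not> P x"
  by (metis finite_subset mem_Collect_eq subsetI)

lemma eval2_nonzero_exists:
  fixes p :: "'a::{idom, ring_char_0} poly poly"
  assumes "p \<noteq> 0" "infinite A" "infinite B"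
  shows "\<exists>x\<in>A. \<exists>y\<in>B. eval2 p x y \<noteq> 0"
proof -
  obtain x where x: "x \<in> A" "map_poly (\<lambda>q. poly q x) p \<noteq> 0"
    using infinite_ex_not[OF assms(2) finite_specialization_zero[OF assms(1)]] by blast
  obtain y where "y \<in> B" "poly (map_poly (\<lambda>q. poly q x) p) y \<noteq> 0"
    using infinite_ex_not[OF assms(3) poly_roots_finite[OF x(2)]] by blast
  with x show ?thesis by (auto simp: eval2_def)
qed

lemma eval2_zeroI:
  fixes p :: "'a::{idom, ring_char_0} poly poly"
  assumes "\<And>x y. eval2 p x y = 0"
  shows "p = 0"
  using eval2_nonzero_exists[of p UNIV UNIV] assms infinite_UNIV_char_0 by blast

subsection \<open>Univariate polynomials over an algebraically closed field\<close>

lemma root_free_const: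
  fixes p :: "'a::alg_closed_field poly"
  assumes "\<And>s. poly p s \<noteq> 0"
  shows "\<exists>c. c \<noteq> 0 \<and> p = [:c:]"
proof -
  have "degree p = 0" using assms alg_closed_imp_poly_has_root[of p] by auto
  then obtain c where "p = [:c:]" by (rule degree_eq_zeroE)
  with assms[of 0] show ?thesis by auto
qed

text \<open>The hypothesis says that all roots are simple. It passes to the cofactor after a linear
  factor is split off, and simplicity of the root \<open>c\<close> keeps \<open>c\<close> from being
  a root of the cofactor.\<close>

lemma card_roots_eq_degree:
  fixes p :: "'a::alg_closed_field poly"
  assumes "p \<noteq> 0" "\<And>a. \<not> (poly p a = 0 \<and> poly (pderiv p) a = 0)"
  shows "card {a. poly p a = 0} = degree p"
  using assms
proof (induction "degree p" arbitrary: p)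
  case 0
  then obtain c where "p = [:c:]" "c \<noteq> 0" by (auto elim: degree_eq_zeroE)
  then show ?case by simp
next
  case (Suc n)
  then obtain c where c: "poly p c = 0"
    using alg_closed_imp_poly_has_root[of p] by auto
  then obtain q where q: "p = [:- c, 1:] * q"
    by (auto simp: poly_eq_0_iff_dvd elim: dvdE)
  have q0: "q \<noteq> 0" using q Suc.prems(1) by auto
  have dp: "poly (pderiv p) a = poly q a + (a - c) * poly (pderiv q) a" for a
    unfolding q pderiv_mult by (simp add: pderiv_pCons algebra_simps)
  have p: "poly p a = (a - c) * poly q a" for a
    unfolding q by (simp add: algebra_simps)
  have "degree q = n"
    using Suc.hyps(2) q0 unfolding q by (subst (asm) degree_mult_eq) auto
  moreover have "\<not> (poly q a = 0 \<and> poly (pderiv q) a = 0)" for a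
    using Suc.prems(2)[of a] by (auto simp: p dp)
  ultimately have "card {a. poly q a = 0} = n"
    using Suc.hyps(1)[of q] q0 by auto
  moreover have "poly q c \<noteq> 0"
    using Suc.prems(2)[of c] c by (auto simp: dp)
  moreover have "{a. poly p a = 0} = insert c {a. poly q a = 0}"
    by (auto simp: p)
  ultimately show ?case
    using Suc.hyps(2) poly_roots_finite[OF q0] by simp
qed

text \<open>A fibre has fewer points than the degree only over a critical value, and there are
  finitely many of these; \<open>c\<close> avoids them together with \<open>B\<close>.\<close>

lemma exists_full_fibre:
  fixes p :: "'a::{alg_closed_field, field_char_0} poly"
  assumes "degree p > 0" "finite B"
  shows "\<exists>c. c \<notin> B \<and> card {s. poly p s = c} = degree p"
proof -
  have "pderiv p \<noteq> 0" using assms(1) by (simp add: pderiv_eq_0_iff)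
  then have "finite (B \<union> poly p ` {s. poly (pderiv p) s = 0})"
    using assms(2) poly_roots_finite by blast
  then obtain c where c: "c \<notin> B \<union> poly p ` {s. poly (pderiv p) s = 0}"
    using ex_new_if_finite infinite_UNIV_char_0 by blast
  have "card {s. poly (p - [:c:]) s = 0} = degree (p - [:c:])"
  proof (rule card_roots_eq_degree)
    show "p - [:c:] \<noteq> 0" using assms(1) by auto
    show "\<not> (poly (p - [:c:]) a = 0 \<and> poly (pderiv (p - [:c:])) a = 0)" for a
      using c by (auto simp: pderiv_diff pderiv_pCons)
  qed
  moreover have "degree (p - [:c:]) = degree p"
    unfolding diff_conv_add_uminus using assms(1) by (intro degree_add_eq_left) simp
  ultimately show ?thesis using c by auto
qed

lemma pderiv_funpow_eq_0:
  fixes p :: "'a::field_char_0 poly"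
  assumes "degree p < n"
  shows "(pderiv ^^ n) p = 0"
  using assms
proof (induction n arbitrary: p)
  case (Suc n)
  show ?case
  proof (cases "degree p = 0")
    case True
    then have "pderiv p = 0" by (simp add: pderiv_eq_0_iff)
    moreover have "(pderiv ^^ m) 0 = (0 :: 'a poly)" for m by (induction m) simp_all
    ultimately show ?thesis by (simp add: funpow_swap1)
  next
    case False
    with Suc have "(pderiv ^^ n) (pderiv p) = 0" by (simp add: degree_pderiv)
    then show ?thesis by (simp add: funpow_swap1)
  qed
qed simp

text \<open>Over an algebraically closed field w(T) is a unit times a product of factors T - c, and
  a prime divides one of them.\<close>

lemma prime_dvd_ucomp:
  fixes w :: "'a::alg_closed_field poly"
  assumes "prime_elem \<pi>" "\<pi> dvd ucomp w T" "w \<noteq> 0"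
  shows "\<exists>c. \<pi> dvd T - const2 c"
  using assms
proof (induction "degree w" arbitrary: w)
  case 0
  then obtain c where c: "w = [:c:]" "c \<noteq> 0" by (auto elim: degree_eq_zeroE)
  have "const2 c * const2 (inverse c) = 1" using c by (simp flip: const2_hom(2))
  then have "const2 c dvd 1" using dvdI[of 1 "const2 c"] by simp
  then have "\<pi> dvd 1" using 0(3) c dvd_trans by auto
  then show ?case using 0 by (simp add: prime_elem_def)
next
  case (Suc n)
  then obtain c where "poly w c = 0"
    using alg_closed_imp_poly_has_root[of w] by auto
  then obtain q where q: "w = [:- c, 1:] * q"
    by (auto simp: poly_eq_0_iff_dvd elim: dvdE)
  have q0: "q \<noteq> 0" using q Suc.prems by auto
  have n: "n = degree q"
    using Suc.hyps(2) q0 unfolding q by (subst (asm) degree_mult_eq) auto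
  have "ucomp w T = (T - const2 c) * ucomp q T"
    unfolding q by (simp only: ucomp_simps) (simp add: const2_hom algebra_simps)
  then have "\<pi> dvd T - const2 c \<or> \<pi> dvd ucomp q T"
    using Suc.prems prime_elem_dvd_multD by metis
  then show ?case using Suc.hyps(1)[OF n Suc.prems(1) _ q0] by auto
qed

subsection \<open>A size measure for bivariate polynomials\<close>

text \<open>The exponents of the lexicographically leading monomial, added up. This number is
  additive on products, does not grow when a constant is subtracted, and is positive on nonconstant
  polynomials, which makes it a measure for repeated division by G - a.\<close>

definition bisize :: "'a::zero poly poly \<Rightarrow> nat" where
  "bisize p = degree p + degree (lead_coeff p)"

lemma bisize_mult:
  fixes p q :: "'a::idom poly poly"
  assumes "p \<noteq> 0" "q \<noteq> 0"
  shows "bisize (p * q) = bisize p + bisize q"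
  using assms by (simp add: bisize_def degree_mult_eq coeff_mult_degree_sum)

lemma bisize_diff_const2: "bisize (p - const2 c) \<le> bisize (p :: 'a::idom poly poly)"
proof (cases "degree p = 0")
  case True
  then obtain q where q: "p = [:q:]" by (metis degree_eq_zeroE)
  have "degree (q - [:c:]) \<le> degree q"
    by (rule degree_diff_le) auto
  then show ?thesis by (simp add: q bisize_def const2_def)
next
  case False
  have "degree (p - const2 c) = degree p"
    unfolding diff_conv_add_uminus using False by (intro degree_add_eq_left) (simp add: const2_def)
  then show ?thesis using False by (simp add: bisize_def const2_def coeff_pCons split: nat.splits)
qed

lemma bisize_eq_0: "bisize p = 0 \<Longrightarrow> \<exists>c. p = const2 c"
  by (auto simp: bisize_def const2_def elim!: degree_eq_zeroE)

lemma map_poly_poly_eq_0D: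
  fixes W :: "'a::idom poly poly"
  assumes "map_poly (\<lambda>q. poly q r) W = 0"
  shows "\<exists>W'. W = [:[:- r, 1:]:] * W'"
proof -
  have "[:- r, 1:] dvd coeff W n" for n
    using arg_cong[OF assms, of "\<lambda>p. coeff p n"] by (simp add: coeff_map_poly poly_eq_0_iff_dvd)
  then have "[:[:- r, 1:]:] dvd W" by (simp add: const_poly_dvd_iff)
  then obtain W' where "W = [:[:- r, 1:]:] * W'" by (elim dvdE)
  then show ?thesis by blast
qed

lemma subst2_const_left: "subst2 W (const2 r) T = ucomp (map_poly (\<lambda>q. poly q r) W) T"
proof (rule rhom2_eqI[where p = W])
  show "rhom (\<lambda>p. ucomp (map_poly (\<lambda>q. poly q r) p) T)"
    by (rule rhom_comp[OF rhom_ucomp rhom.map_poly_rhom[OF rhom_poly]])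
next
  have "map_poly (\<lambda>q. poly q r) (const2 a) = [:a:]" "map_poly (\<lambda>q. poly q r) X2 = [:r:]"
    "map_poly (\<lambda>q. poly q r) Y2 = [:0, 1:]" for a
    by (simp_all add: const2_def X2_def Y2_def map_poly_pCons)
  then show "subst2 (const2 a) (const2 r) T = ucomp (map_poly (\<lambda>q. poly q r) (const2 a)) T"
    "subst2 X2 (const2 r) T = ucomp (map_poly (\<lambda>q. poly q r) X2) T"
    "subst2 Y2 (const2 r) T = ucomp (map_poly (\<lambda>q. poly q r) Y2) T" for a
    by simp_all
qed (rule rhom_subst2)

lemma eval2_map_poly: "poly (map_poly (\<lambda>q. poly q a) f) v = eval2 f a v"
  by (simp add: eval2_def)

subsection \<open>Families of curves parametrized by the affine line\<close>

definition jac :: "'a::idom poly poly \<Rightarrow> 'a poly poly \<Rightarrow> 'a poly poly" where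
  "jac G h = dy2 G * dx2 h - dx2 G * dy2 h"

lemma derivation_jac: "derivation (jac G)"
  by standard (simp_all add: jac_def derivation.add[OF derivation_dx2] derivation.mult[OF derivation_dx2]
      derivation.add[OF derivation_dy2] derivation.mult[OF derivation_dy2] algebra_simps)

lemma jac_simps [simp]: "jac G (const2 a) = 0" "jac G G = 0" "jac G X2 = dy2 G" "jac G Y2 = - dx2 G"
  by (simp_all add: jac_def)

text \<open>The last clause is the scheme-theoretic part of \<open>V(G - a) \<cong> A\<^sup>1\<close>: modulo \<open>G - a\<close> every
  polynomial is a polynomial in \<open>C\<close>. It forces the gradient of \<open>G\<close> to be nonzero on the fibre.\<close>

definition param :: "'a::idom poly poly \<Rightarrow> 'a \<Rightarrow> 'a poly \<Rightarrow> 'a poly \<Rightarrow> 'a poly poly \<Rightarrow> bool" where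
  "param G a X Y C \<longleftrightarrow> curve G X Y = [:a:] \<and> curve C X Y = [:0, 1:] \<and>
     (\<forall>h. G - const2 a dvd h - ucomp (curve h X Y) C)"

lemma param_decomp:
  assumes "param G a X Y C"
  obtains q where "h = ucomp (curve h X Y) C + (G - const2 a) * q"
proof -
  from assms obtain q where "h - ucomp (curve h X Y) C = (G - const2 a) * q"
    unfolding param_def by (meson dvdE)
  then have "h = ucomp (curve h X Y) C + (G - const2 a) * q"
    by (simp add: diff_eq_eq add.commute)
  then show ?thesis by (rule that)
qed

text \<open>If the gradient of \<open>G\<close> vanished at a point of the fibre, differentiating h
  = w(C) + (G - a) q would make the gradient of every \<open>h\<close> there a multiple of that of
  \<open>C\<close>. The gradients of x and y are not proportional.\<close>

lemma param_grad:
  fixes G :: "'a::idom poly poly"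
  assumes "param G a X Y C"
  shows "eval2 (dx2 G) (poly X s) (poly Y s) \<noteq> 0 \<or> eval2 (dy2 G) (poly X s) (poly Y s) \<noteq> 0"
proof (rule ccontr)
  let ?e = "\<lambda>p. eval2 p (poly X s) (poly Y s)"
  assume *: "\<not> ?thesis"
  have G0: "?e G = a"
    using assms by (simp add: param_def flip: poly_curve)
  have "\<exists>w. ?e (dx2 h) = w * ?e (dx2 C) \<and> ?e (dy2 h) = w * ?e (dy2 C)" for h
  proof -
    define w where "w = curve h X Y"
    obtain q where q: "h = ucomp w C + (G - const2 a) * q"
      unfolding w_def using assms by (rule param_decomp)
    have d: "d h = ucomp (pderiv w) C * d C + ((G - const2 a) * d q + d G * q)"
      if "derivation d" "\<And>a. d (const2 a) = 0" for d
      unfolding q by (simp add: derivation.add[OF that(1)] derivation.diff[OF that(1)] that(2)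
          derivation.mult[OF that(1)] chain_rule_ucomp[OF that])
    have "?e (dx2 h) = ?e (ucomp (pderiv w) C) * ?e (dx2 C)"
      using * unfolding d[OF derivation_dx2 dx2_const2] by (simp add: eval2_simps G0)
    moreover have "?e (dy2 h) = ?e (ucomp (pderiv w) C) * ?e (dy2 C)"
      using * unfolding d[OF derivation_dy2 dy2_gens(1)] by (simp add: eval2_simps G0)
    ultimately show ?thesis by blast
  qed
  from this[of X2] this[of Y2] obtain w w' where "1 = w * ?e (dx2 C)" "0 = w * ?e (dy2 C)" "1 = w' * ?e (dy2 C)"
    by (auto simp: eval2_simps)
  then show False by (metis mult_eq_0_iff mult_zero_right zero_neq_one)
qed

text \<open>Applying \<open>jac G\<close> to h = w(C) + (G - a) q and pulling back gives w' times
  the pull-back \<open>L\<close> of \<open>jac G C\<close>. A root of \<open>L\<close> would make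
  \<open>jac G X2\<close> and \<open>jac G Y2\<close>, hence the gradient of \<open>G\<close>,
  vanish at that point. So \<open>L\<close> has no root and is a constant.\<close>

lemma param_jac:
  fixes G :: "'a::alg_closed_field poly poly"
  assumes "param G a X Y C"
  shows "\<exists>c. c \<noteq> 0 \<and> (\<forall>h. curve (jac G h) X Y = smult c (pderiv (curve h X Y)))"
proof -
  have curves: "curve G X Y = [:a:]" "curve C X Y = [:0, 1:]"
    using assms by (simp_all add: param_def)
  define L where "L = curve (jac G C) X Y"
  have *: "curve (jac G h) X Y = pderiv (curve h X Y) * L" for h
  proof -
    define w where "w = curve h X Y"
    obtain q where q: "h = ucomp w C + (G - const2 a) * q"
      unfolding w_def using assms by (rule param_decomp)
    have "jac G h = ucomp (pderiv w) C * jac G C + (G - const2 a) * jac G q"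
      unfolding q by (simp add: derivation.add[OF derivation_jac] derivation.diff[OF derivation_jac]
          derivation.mult[OF derivation_jac] chain_rule_ucomp[OF derivation_jac])
    then show ?thesis by (simp add: curve_simps curve_ucomp curves w_def L_def)
  qed
  have "poly L s \<noteq> 0" for s
  proof
    assume "poly L s = 0"
    then have "poly (curve (jac G h) X Y) s = 0" for h by (simp add: *)
    from this[of X2] this[of Y2] show False
      using param_grad[OF assms, of s] by (simp add: poly_curve eval2_simps)
  qed
  from root_free_const[OF this] obtain c where "c \<noteq> 0" "L = [:c:]" by blast
  with * show ?thesis by (intro exI[of _ c]) simp
qed

lemma param_curve_eq_0D: "param G a X Y C \<Longrightarrow> curve h X Y = 0 \<Longrightarrow> G - const2 a dvd h"
  by (erule param_decomp[where h = h]) simp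

text \<open>\<open>E\<close> collects the values whose fibres are not controlled. The class
  \<open>field_gcd\<close> makes the bivariate polynomial ring factorial, so that irreducible fibre
  polynomials are prime.\<close>

locale affine_line_pencil =
  fixes G :: "'a::{alg_closed_field, field_char_0, field_gcd} poly poly" and E :: "'a set"
  assumes finite_E: "finite E"
    and ex_param: "\<And>a. a \<notin> E \<Longrightarrow> \<exists>X Y C. param G a X Y C"
begin

lemma G_not_const: "G \<noteq> const2 r"
proof
  assume G: "G = const2 r"
  obtain a where "a \<notin> E" using finite_E ex_new_if_finite infinite_UNIV_char_0 by blast
  from ex_param[OF this] obtain X Y C where "param G a X Y C" by blast
  from param_grad[OF this] show False by (simp add: G eval2_simps)
qed

lemma G_minus_nonzero: "G - const2 r \<noteq> 0"
  using G_not_const by simp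

lemma bisize_G: "bisize (G - const2 r) > 0"
proof (rule ccontr)
  assume "\<not> ?thesis"
  then obtain c where "G - const2 r = const2 c" using bisize_eq_0 by auto
  then have "G = const2 (c + r)" by (simp add: const2_hom diff_eq_eq)
  then show False using G_not_const by simp
qed

lemma not_unit: "\<not> G - const2 r dvd const2 c" if "c \<noteq> 0"
proof
  assume "G - const2 r dvd const2 c"
  then obtain q where q: "const2 c = (G - const2 r) * q" by (elim dvdE)
  then have "bisize (const2 c) = bisize (G - const2 r) + bisize q"
    using that by (metis G_minus_nonzero bisize_mult const2_eq_0_iff mult_zero_right)
  moreover have "bisize (const2 c) = 0" by (simp add: bisize_def const2_def)
  ultimately show False using bisize_G[of r] by linarith
qed

text \<open>The product \<open>P\<close> of the G - r over all excluded r takes care of the excluded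
  fibres: every point of the plane lies either on one of them, where \<open>P\<close> vanishes, or
  on a parametrized fibre, where \<open>h\<close> vanishes.\<close>

lemma zero_if_curves_zero:
  assumes "finite E'" and zero: "\<And>a X Y C. a \<notin> E' \<Longrightarrow> a \<notin> E \<Longrightarrow> param G a X Y C \<Longrightarrow> curve h X Y = 0"
  shows "h = 0"
proof -
  define P where "P = (\<Prod>r\<in>E \<union> E'. G - const2 r)"
  have fin: "finite (E \<union> E')" using finite_E assms(1) by simp
  have "eval2 (h * P) x y = 0" for x y
  proof (cases "eval2 G x y \<in> E \<union> E'")
    case True
    then have "G - const2 (eval2 G x y) dvd h * P"
      unfolding P_def using fin by (intro dvd_mult dvd_prodI) auto
    from rhom.dvd[OF rhom_eval2 this, of x y] show ?thesis by (simp add: eval2_simps)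
  next
    case False
    then obtain X Y C where p: "param G (eval2 G x y) X Y C" using ex_param by blast
    have "G - const2 (eval2 G x y) dvd h * P"
      using param_curve_eq_0D[OF p] zero[OF _ _ p] False by auto
    from rhom.dvd[OF rhom_eval2 this, of x y] show ?thesis by (simp add: eval2_simps)
  qed
  then have "h * P = 0" by (rule eval2_zeroI)
  moreover have "P \<noteq> 0" unfolding P_def using fin G_minus_nonzero by simp
  ultimately show ?thesis by simp
qed

end

section \<open>Kernel, degree bounds and local nilpotence of the Jacobian derivation\<close>

context affine_line_pencil
begin

text \<open>A single good fibre suffices: \<open>h\<close> equals a constant b on it, so G - a
  divides h - b. The quotient is again in the kernel, because \<open>jac G\<close> kills G - a, and
  it has smaller \<open>bisize\<close>.\<close>

lemma ker_jac:
  assumes "jac G h = 0"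
  shows "\<exists>D. h = ucomp D G"
  using assms
proof (induction "bisize h" arbitrary: h rule: less_induct)
  case less
  obtain a where "a \<notin> E" using finite_E ex_new_if_finite infinite_UNIV_char_0 by blast
  from ex_param[OF this] obtain X Y C where p: "param G a X Y C" by blast
  from param_jac[OF p] obtain c where c: "c \<noteq> 0" "\<And>h. curve (jac G h) X Y = smult c (pderiv (curve h X Y))"
    by blast
  have "pderiv (curve h X Y) = 0"
    using c(2)[of h] c(1) less.prems by (simp add: curve_simps)
  then obtain b where b: "curve h X Y = [:b:]"
    by (metis pderiv_eq_0_iff degree_eq_zeroE)
  have "G - const2 a dvd h - const2 b"
    by (rule param_curve_eq_0D[OF p]) (simp add: curve_simps b)
  then obtain h1 where h1: "h - const2 b = (G - const2 a) * h1" by (elim dvdE)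
  have "jac G (h - const2 b) = (G - const2 a) * jac G h1"
    unfolding h1 by (simp add: derivation.mult[OF derivation_jac] derivation.diff[OF derivation_jac])
  then have ker1: "jac G h1 = 0"
    using less.prems G_minus_nonzero by (simp add: derivation.diff[OF derivation_jac])
  have h: "h = const2 b + (G - const2 a) * h1" using h1 by (simp add: diff_eq_eq add.commute)
  show ?case
  proof (cases "h1 = 0")
    case True
    then have "h = ucomp [:b:] G" using h by simp
    then show ?thesis by blast
  next
    case False
    then have "bisize h1 < bisize (h - const2 b)"
      unfolding h1 using bisize_mult[OF G_minus_nonzero False] bisize_G by simp
    then have "bisize h1 < bisize h" using bisize_diff_const2[of h b] by linarith
    from less.hyps[OF this ker1] obtain D where "h1 = ucomp D G" by blast
    with h have "h = ucomp ([:b:] + [:- a, 1:] * D) G"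
      by (simp only: ucomp_simps) (simp add: const2_hom algebra_simps)
    then show ?thesis by blast
  qed
qed

text \<open>A general value c is taken by \<open>X\<close> at degree-of-X many parameters. They give
  distinct points of the fibre, since \<open>C\<close> recovers the parameter from the point, and
  all these points lie on the line x = c, where G - a has at most \<open>degree G\<close>
  zeros.\<close>

lemma bounded_degree_X:
  assumes p: "param G a X Y C"
  shows "degree X \<le> degree G"
proof (cases "degree X > 0")
  case True
  define B where "B = {c. map_poly (\<lambda>q. poly q c) (G - const2 a) = 0}"
  have "finite B" unfolding B_def by (rule finite_specialization_zero[OF G_minus_nonzero])
  then obtain c where c: "c \<notin> B" "card {s. poly X s = c} = degree X"
    using exists_full_fibre[OF True] by blast
  let ?g = "map_poly (\<lambda>q. poly q c) (G - const2 a)"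
  have g0: "?g \<noteq> 0" using c(1) by (simp add: B_def)
  have C: "eval2 C (poly X s) (poly Y s) = s" and G: "eval2 G (poly X s) (poly Y s) = a" for s
    using p by (simp_all add: param_def flip: poly_curve)
  have "card {s. poly X s = c} \<le> card {y. poly ?g y = 0}"
  proof (rule card_inj_on_le[of "poly Y"])
    show "inj_on (poly Y) {s. poly X s = c}"
      by (rule inj_onI) (metis (mono_tags, lifting) C mem_Collect_eq)
    show "poly Y ` {s. poly X s = c} \<subseteq> {y. poly ?g y = 0}"
      using G by (auto simp: eval2_map_poly eval2_simps)
    show "finite {y. poly ?g y = 0}" using g0 by (rule poly_roots_finite)
  qed
  also have "\<dots> \<le> degree ?g" using g0 by (rule card_poly_roots_bound)
  also have "\<dots> \<le> degree (G - const2 a)" by (rule map_poly_degree_leq)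
  also have "\<dots> \<le> degree G" by (intro degree_diff_le) (auto simp: const2_def)
  finally show ?thesis using c(2) by simp
qed simp

lemma degree_poly_const_le:
  fixes p :: "'b::idom poly poly"
  assumes "\<And>i. degree (coeff p i) \<le> n"
  shows "degree (poly p [:c:]) \<le> n"
  using assms
proof (induction p)
  case (pCons a p)
  have "degree (poly p [:c:]) \<le> n"
    using pCons.prems[of "Suc _"] by (intro pCons.IH) simp
  moreover have "degree a \<le> n" using pCons.prems[of 0] by simp
  moreover have "degree ([:c:] * poly p [:c:]) \<le> degree (poly p [:c:])" by (simp add: degree_smult_le)
  ultimately show ?case by (auto intro!: degree_add_le)
qed simp

lemma const2_eval: "poly (poly (const2 a) [:c:]) x = a"
  and X2_eval: "poly (poly X2 [:c:]) x = x"
  and Y2_eval: "poly (poly Y2 [:c:]) x = c"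
  by (simp_all add: const2_def X2_def Y2_def)

lemma eval2_swap:
  fixes p :: "'b::comm_ring_1 poly poly"
  shows "poly (poly p [:c:]) x = eval2 p x c"
  by (rule rhom2_eqI[where p = p])
    (auto intro: rhom_comp[OF rhom_poly rhom_poly] rhom_eval2 simp: const2_eval X2_eval Y2_eval)

text \<open>The same count on lines y = c. The degree of \<open>G\<close> in x, which is the largest
  degree among its coefficients, replaces the degree in y.\<close>

lemma bounded_degree_Y:
  assumes p: "param G a X Y C"
  shows "degree Y \<le> Max ((\<lambda>i. degree (coeff G i)) ` {..degree G})"
proof (cases "degree Y > 0")
  case True
  define N where "N = Max ((\<lambda>i. degree (coeff G i)) ` {..degree G})"
  have N: "degree (coeff G i) \<le> N" for i
    by (cases "i \<le> degree G") (auto simp: N_def coeff_eq_0)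
  \<comment> \<open>A line y = c contained in the fibre makes the constant polynomial
    \<open>[:c:]\<close> a root of G - a, read as a polynomial in y over k[x]; so there are finitely
    many such c.\<close>
  define B where "B = {c. poly (G - const2 a) [:c:] = 0}"
  have "(\<lambda>c. [:c:]) ` B \<subseteq> {c. poly (G - const2 a) c = 0}" by (auto simp: B_def)
  then have "finite ((\<lambda>c. [:c:]) ` B)"
    using poly_roots_finite[OF G_minus_nonzero[of a]] finite_subset by blast
  then have "finite B" by (rule finite_imageD) (auto simp: inj_on_def)
  then obtain c where c: "c \<notin> B" "card {s. poly Y s = c} = degree Y"
    using exists_full_fibre[OF True] by blast
  let ?g = "poly (G - const2 a) [:c:]"
  have g0: "?g \<noteq> 0" using c(1) by (simp add: B_def)
  have C: "eval2 C (poly X s) (poly Y s) = s" and G: "eval2 G (poly X s) (poly Y s) = a" for s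
    using p by (simp_all add: param_def flip: poly_curve)
  have "card {s. poly Y s = c} \<le> card {y. poly ?g y = 0}"
  proof (rule card_inj_on_le[of "poly X"])
    show "inj_on (poly X) {s. poly Y s = c}"
      by (rule inj_onI) (metis (mono_tags, lifting) C mem_Collect_eq)
    show "poly X ` {s. poly Y s = c} \<subseteq> {y. poly ?g y = 0}"
      unfolding eval2_swap using G by (auto simp: eval2_simps)
    show "finite {y. poly ?g y = 0}" using g0 by (rule poly_roots_finite)
  qed
  also have "\<dots> \<le> degree ?g" using g0 by (rule card_poly_roots_bound)
  also have "\<dots> \<le> N"
  proof (rule degree_poly_const_le)
    show "degree (coeff (G - const2 a) i) \<le> N" for i
      using N[of i] by (auto intro!: degree_diff_le simp: const2_def coeff_pCons split: nat.splits)
  qed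
  finally show ?thesis using c(2) by (simp add: N_def)
qed simp

lemma bounded_degree: "\<exists>N. \<forall>a X Y C. param G a X Y C \<longrightarrow> degree (curve h X Y) \<le> N"
proof (induction h rule: bipoly_induct)
  case (add p q)
  then obtain M N where "\<forall>a X Y C. param G a X Y C \<longrightarrow> degree (curve p X Y) \<le> M"
    "\<forall>a X Y C. param G a X Y C \<longrightarrow> degree (curve q X Y) \<le> N" by blast
  then show ?case
    by (intro exI[of _ "max M N"]) (fastforce simp: curve_simps intro!: degree_add_le)
next
  case (mult p q)
  then obtain M N where MN: "\<forall>a X Y C. param G a X Y C \<longrightarrow> degree (curve p X Y) \<le> M"
    "\<forall>a X Y C. param G a X Y C \<longrightarrow> degree (curve q X Y) \<le> N" by blast
  have "degree (curve (p * q) X Y) \<le> M + N" if "param G a X Y C" for a X Y C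
    using degree_mult_le[of "curve p X Y" "curve q X Y"] MN that
    by (fastforce simp: curve_simps)
  then show ?case by blast
next
  case X
  show ?case unfolding curve_gens using bounded_degree_X by blast
next
  case Y
  show ?case unfolding curve_gens using bounded_degree_Y by blast
qed simp

lemma jac_funpow_curve:
  assumes c: "\<And>h. curve (jac G h) X Y = smult c (pderiv (curve h X Y))"
  shows "curve ((jac G ^^ n) h) X Y = smult (c ^ n) ((pderiv ^^ n) (curve h X Y))"
  by (induction n) (simp_all add: c pderiv_smult)

lemma jac_nilpotent: "\<exists>n. (jac G ^^ n) h = 0"
proof -
  obtain N where N: "\<And>a X Y C. param G a X Y C \<Longrightarrow> degree (curve h X Y) \<le> N"
    using bounded_degree by blast
  have "(jac G ^^ Suc N) h = 0"
  proof (rule zero_if_curves_zero[of "{}"])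
    fix a X Y C
    assume p: "param G a X Y C"
    from param_jac[OF p] obtain c where c: "\<And>h. curve (jac G h) X Y = smult c (pderiv (curve h X Y))"
      by blast
    show "curve ((jac G ^^ Suc N) h) X Y = 0"
      unfolding jac_funpow_curve[OF c] using N[OF p] by (simp only: pderiv_funpow_eq_0 less_Suc_eq_le smult_0_right)
  qed simp
  then show ?thesis by blast
qed

section \<open>Local slices and the coordinate system \<open>(G, T)\<close>\<close>

lemma near_slice_exists: "\<exists>T D. jac G T = ucomp D G \<and> D \<noteq> 0"
proof -
  have "\<exists>h. jac G h \<noteq> 0"
  proof (rule ccontr)
    assume "\<not> ?thesis"
    then have g: "dy2 G = 0" "dx2 G = 0"
      by (metis jac_simps(3), metis jac_simps(4) neg_equal_0_iff_equal)
    obtain a where "a \<notin> E" using finite_E ex_new_if_finite infinite_UNIV_char_0 by blast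
    from ex_param[OF this] obtain X Y C where "param G a X Y C" by blast
    from param_grad[OF this] show False by (simp add: g eval2_simps)
  qed
  then obtain h where h: "jac G h \<noteq> 0" by blast
  define n where "n = (LEAST n. (jac G ^^ n) h = 0)"
  have n: "(jac G ^^ n) h = 0" unfolding n_def using jac_nilpotent by (rule LeastI_ex)
  have least: "(jac G ^^ m) h \<noteq> 0" if "m < n" for m
    using that not_less_Least unfolding n_def by blast
  have j0: "jac G 0 = 0" by (rule derivation.zero[OF derivation_jac])
  have "n \<noteq> 0" "n \<noteq> 1" using n h j0 by (auto intro: ccontr)
  then obtain m where m: "n = Suc (Suc m)" by (metis One_nat_def not0_implies_Suc)
  \<comment> \<open>Since m = n - 2, applying \<open>jac G\<close> once more gives a nonzero element
    and applying it twice more gives 0.\<close>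
  let ?T = "(jac G ^^ m) h"
  have "jac G (jac G ?T) = 0" using n m by simp
  then obtain D where D: "jac G ?T = ucomp D G" using ker_jac by blast
  moreover have "jac G ?T \<noteq> 0" using least[of "Suc m"] m by simp
  then have "D \<noteq> 0" using D by auto
  ultimately show ?thesis by blast
qed

lemma jac_funpow_linear:
  "(jac G ^^ n) (p + q) = (jac G ^^ n) p + (jac G ^^ n) q"
  "jac G k = 0 \<Longrightarrow> (jac G ^^ n) (k * p) = k * (jac G ^^ n) p"
  by (induction n) (simp_all add: derivation.add[OF derivation_jac] derivation.mult[OF derivation_jac])

lemma jac_ucomp_G: "jac G (ucomp w G) = 0"
  by (simp add: chain_rule_ucomp[OF derivation_jac])

lemma jac_funpow_slice_power:
  assumes "jac G T = ucomp D G"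
  shows "(jac G ^^ n) (T ^ n) = of_nat (fact n) * ucomp D G ^ n"
proof (induction n)
  case (Suc n)
  have "(jac G ^^ Suc n) (T ^ Suc n) = (jac G ^^ n) (jac G (T ^ Suc n))"
    by (simp add: funpow_swap1)
  also have "jac G (T ^ Suc n) = (of_nat (Suc n) * ucomp D G) * T ^ n"
    by (simp only: derivation.power[OF derivation_jac] assms) simp
  also have "(jac G ^^ n) \<dots> = (of_nat (Suc n) * ucomp D G) * (jac G ^^ n) (T ^ n)"
    by (rule jac_funpow_linear)
      (simp only: derivation.mult[OF derivation_jac] derivation.of_nat[OF derivation_jac] jac_ucomp_G
        mult_zero_left mult_zero_right add_0)
  finally show ?case by (simp add: Suc algebra_simps)
qed simp

lemma ucomp_fact: "ucomp (fact n) u = fact n"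
  using rhom.of_nat[OF rhom_ucomp, of "fact n" u] by simp

lemma pcompose_const_right: "pcompose w [:a:] = [:poly w a:]"
  by (induction w) (simp_all add: pcompose_pCons mult.commute)

text \<open>The expansion of \<open>h\<close> in powers of the slice \<open>T\<close>, with
  denominators cleared. If the n-th iterate maps h to e(G), it maps T^n to n! D(G)^n. Hence n!
  D(G)^n h - e(G) T^n is killed by the n-th iterate and the induction applies to it.\<close>

lemma near_slice_rep:
  assumes T: "jac G T = ucomp D G" "D \<noteq> 0"
  shows "(jac G ^^ n) h = 0 \<Longrightarrow> \<exists>P W. P \<noteq> 0 \<and> ucomp P G * h = subst2 W G T"
proof (induction n arbitrary: h)
  case 0
  then show ?case by (intro exI[of _ 1] exI[of _ 0]) (simp add: subst2_simps)
next
  case (Suc n)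
  then have "jac G ((jac G ^^ n) h) = 0" by simp
  then obtain e where e: "(jac G ^^ n) h = ucomp e G" using ker_jac by blast
  define k where "k = of_nat (fact n) * D ^ n"
  define h' where "h' = ucomp k G * h + (- ucomp e G) * T ^ n"
  have neg: "jac G (- ucomp e G) = 0" by (simp add: derivation.minus[OF derivation_jac] jac_ucomp_G)
  have "(jac G ^^ n) h' = ucomp k G * ucomp e G + (- ucomp e G) * (of_nat (fact n) * ucomp D G ^ n)"
    by (simp only: h'_def jac_funpow_linear jac_ucomp_G neg e jac_funpow_slice_power[OF T(1)])
  then have "(jac G ^^ n) h' = 0"
    by (simp add: k_def ucomp_simps ucomp_fact algebra_simps)
  from Suc.IH[OF this] obtain P W where PW: "P \<noteq> 0" "ucomp P G * h' = subst2 W G T" by blast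
  have "ucomp (P * k) G * h = ucomp P G * h' + ucomp (P * e) G * T ^ n"
    by (simp add: h'_def ucomp_simps algebra_simps)
  also have "\<dots> = subst2 (W + ucomp (P * e) X2 * Y2 ^ n) G T"
    by (simp add: PW subst2_simps subst2_ucomp)
  finally have "ucomp (P * k) G * h = subst2 (W + ucomp (P * e) X2 * Y2 ^ n) G T" .
  moreover have "P * k \<noteq> 0" using PW(1) T(2) by (simp add: k_def)
  ultimately show ?case by blast
qed

text \<open>On a fibre over a with w(a) nonzero, u v restricts to a nonzero constant polynomial in
  the parameter, so \<open>u\<close> restricts to a constant. The roots of \<open>w\<close> join the
  excluded values.\<close>

lemma ker_factorially_closed:
  assumes "u * v = ucomp w G" "w \<noteq> 0"
  shows "jac G u = 0"
proof (rule zero_if_curves_zero[of "{a. poly w a = 0}"])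
  show "finite {a. poly w a = 0}" using assms(2) by (rule poly_roots_finite)
  fix a X Y C
  assume a: "a \<notin> {a. poly w a = 0}" and p: "param G a X Y C"
  from param_jac[OF p] obtain c where c: "\<And>h. curve (jac G h) X Y = smult c (pderiv (curve h X Y))"
    by blast
  have "curve u X Y * curve v X Y = curve (ucomp w G) X Y"
    by (simp add: assms(1) flip: curve_simps)
  also have "\<dots> = [:poly w a:]"
    using p by (simp add: curve_ucomp param_def pcompose_const_right)
  finally have "degree (curve u X Y * curve v X Y) = 0" "curve u X Y * curve v X Y \<noteq> 0"
    using a by auto
  then have "degree (curve u X Y) = 0" by (auto simp: degree_mult_eq)
  then show "curve (jac G u) X Y = 0" by (simp add: c pderiv_eq_0_iff)
qed

lemma ucomp_G_inj:
  assumes "ucomp w G = 0"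
  shows "w = 0"
proof (rule ccontr)
  assume "w \<noteq> 0"
  then have "finite ({a. poly w a = 0} \<union> E)" using poly_roots_finite finite_E by blast
  then obtain a where a: "poly w a \<noteq> 0" "a \<notin> E"
    using ex_new_if_finite[OF infinite_UNIV_char_0] by blast
  from ex_param[OF a(2)] obtain X Y C where "param G a X Y C" by blast
  then have "curve (ucomp w G) X Y = [:poly w a:]"
    by (simp add: curve_ucomp param_def pcompose_const_right)
  with assms a show False by (simp add: curve_simps)
qed

text \<open>Both factors of G - r lie in the kernel k[G], so the factorization comes from one of a
  linear univariate polynomial, in which one factor is a nonzero constant.\<close>

lemma fibre_prime: "prime_elem (G - const2 r)"
proof -
  have "irreducible (G - const2 r)"
  proof (rule irreducibleI)
    show "G - const2 r \<noteq> 0" by (rule G_minus_nonzero)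
    show "\<not> G - const2 r dvd 1" using not_unit[of 1 r] by simp
    fix u v
    assume uv: "G - const2 r = u * v"
    then have "u * v = ucomp [:- r, 1:] G" by (simp add: const2_hom)
    then have "jac G u = 0" "jac G v = 0"
      using ker_factorially_closed[of u v "[:- r, 1:]"] ker_factorially_closed[of v u "[:- r, 1:]"]
      by (auto simp: mult.commute)
    then obtain p q where pq: "u = ucomp p G" "v = ucomp q G" using ker_jac by metis
    have "ucomp (p * q - [:- r, 1:]) G = 0"
      using uv by (simp only: ucomp_simps pq) (simp add: const2_hom)
    then have pq_eq: "p * q = [:- r, 1:]" using ucomp_G_inj by (metis eq_iff_diff_eq_0)
    then have "degree (p * q) = 1" "p * q \<noteq> 0" by auto
    then have "degree p = 0 \<or> degree q = 0" "p \<noteq> 0" "q \<noteq> 0" by (auto simp: degree_mult_eq)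
    moreover have "ucomp p G dvd 1" if "degree p = 0" "p \<noteq> 0" for p
    proof -
      from that obtain c where c: "p = [:c:]" "c \<noteq> 0" by (auto elim: degree_eq_zeroE)
      then have "const2 c * const2 (inverse c) = 1" by (simp flip: const2_hom(2))
      then show ?thesis using dvdI[of 1 "const2 c"] c by simp
    qed
    ultimately show "u dvd 1 \<or> v dvd 1" using pq by blast
  qed
  then show ?thesis by (rule irreducible_imp_prime_elem)
qed

lemma coordinate_mate:
  "\<exists>T D. jac G T = ucomp D G \<and> D \<noteq> 0 \<and> (\<forall>h. \<exists>W. h = subst2 W G T)"
proof -
  define Q where "Q T D \<longleftrightarrow> jac G T = ucomp D G \<and> D \<noteq> 0" for T D
  define n where "n = (LEAST n. \<exists>T D. Q T D \<and> degree D = n)"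
  have "\<exists>T D. Q T D \<and> degree D = n"
    unfolding n_def by (rule LeastI_ex) (use near_slice_exists in \<open>auto simp: Q_def\<close>)
  then obtain T D where TD: "Q T D" "degree D = n" by blast
  have least: "n \<le> degree D'" if "Q T' D'" for T' D'
    unfolding n_def using that by (intro Least_le) blast
  have T: "jac G T = ucomp D G" "D \<noteq> 0" using TD by (simp_all add: Q_def)
  have no_split: False if "G - const2 r dvd T - const2 c" for r c
  proof -
    from that obtain T' where "T - const2 c = (G - const2 r) * T'" by (elim dvdE)
    then have T': "T = const2 c + (G - const2 r) * T'" by (simp add: diff_eq_eq add.commute)
    have jT: "ucomp D G = (G - const2 r) * jac G T'"
      unfolding T(1)[symmetric] T' by (simp add: derivation.add[OF derivation_jac]
          derivation.mult[OF derivation_jac] derivation.diff[OF derivation_jac])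
    \<comment> \<open>Division of D by u - r with remainder D(r). Since G - r divides D(G), it
      divides the constant D(r), which must then be 0.\<close>
    have "[:- r, 1:] dvd D - [:poly D r:]" by (simp add: dvd_iff_poly_eq_0)
    then obtain D' where D1: "D - [:poly D r:] = [:- r, 1:] * D'" by (elim dvdE)
    then have D': "D = [:poly D r:] + [:- r, 1:] * D'" by (simp only: diff_eq_eq add.commute)
    have uD: "ucomp D G = const2 (poly D r) + (G - const2 r) * ucomp D' G"
      by (subst D', simp only: ucomp_simps) (simp add: const2_hom)
    have "const2 (poly D r) = (G - const2 r) * (jac G T' - ucomp D' G)"
      unfolding right_diff_distrib jT[symmetric] uD by simp
    then have "G - const2 r dvd const2 (poly D r)" by (rule dvdI)
    then have pr: "poly D r = 0" using not_unit by blast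
    then have DD': "D = [:- r, 1:] * D'" using D1 by simp
    have jT': "jac G T' = ucomp D' G"
      using uD jT G_minus_nonzero[of r] by (simp add: pr)
    have "D' \<noteq> 0" using T(2) DD' by auto
    then have "degree D = Suc (degree D')"
      unfolding DD' by (subst degree_mult_eq) auto
    moreover have "Q T' D'" using jT' \<open>D' \<noteq> 0\<close> by (simp add: Q_def)
    ultimately show False using least[of T' D'] TD(2) by simp
  qed
  have "\<exists>W. h = subst2 W G T" for h
  proof -
    \<comment> \<open>\<open>P\<close> runs over the denominators of \<open>h\<close> with respect
      to k[G, T]. One of least degree is shown to have no root, so it is a nonzero constant.\<close>
    define R where "R P \<longleftrightarrow> P \<noteq> 0 \<and> (\<exists>W. ucomp P G * h = subst2 W G T)" for P
    define m where "m = (LEAST m. \<exists>P. R P \<and> degree P = m)"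
    obtain k where "(jac G ^^ k) h = 0" using jac_nilpotent[of h] by blast
    from near_slice_rep[OF T this] obtain P0 where "R P0" unfolding R_def by blast
    then have "\<exists>P. R P \<and> degree P = m"
      unfolding m_def by (intro LeastI_ex[where P = "\<lambda>m. \<exists>P. R P \<and> degree P = m"]) blast
    then obtain P where "R P" "degree P = m" by blast
    then obtain W where P: "P \<noteq> 0" "ucomp P G * h = subst2 W G T" "degree P = m"
      unfolding R_def by blast
    have leastP: "m \<le> degree P'" if "R P'" for P'
      unfolding m_def using that by (intro Least_le) blast
    have "poly P r \<noteq> 0" for r
    proof
      assume "poly P r = 0"
      then have "[:- r, 1:] dvd P" by (simp add: poly_eq_0_iff_dvd)
      then obtain P' where P': "P = [:- r, 1:] * P'" by (elim dvdE)
      have P'0: "P' \<noteq> 0" using P(1) P' by auto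
      have uP: "ucomp P G = (G - const2 r) * ucomp P' G"
        unfolding P' by (simp only: ucomp_simps) (simp add: const2_hom)
      \<comment> \<open>G - r divides P(G) h = W(G, T), hence also W(r, T). If W(r, v) is the zero
        polynomial, G - r cancels from the relation, against the minimality of \<open>P\<close>.
        Otherwise the prime G - r divides some T - c, which \<open>no_split\<close> rules
        out.\<close>
      show False
      proof (cases "map_poly (\<lambda>q. poly q r) W = 0")
        case True
        then obtain W' where W': "W = [:[:- r, 1:]:] * W'" using map_poly_poly_eq_0D[OF True] by blast
        have "[:[:- r, 1:]:] = X2 - const2 r" by (simp add: X2_def const2_def)
        then have "(G - const2 r) * (ucomp P' G * h) = (G - const2 r) * subst2 W' G T"
          using P(2) unfolding W' uP by (simp only: subst2_simps subst2_gens mult.assoc)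
        then have "ucomp P' G * h = subst2 W' G T" using G_minus_nonzero[of r] by simp
        then have "R P'" using P'0 by (auto simp: R_def)
        then have "degree P \<le> degree P'" using leastP P(3) by simp
        moreover have "degree P = Suc (degree P')"
          unfolding P' using P'0 by (subst degree_mult_eq) auto
        ultimately show False by simp
      next
        case False
        have "G - const2 r dvd subst2 W G T - subst2 W (const2 r) T"
          by (rule subst2_cong_dvd) simp_all
        moreover have "G - const2 r dvd subst2 W G T"
          unfolding P(2)[symmetric] uP by simp
        ultimately have "G - const2 r dvd ucomp (map_poly (\<lambda>q. poly q r) W) T"
          unfolding subst2_const_left[symmetric] by (simp only: dvd_diff_right_iff)
        from prime_dvd_ucomp[OF fibre_prime this False] no_split show False by blast
      qed
    qed
    from root_free_const[OF this] obtain c where c: "c \<noteq> 0" "P = [:c:]" by blast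
    have "h = const2 (inverse c * c) * h"
      using c(1) by simp
    also have "\<dots> = const2 (inverse c) * (const2 c * h)"
      by (simp only: const2_hom mult.assoc)
    also have "\<dots> = subst2 (const2 (inverse c) * W) G T"
      using P(2) c by (simp add: subst2_simps)
    finally show ?thesis by (rule exI)
  qed
  with T show ?thesis by (intro exI[of _ T] exI[of _ D]) simp
qed

text \<open>Generation by \<open>G\<close> and \<open>T\<close> supplies \<open>P\<close> and
  \<open>Q\<close>; the two reverse identities need algebraic independence. If h(G, T) = 0, choose a
  fibre over a with D(a) nonzero: there \<open>T\<close> restricts to a nonconstant polynomial,
  which takes every value v, so h(a, v) = 0 for all v. This fails for all but finitely many a unless
  h = 0.\<close>

theorem coordinate:
  "\<exists>T P Q. subst2 P G T = X2 \<and> subst2 Q G T = Y2 \<and> subst2 G P Q = X2 \<and> subst2 T P Q = Y2"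
proof -
  obtain T D where T: "jac G T = ucomp D G" "D \<noteq> 0" "\<forall>h. \<exists>W. h = subst2 W G T"
    using coordinate_mate by blast
  obtain P where P: "X2 = subst2 P G T" using T(3) by blast
  obtain Q where Q: "Y2 = subst2 Q G T" using T(3) by blast
  note PQ = P[symmetric] Q[symmetric]
  have inj: "h = 0" if h: "subst2 h G T = 0" for h
  proof (rule eval2_zeroI, rule ccontr)
    fix x y assume "eval2 h x y \<noteq> 0"
    then have "h \<noteq> 0" by (auto simp: eval2_simps)
    then have fin: "finite ({a. poly D a = 0} \<union> E \<union> {c. map_poly (\<lambda>q. poly q c) h = 0})"
      using T(2) by (simp add: poly_roots_finite finite_E finite_specialization_zero)
    obtain a where "a \<notin> {a. poly D a = 0} \<union> E \<union> {c. map_poly (\<lambda>q. poly q c) h = 0}"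
      using ex_new_if_finite[OF infinite_UNIV_char_0 fin] by (rule exE)
    then have a: "poly D a \<noteq> 0" "a \<notin> E" "map_poly (\<lambda>q. poly q a) h \<noteq> 0"
      by simp_all
    from ex_param[OF a(2)] obtain X Y C where p: "param G a X Y C" by blast
    from param_jac[OF p] obtain c where c: "\<And>h. curve (jac G h) X Y = smult c (pderiv (curve h X Y))"
      by blast
    have curveG: "curve G X Y = [:a:]" using p by (simp add: param_def)
    define t where "t = curve T X Y"
    have "smult c (pderiv t) = [:poly D a:]"
      using c[of T] by (simp add: t_def T(1) curve_ucomp curveG pcompose_const_right)
    then have "pderiv t \<noteq> 0" using a(1) by auto
    then have "degree t > 0" by (simp add: pderiv_eq_0_iff)
    have "poly (map_poly (\<lambda>q. poly q a) h) v = 0" for v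
    proof -
      have "degree (t - [:v:]) > 0"
        using \<open>degree t > 0\<close> by (simp only: diff_conv_add_uminus degree_add_eq_left minus_pCons
            minus_zero degree_pCons_0)
      from alg_closed_imp_poly_has_root[OF this] obtain s where s: "poly t s = v"
        by auto
      have "poly (curve (subst2 h G T) X Y) s = eval2 h a v"
        by (simp add: curve_subst2 poly_curve curveG s flip: t_def)
      then show ?thesis by (simp add: eval2_map_poly h curve_simps)
    qed
    then have "map_poly (\<lambda>q. poly q a) h = 0"
      using poly_all_0_iff_0 by blast
    with a(3) show False by blast
  qed
  have inv: "subst2 (subst2 h G T) P Q = h" for h
  proof -
    have "subst2 (subst2 (subst2 h G T) P Q - h) G T = 0"
      by (simp add: subst2_simps subst2_subst2 PQ)
    from inj[OF this] show ?thesis by simp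
  qed
  have "subst2 G P Q = X2" "subst2 T P Q = Y2"
    using inv[of X2] inv[of Y2] by simp_all
  with PQ show ?thesis by (intro exI[of _ T] exI[of _ P] exI[of _ Q]) simp
qed

end

subsection \<open>Curves meeting the generic line of a pencil once\<close>

lemma linear_conv: "[:b, l:] = ucomp b X2 + ucomp l X2 * Y2"
  by (simp add: ucomp_X2 Y2_def)

lemma subst2_linear:
  fixes U V :: "'a::comm_ring_1 poly poly"
  shows "subst2 [:b, l:] U V = ucomp b U + ucomp l U * V"
  unfolding linear_conv by (simp add: subst2_simps subst2_ucomp)

lemma eval2_linear: "eval2 [:b, l:] u v = poly b u + poly l u * (v :: 'a::comm_ring_1)"
  unfolding linear_conv by (simp add: eval2_simps)

definition smooth_points :: "'a::idom poly poly \<Rightarrow> bool" where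
  "smooth_points F \<longleftrightarrow> (\<forall>x y. eval2 F x y = 0 \<longrightarrow> eval2 (dx2 F) x y \<noteq> 0 \<or> eval2 (dy2 F) x y \<noteq> 0)"

text \<open>By the chain rule both partial derivatives of \<open>F\<close> at the point (P, Q)(u, v)
  are combinations of those of \<open>f\<close> at (u, v).\<close>

lemma smooth_points_subst2:
  fixes F :: "'a::idom poly poly"
  assumes F: "F = subst2 f G T" and sm: "smooth_points F"
    and inv: "subst2 G P Q = X2" "subst2 T P Q = Y2"
  shows "smooth_points f"
  unfolding smooth_points_def
proof (intro allI impI, rule ccontr)
  fix u v
  assume f: "eval2 f u v = 0" and "\<not> (eval2 (dx2 f) u v \<noteq> 0 \<or> eval2 (dy2 f) u v \<noteq> 0)"
  then have df: "eval2 (dx2 f) u v = 0" "eval2 (dy2 f) u v = 0" by auto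
  let ?x = "eval2 P u v" and ?y = "eval2 Q u v"
  have GT: "eval2 G ?x ?y = u" "eval2 T ?x ?y = v"
    by (simp_all add: inv flip: eval2_subst2)
  have "eval2 F ?x ?y = 0" by (simp add: F eval2_subst2 GT f)
  moreover have "eval2 (dx2 F) ?x ?y = 0" "eval2 (dy2 F) ?x ?y = 0"
    unfolding F chain_rule_subst2[OF derivation_dx2 dx2_const2] chain_rule_subst2[OF derivation_dy2 dy2_gens(1)]
    by (simp_all add: eval2_simps eval2_subst2 GT df)
  ultimately show False using sm by (auto simp: smooth_points_def)
qed

lemma single_root_poly:
  fixes g :: "'a::{alg_closed_field, field_char_0} poly"
  assumes "card {v. poly g v = 0} = 1"
  obtains s where "g = smult (lead_coeff g) ([:- s, 1:] ^ degree g)" "poly g s = 0"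
proof -
  from assms obtain s where s: "{v. poly g v = 0} = {s}" by (auto simp: card_1_singleton_iff)
  have "g \<noteq> 0"
  proof
    assume "g = 0"
    with s have "(UNIV :: 'a set) = {s}" by auto
    then have "finite (UNIV :: 'a set)" by (metis finite.emptyI finite.insertI)
    then show False using infinite_UNIV_char_0 by blast
  qed
  then obtain A where A: "size A = degree g" "g = smult (lead_coeff g) (\<Prod>x\<in>#A. [:- x, 1:])"
    using alg_closed_imp_factorization by blast
  have "x = s" if "x \<in># A" for x
  proof -
    have "poly (\<Prod>x\<in>#A. [:- x, 1:]) x = 0"
      using that by (auto simp: poly_prod_mset prod_mset_zero_iff)
    then have "poly g x = 0" by (subst A(2)) simp
    then show ?thesis using s by blast
  qed
  then have "A = replicate_mset (degree g) s"
    using A(1) by (metis set_mset_subset_singletonD subsetI singletonI)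
  then have "g = smult (lead_coeff g) ([:- s, 1:] ^ degree g)"
    using A(2) by simp
  moreover have "poly g s = 0" using s by auto
  ultimately show ?thesis by (rule that)
qed

lemma degree_one_in_fibre_variable:
  fixes f :: "'a::{alg_closed_field, field_char_0} poly poly"
  assumes fin: "finite E" and one: "\<And>a. a \<notin> E \<Longrightarrow> card {v. eval2 f a v = 0} = 1"
    and smooth: "smooth_points f"
  shows "\<exists>b l. f = [:b, l:] \<and> l \<noteq> 0"
proof -
  define n where "n = degree f"
  define l where "l = lead_coeff f"
  have "f \<noteq> 0"
  proof
    assume "f = 0"
    obtain a where "a \<notin> E" using fin ex_new_if_finite infinite_UNIV_char_0 by blast
    from one[OF this] show False
      by (simp add: \<open>f = 0\<close> eval2_simps card.infinite[OF infinite_UNIV_char_0])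
  qed
  then have l0: "l \<noteq> 0" by (simp add: l_def)
  have n0: "n \<noteq> 0"
  proof
    assume "n = 0"
    then obtain q where q: "f = [:q:]" unfolding n_def by (elim degree_eq_zeroE)
    obtain a where "a \<notin> E" using fin ex_new_if_finite infinite_UNIV_char_0 by blast
    \<comment> \<open>The zero set on the line u = a is empty or the whole line, and
      \<open>card\<close> of an infinite set is 0 as well.\<close>
    from one[OF this] show False
      by (cases "poly q a = 0")
        (simp_all add: q eval2_def map_poly_pCons card.infinite[OF infinite_UNIV_char_0])
  qed
  define A where "A = {a. a \<notin> E \<and> poly l a \<noteq> 0}"
  have "finite (E \<union> {a. poly l a = 0})" using fin poly_roots_finite[OF l0] by simp
  moreover have "- A = E \<union> {a. poly l a = 0}" by (auto simp: A_def)
  ultimately have infA: "infinite A"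
    using infinite_UNIV_char_0[where 'a = 'a] by (metis Compl_partition finite_UnI)
  have "n = 1"
  proof (rule ccontr)
    assume "n \<noteq> 1"
    with n0 have n2: "n \<ge> 2" by simp
    \<comment> \<open>A polynomial with a single root is determined by its two leading coefficients; so
      \<open>n ^ n * l ^ (n - 1) * f = (n * l * v + b) ^ n\<close>, and all its zeros are singular.\<close>
    define b where "b = coeff f (n - 1)"
    define w where "w = [:b, of_nat n * l:]"
    define K where "K = ucomp (of_nat (n ^ n) * l ^ (n - 1)) X2"
    have fact: "\<exists>s. eval2 f a s = 0 \<and> (\<forall>v. eval2 f a v = poly l a * (v - s) ^ n)
        \<and> poly b a = - (of_nat n * poly l a * s)" if a: "a \<in> A" for a
    proof -
      define g where "g = map_poly (\<lambda>q. poly q a) f"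
      have g: "poly g v = eval2 f a v" for v by (simp add: g_def eval2_map_poly)
      have lg: "coeff g n = poly l a" by (simp add: g_def coeff_map_poly n_def l_def)
      have "degree g \<le> n" unfolding g_def n_def by (rule map_poly_degree_leq)
      moreover have "n \<le> degree g" using lg a by (intro le_degree) (simp add: A_def)
      ultimately have dg: "degree g = n" by simp
      have "card {v. poly g v = 0} = 1" using one[of a] a by (simp add: g A_def)
      from single_root_poly[OF this] obtain s where
        s: "g = smult (lead_coeff g) ([:- s, 1:] ^ degree g)" "poly g s = 0" .
      then have gs: "g = smult (poly l a) ([:- s, 1:] ^ n)" by (simp add: dg lg)
      have "poly b a = coeff g (n - 1)" by (simp add: g_def coeff_map_poly b_def)
      also have "\<dots> = - (of_nat n * poly l a * s)"
        using n2 binomial_symmetric[of 1 n] by (subst gs) (simp add: coeff_linear_poly_power)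
      finally have "poly b a = - (of_nat n * poly l a * s)" .
      moreover have "eval2 f a v = poly l a * (v - s) ^ n" for v
        unfolding g[symmetric] by (subst gs) simp
      ultimately show ?thesis using s(2) g by auto
    qed
    have w: "eval2 w a v = of_nat n * poly l a * (v - s)"
      if "poly b a = - (of_nat n * poly l a * s)" for a v s
      using that by (simp add: w_def eval2_linear algebra_simps)
    have Ka: "eval2 K a v = of_nat n ^ n * poly l a ^ (n - 1)" for a v
      by (simp add: K_def)
    have "K * f - w ^ n = 0"
    proof (rule ccontr)
      assume "K * f - w ^ n \<noteq> 0"
      from eval2_nonzero_exists[OF this infA infinite_UNIV_char_0]
      obtain a v where a: "a \<in> A" "eval2 (K * f - w ^ n) a v \<noteq> 0" by blast
      from fact[OF a(1)] obtain s where s: "\<forall>v. eval2 f a v = poly l a * (v - s) ^ n"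
        "poly b a = - (of_nat n * poly l a * s)" by blast
      have "poly l a ^ n = poly l a ^ (n - 1) * poly l a"
        using n0 power_minus_mult[of n "poly l a"] by simp
      then have "eval2 K a v * eval2 f a v = eval2 w a v ^ n"
        unfolding Ka s(1)[rule_format] w[OF s(2)] power_mult_distrib by (simp only: mult.assoc)
      then have "eval2 (K * f - w ^ n) a v = 0"
        by (simp only: eval2_simps) simp
      with a(2) show False by simp
    qed
    then have Kf: "K * f = w ^ n" by simp
    have "A \<noteq> {}" using infA by auto
    then obtain a where a: "a \<in> A" by blast
    from fact[OF a] obtain s where s: "eval2 f a s = 0" "poly b a = - (of_nat n * poly l a * s)" by blast
    have w0: "eval2 w a s = 0" using w[OF s(2)] by simp
    \<comment> \<open>At this point \<open>w\<close> vanishes, and n >= 2, so the derivative of w^n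
      vanishes. As \<open>f\<close> vanishes too, the derivative of K f reduces to K times that of
      \<open>f\<close>, where \<open>K\<close> is nonzero.\<close>
    have "eval2 (d f) a s = 0" if d: "derivation d" for d
    proof -
      have "d (K * f) = of_nat n * w ^ (n - 1) * d w"
        unfolding Kf by (rule derivation.power[OF d])
      then have "eval2 (d K * f + K * d f) a s = eval2 (of_nat n * w ^ (n - 1) * d w) a s"
        by (simp add: derivation.mult[OF d])
      then have "eval2 K a s * eval2 (d f) a s = 0"
        using n2 by (simp add: eval2_simps s(1) w0)
      moreover have "eval2 K a s \<noteq> 0" using a n0 by (simp add: Ka A_def)
      ultimately show ?thesis by simp
    qed
    from this[OF derivation_dx2] this[OF derivation_dy2] s(1) smooth show False
      by (auto simp: smooth_points_def)
  qed
  then have d1: "degree f = 1" by (simp add: n_def)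
  then have "f = [:coeff f 0, coeff f 1:]"
    by (intro poly_eqI) (auto simp: coeff_pCons coeff_eq_0 split: nat.splits)
  moreover have "coeff f 1 \<noteq> 0" using l0 d1 by (simp add: l_def)
  ultimately show ?thesis by blast
qed

subsection \<open>Recognizing the affine line and the punctured affine line\<close>

lemma coeffs_in_UNIV [simp]: "coeffs_in UNIV p"
  by (simp add: coeffs_in_def)

lemma const2_inverse: "c \<noteq> 0 \<Longrightarrow> const2 c * const2 (inverse (c :: 'a::field)) = 1"
  by (simp flip: const2_hom(2))

text \<open>In the coordinates (u, v) = (G, T) the curve is b(u) + c v = 0. The pair (G, F) is again
  a coordinate system, since v is recovered as (F - b(u)) / c, the polynomial \<open>Z\<close> at
  (u, F). This automorphism of the plane carries the curve to y = 0.\<close>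

lemma iso_A1:
  fixes F :: "'a::field poly poly"
  assumes F: "F = subst2 [:b, [:c:]:] G T" and c: "c \<noteq> 0"
    and inv: "subst2 P G T = X2" "subst2 Q G T = Y2" "subst2 G P Q = X2" "subst2 T P Q = Y2"
  shows "plane_curve_iso UNIV F A1_poly"
proof -
  define Z where "Z = const2 (inverse c) * (Y2 - ucomp b X2)"
  have F': "F = ucomp b G + const2 c * T" unfolding F subst2_linear by simp
  have cc: "const2 c * (const2 (inverse c) * p) = p" "const2 (inverse c) * (const2 c * p) = p" for p
    using const2_inverse[OF c] by (simp_all only: mult.assoc[symmetric] mult.commute[of "const2 (inverse c)" "const2 c"] mult_1_left)
  have "subst2 G (subst2 P X2 Z) (subst2 Q X2 Z) = X2" "subst2 T (subst2 P X2 Z) (subst2 Q X2 Z) = Z"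
    by (simp_all add: inv flip: subst2_subst2)
  then have FAB: "subst2 F (subst2 P X2 Z) (subst2 Q X2 Z) = Y2"
    and G: "subst2 G (subst2 P X2 Z) (subst2 Q X2 Z) = X2"
    by (simp_all add: F' subst2_simps subst2_ucomp Z_def cc)
  have "subst2 Z G F = T" by (simp add: Z_def F' subst2_simps subst2_ucomp cc)
  then have "subst2 (subst2 P X2 Z) G F = X2" "subst2 (subst2 Q X2 Z) G F = Y2"
    by (simp_all add: subst2_subst2 inv)
  then show ?thesis unfolding plane_curve_iso_def A1_poly_def
    by (intro exI[of _ "subst2 P X2 Z"] exI[of _ "subst2 Q X2 Z"] exI[of _ G] exI[of _ F])
      (simp add: FAB G)
qed

text \<open>The curve b(u) + c (u - r)^k v = 0 has no point with u = r, and elsewhere v is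
  determined by u, so u - r is a coordinate on a punctured line. The task is to express its inverse
  by a polynomial in u and v.\<close>

lemma iso_A1star:
  fixes F :: "'a::field poly poly"
  assumes F: "F = subst2 [:b, smult c ([:- r, 1:] ^ k):] G T" and c: "c \<noteq> 0" and k: "k > 0"
    and br: "poly b r \<noteq> 0"
    and inv: "subst2 P G T = X2" "subst2 Q G T = Y2" "subst2 G P Q = X2" "subst2 T P Q = Y2"
  shows "plane_curve_iso UNIV F A1star_poly"
proof -
  define \<beta> where "\<beta> = poly b r"
  have "[:- r, 1:] dvd b - [:\<beta>:]" by (simp add: dvd_iff_poly_eq_0 \<beta>_def)
  then obtain b1 where "b - [:\<beta>:] = [:- r, 1:] * b1" by (elim dvdE)
  then have b: "b = [:\<beta>:] + [:- r, 1:] * b1" by (simp only: diff_eq_eq add.commute)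
  have ub: "ucomp b u = const2 \<beta> + (u - const2 r) * ucomp b1 u" for u
    unfolding b by (simp only: ucomp_simps) (simp add: const2_hom)
  have ul: "ucomp (smult c ([:- r, 1:] ^ k)) u = const2 c * (u - const2 r) ^ k" for u
  proof -
    have "smult c ([:- r, 1:] ^ k) = [:c:] * [:- r, 1:] ^ k" by simp
    then show ?thesis by (simp only: ucomp_simps) (simp add: const2_hom)
  qed
  have F': "F = ucomp b G + const2 c * (G - const2 r) ^ k * T"
    unfolding F subst2_linear ul ..
  define ci where "ci = const2 (inverse c)"
  define \<beta>i where "\<beta>i = const2 (inverse \<beta>)"
  have ci: "ci * const2 c = 1" and \<beta>i: "\<beta>i * const2 \<beta> = 1"
    using const2_inverse[OF c] const2_inverse[OF br] by (simp_all add: ci_def \<beta>i_def \<beta>_def mult.commute)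
  \<comment> \<open>\<open>(U, V)\<close> parametrizes the curve by x = u - r. With y in the role of
    1 / x, the solution v = - b(u) / (c x^k) becomes a polynomial.\<close>
  define U where "U = X2 + const2 r"
  define V where "V = - (ci * Y2 ^ k * ucomp b U)"
  define C where "C = G - const2 r"
  \<comment> \<open>As b = \<beta> + (u - r) b1, the equation of the curve reads (u - r) (c (u -
    r)^(k - 1) v + b1(u)) = - \<beta>. So \<open>D\<close> inverts u - r on the curve.\<close>
  define D where "D = - (\<beta>i * (const2 c * C ^ (k - 1) * T + ucomp b1 G))"
  let ?A = "subst2 P U V" and ?B = "subst2 Q U V" and ?H = "X2 * Y2 - 1 :: 'a poly poly"
  have Ck: "C ^ k = C * C ^ (k - 1)" and Xk: "X2 ^ k = X2 * (X2 ^ (k - 1) :: 'a poly poly)"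
    and Yk: "Y2 ^ k = Y2 * (Y2 ^ (k - 1) :: 'a poly poly)"
    using k by (cases k; simp)+
  have GU: "subst2 G ?A ?B = U" and TV: "subst2 T ?A ?B = V"
    by (simp_all add: inv flip: subst2_subst2)
  have Ur: "U - const2 r = X2" by (simp add: U_def)
  have F_eq: "F = const2 \<beta> + C * ucomp b1 G + const2 c * C ^ k * T"
    unfolding F' ub C_def by simp
  have power_dvd: "p - 1 dvd p ^ m - 1" for p :: "'a poly poly" and m
    using power_diff_1_eq[of p m] by simp
  have "subst2 F ?A ?B = ucomp b U + const2 c * X2 ^ k * V"
    by (simp add: F' subst2_simps subst2_ucomp GU TV Ur)
  also have "\<dots> = ucomp b U - (ci * const2 c) * (X2 ^ k * Y2 ^ k * ucomp b U)"
    by (simp add: V_def algebra_simps)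
  also have "\<dots> = - (((X2 * Y2) ^ k - 1) * ucomp b U)"
    by (simp add: ci power_mult_distrib algebra_simps)
  finally have 1: "?H dvd subst2 F ?A ?B" using power_dvd[of "X2 * Y2" k] by simp
  have "C * D - 1 = - (\<beta>i * (const2 c * (C * C ^ (k - 1)) * T + C * ucomp b1 G)) - \<beta>i * const2 \<beta>"
    unfolding D_def \<beta>i by (simp add: algebra_simps)
  also have "\<dots> = - (\<beta>i * F)"
    unfolding F_eq Ck by (simp add: algebra_simps)
  finally have 2: "F dvd C * D - 1" by simp
  have UCD: "subst2 U C D = G" by (simp add: U_def C_def subst2_simps)
  have VCD: "subst2 V C D = - (ci * D ^ k * ucomp b G)"
    by (simp add: V_def ci_def subst2_simps subst2_ucomp UCD)
  have bG: "F - const2 c * C ^ k * T = ucomp b G"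
    by (simp add: F' C_def)
  have "subst2 V C D - T = - (ci * D ^ k * (F - const2 c * C ^ k * T)) - (ci * const2 c) * T"
    unfolding VCD bG ci by simp
  also have "\<dots> = - (ci * D ^ k * F) + (ci * const2 c) * (T * ((C * D) ^ k - 1))"
    by (simp add: power_mult_distrib algebra_simps)
  finally have "subst2 V C D - T = - (ci * D ^ k * F) + (ci * const2 c) * (T * ((C * D) ^ k - 1))" .
  moreover have "F dvd (C * D) ^ k - 1" using 2 power_dvd[of "C * D" k] by (rule dvd_trans)
  ultimately have "F dvd subst2 V C D - T"
    by (metis dvd_add dvd_minus_iff dvd_mult dvd_triv_right)
  then have 3: "F dvd subst2 p G (subst2 V C D) - subst2 p G T" for p
    by (intro subst2_cong_dvd) simp_all
  have 4: "subst2 C ?A ?B = X2" by (simp add: C_def subst2_simps GU Ur)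
  have "subst2 D ?A ?B = - (\<beta>i * (const2 c * X2 ^ (k - 1) * V + ucomp b1 U))"
    by (simp add: D_def \<beta>i_def subst2_simps subst2_ucomp 4 TV GU)
  also have "\<dots> - Y2 = \<beta>i * ((ci * const2 c) * (X2 ^ (k - 1) * Y2 ^ k * ucomp b U)) - \<beta>i * ucomp b1 U
      - \<beta>i * const2 \<beta> * Y2"
    unfolding \<beta>i by (simp add: V_def algebra_simps)
  also have "\<dots> = \<beta>i * (((X2 * Y2) ^ (k - 1) - 1) * (Y2 * ucomp b U) + ?H * ucomp b1 U)"
    unfolding ci Yk ub Ur by (simp add: power_mult_distrib algebra_simps)
  finally have 5: "?H dvd subst2 D ?A ?B - Y2"
    using power_dvd[of "X2 * Y2" "k - 1"] by (simp add: dvd_add)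
  have 6: "F dvd subst2 ?A C D - X2" "F dvd subst2 ?B C D - Y2"
    using 3[of P] 3[of Q] by (simp_all add: subst2_subst2 UCD inv)
  show ?thesis
    unfolding plane_curve_iso_def A1star_poly_def
    by (intro exI[of _ ?A] exI[of _ ?B] exI[of _ C] exI[of _ D])
      (use 1 2 4 5 6 in \<open>simp add: subst2_simps\<close>)
qed

subsection \<open>Sections of the curve function along rational curves\<close>

lemma exceptional_two_roots:
  fixes b l :: "'a::{alg_closed_field, field_char_0} poly"
  assumes r: "poly l r1 = 0" "poly l r2 = 0" "r1 \<noteq> r2"
  shows "\<exists>U0. \<forall>U V. pcompose b U + pcompose l U * V = [:0, 1:] \<longrightarrow> degree U \<noteq> 0 \<longrightarrow> U = U0"
proof (intro exI allI impI)
  fix U V :: "'a poly"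
  assume eq: "pcompose b U + pcompose l U * V = [:0, 1:]" and U: "degree U \<noteq> 0"
  define n where "n = degree U"
  define c where "c = lead_coeff U"
  have c0: "c \<noteq> 0" using U by (auto simp: c_def)
  \<comment> \<open>If \<open>U s = r\<close>, the hypothesis evaluated at \<open>s\<close> reads \<open>b r = s\<close>: so \<open>U - r\<close> has a single root.\<close>
  have shape: "U - [:r:] = smult c ([:- poly b r, 1:] ^ n)" if r: "poly l r = 0" for r
  proof -
    have deg: "degree (U - [:r:]) = n" "lead_coeff (U - [:r:]) = c"
    proof -
      show "degree (U - [:r:]) = n"
        unfolding diff_conv_add_uminus n_def using U by (intro degree_add_eq_left) simp
      then show "lead_coeff (U - [:r:]) = c"
        using U by (simp add: c_def n_def coeff_pCons split: nat.splits)
    qed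
    have root: "s = poly b r" if "poly (U - [:r:]) s = 0" for s
    proof -
      have "poly (pcompose b U + pcompose l U * V) s = s" by (simp add: eq)
      then show ?thesis using that r by (simp add: poly_pcompose)
    qed
    obtain s where "poly (U - [:r:]) s = 0"
      using alg_closed_imp_poly_has_root[of "U - [:r:]"] deg(1) U by (auto simp: n_def)
    with root have "{s. poly (U - [:r:]) s = 0} = {poly b r}" by blast
    then have "card {s. poly (U - [:r:]) s = 0} = 1" by simp
    from single_root_poly[OF this] obtain s where
      "U - [:r:] = smult c ([:- s, 1:] ^ n)" "poly (U - [:r:]) s = 0"
      unfolding deg(2) unfolding deg(1) .
    with root show ?thesis by blast
  qed
  define \<beta>1 where "\<beta>1 = poly b r1"
  define \<beta>2 where "\<beta>2 = poly b r2"
  have U1: "U = [:r1:] + smult c ([:- \<beta>1, 1:] ^ n)" and U2: "U = [:r2:] + smult c ([:- \<beta>2, 1:] ^ n)"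
    using shape[OF r(1)] shape[OF r(2)] by (simp_all only: diff_eq_eq add.commute \<beta>1_def \<beta>2_def)
  have neq: "\<beta>1 \<noteq> \<beta>2"
  proof
    assume "\<beta>1 = \<beta>2"
    then have "[:r1:] = [:r2:]" using U1 U2 by (simp only: add_right_cancel)
    with r(3) show False by simp
  qed
  \<comment> \<open>For n >= 2 the constants \<open>r1\<close> and \<open>r2\<close> do not reach
    the coefficient of s^(n - 1), so the two expressions for \<open>U\<close> would force \<beta>1 =
    \<beta>2.\<close>
  have "n = 1"
  proof (rule ccontr)
    assume "n \<noteq> 1"
    with U have n2: "n \<ge> 2" by (simp add: n_def)
    then have bin: "n choose (n - 1) = n" using binomial_symmetric[of 1 n] by simp
    have "coeff U (n - 1) = c * (of_nat n * (- \<beta>1))"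
      using n2 bin by (subst U1) (simp add: coeff_linear_poly_power coeff_eq_0)
    moreover have "coeff U (n - 1) = c * (of_nat n * (- \<beta>2))"
      using n2 bin by (subst U2) (simp add: coeff_linear_poly_power coeff_eq_0)
    ultimately show False using c0 n2 neq by simp
  qed
  then have U1': "U = [:r1 - c * \<beta>1, c:]" using U1 by simp
  \<comment> \<open>\<open>U\<close> is now the linear polynomial with values \<open>r1\<close> and
    \<open>r2\<close> at \<beta>1 and \<beta>2, hence determined by \<open>b\<close> and the two
    roots.\<close>
  have "poly U \<beta>2 = r2" using \<open>n = 1\<close> by (subst U2) simp
  then have "c * (\<beta>2 - \<beta>1) = r2 - r1" by (simp add: U1' algebra_simps)
  then have "c = (r2 - r1) / (\<beta>2 - \<beta>1)" using neq by (simp add: field_simps)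
  with U1' show "U = [:r1 - (r2 - r1) / (poly b r2 - poly b r1) * poly b r1,
      (r2 - r1) / (poly b r2 - poly b r1):]"
    by (simp add: \<beta>1_def \<beta>2_def)
qed

text \<open>Since (u - r)^2 divides \<open>l\<close> and u - r divides \<open>b\<close>, the left
  side is W Z with W = U - r. The product is s and W is not constant, so Z is a constant z and W = s
  / z. At s = 0 the part of Z coming from \<open>l\<close> still carries a factor W and vanishes,
  which leaves z = b1(r).\<close>

lemma exceptional_double_root:
  fixes b l :: "'a::{alg_closed_field, field_char_0} poly"
  assumes r: "poly l r = 0" "poly (pderiv l) r = 0" "poly b r = 0"
  shows "\<exists>U0. \<forall>U V. pcompose b U + pcompose l U * V = [:0, 1:] \<longrightarrow> degree U \<noteq> 0 \<longrightarrow> U = U0"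
proof -
  from r(1) have "[:- r, 1:] dvd l" by (simp add: poly_eq_0_iff_dvd)
  then obtain l1 where l1: "l = [:- r, 1:] * l1" by (elim dvdE)
  have "poly l1 r = 0" using r(2) unfolding l1 pderiv_mult by (simp add: pderiv_pCons)
  then have "[:- r, 1:] dvd l1" by (simp add: poly_eq_0_iff_dvd)
  then obtain l2 where l2: "l1 = [:- r, 1:] * l2" by (elim dvdE)
  from r(3) have "[:- r, 1:] dvd b" by (simp add: poly_eq_0_iff_dvd)
  then obtain b1 where b1: "b = [:- r, 1:] * b1" by (elim dvdE)
  show ?thesis
  proof (intro exI allI impI)
    fix U V :: "'a poly"
    assume eq: "pcompose b U + pcompose l U * V = [:0, 1:]" and U: "degree U \<noteq> 0"
    define W where "W = U - [:r:]"
    define Z where "Z = pcompose b1 U + W * pcompose l2 U * V"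
    have "pcompose [:- r, 1:] U = W" by (simp add: pcompose_pCons W_def)
    then have WZ: "W * Z = [:0, 1:]"
      unfolding eq[symmetric] l1 l2 b1 by (simp only: pcompose_mult) (simp add: Z_def algebra_simps)
    have dW: "degree W \<noteq> 0"
      unfolding W_def diff_conv_add_uminus using U by (subst degree_add_eq_left) auto
    have "W * Z \<noteq> 0" using WZ by simp
    then have "W \<noteq> 0" "Z \<noteq> 0" by auto
    then have "degree W + degree Z = 1" using degree_mult_eq[of W Z] by (simp add: WZ)
    then have dZ: "degree Z = 0" "degree W = 1" using dW by auto
    then obtain z where z: "Z = [:z:]" by (auto elim: degree_eq_zeroE)
    have zW: "smult z W = [:0, 1:]" using WZ by (simp add: z)
    then have z0: "z \<noteq> 0" by auto
    have W0: "W = [:0, inverse z:]"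
    proof -
      have "W = smult (inverse z) (smult z W)" using z0 by simp
      then show ?thesis by (simp add: zW)
    qed
    then have U': "U = [:r, inverse z:]" by (simp add: W_def diff_eq_eq)
    have "z = poly Z 0" by (simp add: z)
    also have "\<dots> = poly b1 r" by (simp add: Z_def W0 poly_pcompose U')
    finally show "U = [:r, inverse (poly b1 r):]" using U' by simp
  qed
qed

lemma const_root_multiplicity:
  fixes l :: "'a::alg_closed_field poly"
  assumes "l \<noteq> 0" and only: "\<And>s. poly l s = 0 \<Longrightarrow> s = r"
  shows "\<exists>c k. c \<noteq> 0 \<and> l = smult c ([:- r, 1:] ^ k)"
proof -
  obtain A where A: "size A = degree l" "l = smult (lead_coeff l) (\<Prod>x\<in>#A. [:- x, 1:])"
    using alg_closed_imp_factorization[OF assms(1)] by blast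
  have "x = r" if "x \<in># A" for x
  proof (rule only)
    have "poly (\<Prod>x\<in>#A. [:- x, 1:]) x = 0"
      using that by (auto simp: poly_prod_mset prod_mset_zero_iff)
    then show "poly l x = 0" by (subst A(2)) simp
  qed
  then have "A = replicate_mset (degree l) r"
    using A(1) by (metis set_mset_subset_singletonD subsetI singletonI)
  then have "l = smult (lead_coeff l) ([:- r, 1:] ^ degree l)"
    using A(2) by simp
  then show ?thesis using assms(1) by (metis leading_coeff_0_iff)
qed

locale once_met_pencil = affine_line_pencil G E
  for G :: "'a::{alg_closed_field, field_char_0, field_gcd} poly poly" and E +
  fixes F :: "'a poly poly"
  assumes smooth: "smooth_points F"
    and meets_once: "\<And>a. a \<notin> E \<Longrightarrow> card {(x, y). eval2 F x y = 0 \<and> eval2 G x y = a} = 1"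
    and not_A1: "\<not> plane_curve_iso UNIV F A1_poly"
    and not_A1star: "\<not> plane_curve_iso UNIV F A1star_poly"
begin

text \<open>In the coordinates (G, T) sections are the pairs (U, V) with b(U) + l(U) V = s, and
  \<open>U0\<close> is the only possible nonconstant U. The excluded curves are what would prevent
  this: the affine line when \<open>l\<close> has no root, the punctured line when \<open>l\<close>
  has a single root r with b(r) nonzero.\<close>

lemma normal_form:
  "\<exists>T P Q b l U0. subst2 P G T = X2 \<and> subst2 Q G T = Y2 \<and> subst2 G P Q = X2 \<and> subst2 T P Q = Y2
     \<and> F = subst2 [:b, l:] G T \<and> l \<noteq> 0
     \<and> (\<forall>U V. pcompose b U + pcompose l U * V = [:0, 1:] \<longrightarrow> degree U \<noteq> 0 \<longrightarrow> U = U0)"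
proof -
  obtain T P Q where inv: "subst2 P G T = X2" "subst2 Q G T = Y2" "subst2 G P Q = X2" "subst2 T P Q = Y2"
    using coordinate by blast
  define f where "f = subst2 F P Q"
  have F: "F = subst2 f G T" by (simp add: f_def subst2_subst2 inv)
  have sf: "smooth_points f" by (rule smooth_points_subst2[OF F smooth inv(3,4)])
  have PQ: "eval2 P (eval2 G x y) (eval2 T x y) = x" "eval2 Q (eval2 G x y) (eval2 T x y) = y" for x y
    by (simp_all add: inv flip: eval2_subst2)
  have GT: "eval2 G (eval2 P u v) (eval2 Q u v) = u" "eval2 T (eval2 P u v) (eval2 Q u v) = v" for u v
    by (simp_all add: inv flip: eval2_subst2)
  have "card {v. eval2 f a v = 0} = 1" if "a \<notin> E" for a
  proof -
    have "bij_betw (\<lambda>(x, y). eval2 T x y) {(x, y). eval2 F x y = 0 \<and> eval2 G x y = a} {v. eval2 f a v = 0}"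
      by (rule bij_betw_byWitness[where f' = "\<lambda>v. (eval2 P a v, eval2 Q a v)"])
        (auto simp: F eval2_subst2 GT PQ)
    from bij_betw_same_card[OF this] meets_once[OF that] show ?thesis by simp
  qed
  from degree_one_in_fibre_variable[OF finite_E this sf]
  obtain b l where f: "f = [:b, l:]" and l0: "l \<noteq> 0" by blast
  have "\<exists>r. poly l r = 0"
  proof (rule ccontr)
    assume "\<not> ?thesis"
    then obtain c where c: "c \<noteq> 0" "l = [:c:]" using root_free_const[of l] by blast
    have "F = subst2 [:b, [:c:]:] G T" using F by (simp add: f c)
    from iso_A1[OF this c(1) inv] not_A1 show False by contradiction
  qed
  then obtain r where r: "poly l r = 0" by blast
  have "\<exists>U0. \<forall>U V. pcompose b U + pcompose l U * V = [:0, 1:] \<longrightarrow> degree U \<noteq> 0 \<longrightarrow> U = U0"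
  proof (cases "\<exists>r'. poly l r' = 0 \<and> r' \<noteq> r")
    case True
    then show ?thesis using exceptional_two_roots[OF r] by blast
  next
    case False
    then obtain c k where ck: "c \<noteq> 0" "l = smult c ([:- r, 1:] ^ k)"
      using const_root_multiplicity[OF l0, of r] by blast
    have k: "k > 0" using r ck by (auto intro!: Nat.gr0I)
    have br: "poly b r = 0"
    proof (rule ccontr)
      assume br: "poly b r \<noteq> 0"
      have "F = subst2 [:b, smult c ([:- r, 1:] ^ k):] G T" using F by (simp only: f ck(2))
      from iso_A1star[OF this ck(1) k br inv] not_A1star show False by contradiction
    qed
    have dl: "poly (pderiv l) r = 0"
    proof (rule ccontr)
      assume *: "poly (pderiv l) r \<noteq> 0"
      \<comment> \<open>The equation b'(r) + l'(r) v = 0 is solvable for v at a simple root of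
        \<open>l\<close>. The point (r, v) lies on the curve and both partial derivatives vanish
        there.\<close>
      define v where "v = - poly (pderiv b) r / poly (pderiv l) r"
      have "dx2 f = [:pderiv b, pderiv l:]" "dy2 f = [:l:]"
        by (simp_all add: f dx2_def dy2_def map_poly_pCons pderiv_pCons)
      then have "eval2 (dx2 f) r v = 0" "eval2 (dy2 f) r v = 0" "eval2 f r v = 0"
        using * by (simp_all add: f eval2_linear v_def br r eval2_def map_poly_pCons)
      with sf show False by (auto simp: smooth_points_def)
    qed
    show ?thesis by (rule exceptional_double_root[OF r dl br])
  qed
  then obtain U0 where "\<forall>U V. pcompose b U + pcompose l U * V = [:0, 1:] \<longrightarrow> degree U \<noteq> 0 \<longrightarrow> U = U0"
    by (rule exE)
  with inv l0 F show ?thesis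
    unfolding f
    by (intro exI[of _ T] exI[of _ P] exI[of _ Q] exI[of _ b] exI[of _ l] exI[of _ U0]) simp
qed

theorem unique_section:
  "\<exists>\<Omega>. \<Omega> \<noteq> 0 \<and> (\<forall>x y. eval2 \<Omega> x y \<noteq> 0 \<longrightarrow>
     (\<exists>!(X, Y). curve F X Y = [:0, 1:] \<and> poly X (eval2 F x y) = x \<and> poly Y (eval2 F x y) = y))"
proof -
  obtain T P Q b l U0 where inv: "subst2 P G T = X2" "subst2 Q G T = Y2" "subst2 G P Q = X2" "subst2 T P Q = Y2"
    and F: "F = subst2 [:b, l:] G T" and l0: "l \<noteq> 0"
    and U0: "\<And>U V. pcompose b U + pcompose l U * V = [:0, 1:] \<Longrightarrow> degree U \<noteq> 0 \<longrightarrow> U = U0"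
    using normal_form by blast
  have F': "F = ucomp b G + ucomp l G * T" unfolding F subst2_linear ..
  have PQ: "eval2 P (eval2 G x y) (eval2 T x y) = x" "eval2 Q (eval2 G x y) (eval2 T x y) = y" for x y
    by (simp_all add: inv flip: eval2_subst2)
  have GT: "eval2 G (eval2 P u v) (eval2 Q u v) = u" "eval2 T (eval2 P u v) (eval2 Q u v) = v" for u v
    by (simp_all add: inv flip: eval2_subst2)
  \<comment> \<open>The first factor removes the points where the equation cannot be solved for v.
    The second removes those through which the exceptional section could pass: a section through the
    point has U(t) = a, and U = U0 would give a = U0(t).\<close>
  define \<Omega> where "\<Omega> = ucomp l G * (G - ucomp U0 F)"
  \<comment> \<open>Otherwise \<open>G\<close> would be constant on F = 0, whereas that curve meets
    the line u = a whenever l(a) is nonzero.\<close>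
  have "G - ucomp U0 F \<noteq> 0"
  proof
    assume 0: "G - ucomp U0 F = 0"
    have G: "eval2 G x y = poly U0 (eval2 F x y)" for x y
      using arg_cong[OF 0, of "\<lambda>p. eval2 p x y"] by (simp only: eval2_simps eval2_ucomp right_minus_eq)
    have val: "a = poly U0 0" if "poly l a \<noteq> 0" for a
    proof -
      define v where "v = - poly b a / poly l a"
      have "eval2 F (eval2 P a v) (eval2 Q a v) = 0"
        using that by (simp add: F' eval2_simps GT v_def)
      with G[of "eval2 P a v" "eval2 Q a v"] show ?thesis by (simp add: GT)
    qed
    have "finite {a. poly l a = 0}" using l0 by (rule poly_roots_finite)
    then have fin: "finite (insert (poly U0 0) {a. poly l a = 0})" by simp
    obtain a where "a \<notin> insert (poly U0 0) {a. poly l a = 0}"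
      using ex_new_if_finite[OF infinite_UNIV_char_0 fin] by (rule exE)
    with val show False by auto
  qed
  moreover have "ucomp l G \<noteq> 0" using ucomp_G_inj[of l] l0 by auto
  ultimately have "\<Omega> \<noteq> 0" by (simp add: \<Omega>_def)
  moreover have "\<exists>!(X, Y). curve F X Y = [:0, 1:] \<and> poly X (eval2 F x y) = x \<and> poly Y (eval2 F x y) = y"
    if "eval2 \<Omega> x y \<noteq> 0" for x y
  proof -
    define a where "a = eval2 G x y"
    define t where "t = eval2 F x y"
    have la: "poly l a \<noteq> 0" and aU0: "a \<noteq> poly U0 t"
      using that by (auto simp: \<Omega>_def eval2_simps a_def t_def)
    define V0 where "V0 = [:- poly b a / poly l a, 1 / poly l a:]"
    have t_eq: "t = poly b a + poly l a * eval2 T x y" by (simp add: t_def F' eval2_simps a_def)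
    have V0t: "poly V0 t = eval2 T x y" unfolding V0_def t_eq using la by (simp add: add_divide_distrib)
    have V0_eq: "smult (poly l a) V0 = [:- poly b a, 1:]" using la by (simp add: V0_def)
    show ?thesis
    proof (rule ex1I[of _ "(curve P [:a:] V0, curve Q [:a:] V0)"], clarify)
      have "curve G (curve P [:a:] V0) (curve Q [:a:] V0) = [:a:]"
        "curve T (curve P [:a:] V0) (curve Q [:a:] V0) = V0"
        by (simp_all add: inv flip: curve_subst2)
      then have "curve F (curve P [:a:] V0) (curve Q [:a:] V0) = [:0, 1:]"
        by (simp add: F' curve_simps curve_ucomp pcompose_const_right V0_eq)
      then show "curve F (curve P [:a:] V0) (curve Q [:a:] V0) = [:0, 1:] \<and>
        poly (curve P [:a:] V0) (eval2 F x y) = x \<and> poly (curve Q [:a:] V0) (eval2 F x y) = y"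
        using PQ[of x y] by (simp add: poly_curve V0t flip: t_def a_def)
    next
      fix XY :: "'a poly \<times> 'a poly"
      assume *: "case XY of (X, Y) \<Rightarrow> curve F X Y = [:0, 1:] \<and> poly X (eval2 F x y) = x \<and> poly Y (eval2 F x y) = y"
      obtain X Y where XY: "XY = (X, Y)" by (cases XY)
      with * have c: "curve F X Y = [:0, 1:]" "poly X t = x" "poly Y t = y" by (simp_all add: t_def)
      define U where "U = curve G X Y"
      define V where "V = curve T X Y"
      have X: "X = curve P U V" and Y: "Y = curve Q U V"
        unfolding U_def V_def by (simp_all add: inv flip: curve_subst2)
      have eq: "pcompose b U + pcompose l U * V = [:0, 1:]"
        using c(1) by (simp add: F' curve_simps curve_ucomp U_def V_def)
      have Ut: "poly U t = a" by (simp add: U_def poly_curve c a_def)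
      from U0[OF eq] Ut aU0 have "degree U = 0" by auto
      then obtain u where "U = [:u:]" by (rule degree_eq_zeroE)
      with Ut have U: "U = [:a:]" by simp
      have "[:poly b a:] + smult (poly l a) V = [:0, 1:]"
        using eq by (simp add: U pcompose_const_right)
      then have "smult (poly l a) V = [:0, 1:] - [:poly b a:]" by (simp only: eq_diff_eq add.commute)
      then have "smult (poly l a) V = smult (poly l a) V0" by (simp add: V0_eq)
      from arg_cong[OF this, of "smult (inverse (poly l a))"] have "V = V0" using la by simp
      then show "XY = (curve P [:a:] V0, curve Q [:a:] V0)"
        using X Y U XY by simp
    qed
  qed
  ultimately show ?thesis by (intro exI[of _ \<Omega>]) simp
qed

end

subsection \<open>Naturality of evaluation\<close>

lemma rhom_ev2_natural:
  assumes f: "rhom f" and h: "rhom h"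
  shows "h (ev2 f p u v) = ev2 (\<lambda>a. h (f a)) p (h u) (h v)"
proof -
  have hf: "rhom (\<lambda>a. h (f a))" using h f by (rule rhom_comp)
  show ?thesis
    by (rule rhom2_eqI[where p = p])
      (simp_all add: rhom_comp[OF h rhom_ev2[OF f]] rhom_ev2[OF hf] ev2_const2[OF f] ev2_X2[OF f] ev2_Y2[OF f]
        ev2_const2[OF hf] ev2_X2[OF hf] ev2_Y2[OF hf])
qed

lemma map_poly_gens:
  assumes g: "rhom g"
  shows "map_poly (map_poly g) (const2 a) = const2 (g a)"
    "map_poly (map_poly g) X2 = X2" "map_poly (map_poly g) Y2 = Y2"
  by (simp_all add: const2_def X2_def Y2_def map_poly_pCons rhom.zero[OF g] rhom.one[OF g]
      rhom.one[OF rhom.map_poly_rhom[OF g]])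

lemma ev2_map_poly:
  assumes f: "rhom f" and g: "rhom g"
  shows "ev2 f (map_poly (map_poly g) p) u v = ev2 (\<lambda>a. f (g a)) p u v"
proof -
  have fg: "rhom (\<lambda>a. f (g a))" using f g by (rule rhom_comp)
  have gg: "rhom (map_poly (map_poly g))" using g by (intro rhom.map_poly_rhom)
  show ?thesis
    by (rule rhom2_eqI[where p = p])
      (simp_all add: rhom_comp[OF rhom_ev2[OF f] gg] rhom_ev2[OF fg] map_poly_gens[OF g]
        ev2_const2[OF f] ev2_X2[OF f] ev2_Y2[OF f] ev2_const2[OF fg] ev2_X2[OF fg] ev2_Y2[OF fg])
qed

abbreviation rat_extend :: "rat poly poly \<Rightarrow> 'a::field_char_0 poly poly" where
  "rat_extend \<equiv> map_poly (map_poly of_rat)"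

lemma eval2_rat_extend:
  "eval2 (rat_extend F) (of_rat x) (of_rat y) = (of_rat (eval2 F x y) :: 'a::field_char_0)"
  unfolding eval2_conv ev2_map_poly[OF rhom_id rhom_of_rat]
  by (rule rhom_ev2_natural[OF rhom_id rhom_of_rat, symmetric])

lemma curve_rat_extend:
  "curve (rat_extend F) X Y = ev2 (\<lambda>a. [:of_rat a:]) F X (Y :: 'a::field_char_0 poly)"
  unfolding curve_def by (rule ev2_map_poly[OF rhom_const rhom_of_rat])

subsection \<open>Fields generated by one algebraic element\<close>

abbreviation evq :: "rat poly \<Rightarrow> 'a::field_char_0 \<Rightarrow> 'a" where
  "evq \<equiv> ev1 of_rat"

lemmas rhom_evq = rhom_ev1[OF rhom_of_rat]

lemma evq_pCons [simp]: "evq (pCons a p) u = of_rat a + u * evq p u"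
  by (rule ev1_pCons[OF rhom_of_rat])

lemma evq_0 [simp]: "evq 0 u = 0"
  by (rule ev1_0)

lemma evq_pcompose: "evq (pcompose p q) u = evq p (evq q u)"
  by (induction p) (simp_all add: pcompose_pCons rhom.add[OF rhom_evq] rhom.mult[OF rhom_evq])

text \<open>When all elements are algebraic, this ring of polynomial expressions is already the
  field Q(\<theta>).\<close>

definition Qadj :: "'a::field_char_0 \<Rightarrow> 'a set" where
  "Qadj \<theta> = range (\<lambda>p. evq p \<theta>)"

lemma Qadj_add: "x \<in> Qadj \<theta> \<Longrightarrow> y \<in> Qadj \<theta> \<Longrightarrow> x + y \<in> Qadj \<theta>"
  unfolding Qadj_def by (auto simp flip: rhom.add[OF rhom_evq])

lemma Qadj_mult: "x \<in> Qadj \<theta> \<Longrightarrow> y \<in> Qadj \<theta> \<Longrightarrow> x * y \<in> Qadj \<theta>"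
  unfolding Qadj_def by (auto simp flip: rhom.mult[OF rhom_evq])

lemma Qadj_diff: "x \<in> Qadj \<theta> \<Longrightarrow> y \<in> Qadj \<theta> \<Longrightarrow> x - y \<in> Qadj \<theta>"
  unfolding Qadj_def by (auto simp flip: rhom.diff[OF rhom_evq])

lemma Qadj_of_rat: "of_rat a \<in> Qadj \<theta>"
proof -
  have "of_rat a = evq [:a:] \<theta>" by simp
  then show ?thesis unfolding Qadj_def by blast
qed

lemma Qadj_self: "\<theta> \<in> Qadj \<theta>"
proof -
  have "\<theta> = evq [:0, 1:] \<theta>" by simp
  then show ?thesis unfolding Qadj_def by blast
qed

lemma Qadj_trans: "x \<in> Qadj \<theta> \<Longrightarrow> \<theta> \<in> Qadj \<theta>' \<Longrightarrow> x \<in> Qadj \<theta>'"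
  unfolding Qadj_def by (auto simp flip: evq_pcompose)

definition algebraic_type :: "'a::field_char_0 itself \<Rightarrow> bool" where
  "algebraic_type _ \<longleftrightarrow> (\<forall>z :: 'a. \<exists>p :: rat poly. p \<noteq> 0 \<and> evq p z = 0)"

text \<open>Any annihilating polynomial of least degree counts. The leading coefficient is not
  normalized, so it is unique only up to a rational factor.\<close>

definition minpoly :: "rat poly \<Rightarrow> 'a::field_char_0 \<Rightarrow> bool" where
  "minpoly m z \<longleftrightarrow> m \<noteq> 0 \<and> evq m z = 0 \<and> (\<forall>q. q \<noteq> 0 \<longrightarrow> evq q z = 0 \<longrightarrow> degree m \<le> degree q)"

lemma minpoly_exists:
  assumes "algebraic_type TYPE('a::field_char_0)"
  shows "\<exists>m. minpoly m (z :: 'a)"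
proof -
  obtain p where p: "p \<noteq> 0 \<and> evq p z = 0" using assms unfolding algebraic_type_def by blast
  define m where "m = arg_min degree (\<lambda>p. p \<noteq> 0 \<and> evq p z = 0)"
  have "m \<noteq> 0 \<and> evq m z = 0" unfolding m_def using p by (rule arg_min_natI)
  moreover have "degree m \<le> degree q" if "q \<noteq> 0" "evq q z = 0" for q
    unfolding m_def by (rule arg_min_nat_le) (use that in simp)
  ultimately show ?thesis unfolding minpoly_def by blast
qed

lemma minpoly_dvd:
  assumes m: "minpoly m z" and q: "evq q z = 0"
  shows "m dvd q"
proof -
  have "evq (q mod m) z = evq q z - evq (q div m) z * evq m z"
    by (simp flip: rhom.mult[OF rhom_evq] rhom.diff[OF rhom_evq] add: minus_div_mult_eq_mod)
  then have "evq (q mod m) z = 0" using m q by (simp add: minpoly_def)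
  moreover have "degree (q mod m) < degree m \<or> q mod m = 0"
    using m degree_mod_less[of m q] by (auto simp: minpoly_def)
  ultimately have "q mod m = 0" using m unfolding minpoly_def by (meson not_le)
  then show ?thesis by (rule mod_0_imp_dvd)
qed

lemma minpoly_degree: "minpoly m z \<Longrightarrow> degree m > 0"
  by (rule gr0I) (auto simp: minpoly_def elim!: degree_eq_zeroE)

text \<open>This is irreducibility: a minimal polynomial \<open>p\<close> of z' divides m, say m = p
  r. One of the factors vanishes at z and has at least the degree of m; it cannot be r, because
  \<open>p\<close> is not constant.\<close>

lemma minpoly_conjugate:
  assumes m: "minpoly m z" and z': "evq m z' = 0"
  shows "minpoly m z'"
  unfolding minpoly_def
proof (intro conjI allI impI)
  show "m \<noteq> 0" using m by (simp add: minpoly_def)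
  fix q assume q: "q \<noteq> 0" "evq q z' = 0"
  define P where "P p \<longleftrightarrow> p \<noteq> 0 \<and> evq p z' = 0" for p
  define p where "p = arg_min degree P"
  have P: "P p" unfolding p_def using q by (intro arg_min_natI[of P q]) (simp add: P_def)
  have le: "degree p \<le> degree r" if "r \<noteq> 0" "evq r z' = 0" for r
    unfolding p_def by (rule arg_min_nat_le) (use that in \<open>simp add: P_def\<close>)
  have mp: "minpoly p z'" using P le by (auto simp: minpoly_def P_def)
  from minpoly_dvd[OF mp z'] obtain r where r: "m = p * r" by (elim dvdE)
  have nz: "p \<noteq> 0" "r \<noteq> 0" using m r by (auto simp: minpoly_def)
  have "evq p z * evq r z = 0"
    using m unfolding r minpoly_def by (simp add: rhom.mult[OF rhom_evq])
  then have "degree m \<le> degree p \<or> degree m \<le> degree r"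
    using m nz by (auto simp: minpoly_def)
  moreover have "degree m = degree p + degree r" unfolding r using nz by (rule degree_mult_eq)
  moreover have "degree p \<noteq> 0"
    using minpoly_degree[OF mp] by simp
  ultimately have "degree m \<le> degree p" by linarith
  with le[OF q] show "degree m \<le> degree q" by linarith
qed (rule z')

lemma pderiv_map_of_rat: "pderiv (map_poly of_rat p) = (map_poly of_rat (pderiv p) :: 'a::field_char_0 poly)"
  by (rule poly_eqI) (simp add: coeff_pderiv coeff_map_poly of_rat_mult of_rat_add)

lemma minpoly_simple:
  assumes "minpoly m z"
  shows "evq (pderiv m) z \<noteq> 0"
proof
  assume 0: "evq (pderiv m) z = 0"
  have "pderiv m \<noteq> 0" using minpoly_degree[OF assms] by (simp add: pderiv_eq_0_iff)
  with assms 0 have "degree m \<le> degree (pderiv m)" by (simp add: minpoly_def)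
  then show False using minpoly_degree[OF assms] by (simp add: degree_pderiv)
qed

text \<open>The minimal polynomial of a nonzero x has the form a + x r(x) with a nonzero, which
  gives 1 / x = - r(x) / a.\<close>

lemma Qadj_inverse:
  assumes alg: "algebraic_type TYPE('a::field_char_0)" and x: "(x :: 'a) \<in> Qadj \<theta>"
  shows "inverse x \<in> Qadj \<theta>"
proof (cases "x = 0")
  case True
  then show ?thesis using x by simp
next
  case False
  obtain m where m: "minpoly m x" using minpoly_exists[OF alg] by blast
  obtain a r where ar: "m = pCons a r" by (rule pCons_cases)
  have "a \<noteq> 0"
  proof
    assume a: "a = 0"
    then have "r \<noteq> 0" "evq r x = 0" using m ar False by (auto simp: minpoly_def)
    then have "degree m \<le> degree r" using m by (simp add: minpoly_def)
    then show False using \<open>r \<noteq> 0\<close> by (simp add: ar a)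
  qed
  have "of_rat a + x * evq r x = 0" using m by (simp add: minpoly_def ar)
  then have "x * evq r x = - of_rat a" by (simp add: eq_neg_iff_add_eq_0 add.commute)
  then have "- of_rat (inverse a) * (x * evq r x) = of_rat (inverse a * a)"
    unfolding of_rat_mult by simp
  then have "x * (- of_rat (inverse a) * evq r x) = 1"
    using \<open>a \<noteq> 0\<close> by (simp add: mult.left_commute)
  then have "inverse x = of_rat (- inverse a) * evq r x"
    by (simp add: inverse_unique of_rat_minus)
  moreover have "evq r x \<in> Qadj \<theta>" using Qadj_trans[OF _ x] by (auto simp: Qadj_def)
  ultimately show ?thesis using Qadj_mult Qadj_of_rat by metis
qed

text \<open>The primitive element theorem with \<theta> = a + c b. The polynomials g(z) and
  f(\<theta> - c z) over Q(\<theta>) have only the root b in common. An annihilator \<open>m\<close>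
  of b of least degree over Q(\<theta>) divides both, and b is a simple root of g, so
  \<open>m\<close> is linear and b lies in Q(\<theta>).\<close>

lemma Qadj_pair:
  fixes a b :: "'a::{alg_closed_field, field_char_0}"
  assumes alg: "algebraic_type TYPE('a)"
  shows "\<exists>\<theta>. a \<in> Qadj \<theta> \<and> b \<in> Qadj \<theta>"
proof -
  obtain f where f: "minpoly f a" using minpoly_exists[OF alg] by blast
  obtain g where g: "minpoly g b" using minpoly_exists[OF alg] by blast
  have fin: "finite {z :: 'a. evq p z = 0}" if "p \<noteq> 0" for p
    unfolding ev1_def by (rule poly_roots_finite) (use that in \<open>simp add: map_poly_eq_0_iff\<close>)
  define A where "A = {z :: 'a. evq f z = 0}"
  define B where "B = {z :: 'a. evq g z = 0}"
  \<comment> \<open>A root b' of \<open>g\<close> other than b is a zero of f(\<theta> - c z) only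
    if c = (a' - a) / (b - b') for some root a' of \<open>f\<close>; these c are avoided. For b' = b
    the quotient is 0 by the convention on division, so c = 0 is avoided too.\<close>
  have "finite ((\<lambda>(a', b'). (a' - a) / (b - b')) ` (A \<times> B))"
    unfolding A_def B_def using f g fin by (intro finite_imageI finite_cartesian_product) (auto simp: minpoly_def)
  then obtain n :: nat where n: "of_nat n \<notin> (\<lambda>(a', b'). (a' - a) / (b - b')) ` (A \<times> B)"
    using infinite_ex_not[of "range (of_nat :: nat \<Rightarrow> 'a)"]
    by (metis (no_types, lifting) Collect_mem_eq infinite_UNIV_nat finite_imageD inj_of_nat rangeE)
  define c where "c = (of_nat n :: 'a)"
  define \<theta> where "\<theta> = a + c * b"
  let ?K = "Qadj \<theta>"
  have cK: "c \<in> ?K" using Qadj_of_rat[of "of_nat n" \<theta>] by (simp add: c_def)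
  define KP where "KP = {p :: 'a poly. \<forall>i. coeff p i \<in> ?K}"
  have KP_shift: "[:\<theta>, - c:] * p \<in> KP" if "p \<in> KP" for p
  proof -
    have "coeff ([:\<theta>, - c:] * p) i = \<theta> * coeff p i - c * coeff (pCons 0 p) i" for i
      by (simp add: coeff_pCons split: nat.splits)
    moreover have "coeff (pCons 0 p) i \<in> ?K" for i
      using that Qadj_of_rat[of 0 \<theta>] by (auto simp: KP_def coeff_pCons split: nat.splits)
    ultimately show ?thesis
      using that cK Qadj_self[of \<theta>] by (simp add: KP_def Qadj_diff Qadj_mult)
  qed
  have KP_pcompose: "pcompose (map_poly of_rat p) [:\<theta>, - c:] \<in> KP" for p
  proof (induction p)
    case 0
    then show ?case using Qadj_of_rat[of 0 \<theta>] by (simp add: KP_def)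
  next
    case (pCons q p)
    have "[:of_rat q:] \<in> KP"
      using Qadj_of_rat[of 0 \<theta>] Qadj_of_rat[of q \<theta>] by (simp add: KP_def coeff_pCons split: nat.splits)
    with KP_shift[OF pCons.IH] have "[:of_rat q:] + [:\<theta>, - c:] * pcompose (map_poly of_rat p) [:\<theta>, - c:] \<in> KP"
      unfolding KP_def by (simp only: coeff_add mem_Collect_eq) (simp add: Qadj_add del: mult_pCons_left)
    then show ?case by (simp only: map_poly_pCons of_rat_0 pcompose_pCons)
  qed
  have KP_rat: "map_poly of_rat p \<in> KP" for p
    by (simp add: KP_def coeff_map_poly Qadj_of_rat)
  define R where "R p \<longleftrightarrow> p \<in> KP \<and> p \<noteq> 0 \<and> poly p b = 0" for p
  define m where "m = arg_min degree R"
  have "R (map_poly of_rat g)"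
    using g KP_rat by (simp add: R_def minpoly_def ev1_def map_poly_eq_0_iff)
  then have m: "m \<in> KP" "m \<noteq> 0" "poly m b = 0"
    using arg_min_natI[of R _ degree] unfolding m_def R_def by blast+
  have le: "degree m \<le> degree p" if "p \<in> KP" "p \<noteq> 0" "poly p b = 0" for p
    unfolding m_def by (rule arg_min_nat_le) (use that in \<open>simp add: R_def\<close>)
  \<comment> \<open>Division with remainder inside Q(\<theta>)[z], one leading term at a time, so
    that the coefficients stay in Q(\<theta>).\<close>
  have dvd: "m dvd p" if "p \<in> KP" "poly p b = 0" for p
    using that
  proof (induction "degree p" arbitrary: p rule: less_induct)
    case less
    show ?case
    proof (cases "p = 0")
      case False
      define e where "e = lead_coeff p * inverse (lead_coeff m)"
      define p' where "p' = p - monom e (degree p - degree m) * m"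
      have deg: "degree m \<le> degree p" using le less.prems False by blast
      have e0: "e \<noteq> 0" using False m(2) by (simp add: e_def)
      have eK: "e \<in> ?K" unfolding e_def
        using less.prems(1) m(1) by (intro Qadj_mult Qadj_inverse[OF alg]) (auto simp: KP_def)
      have "p' \<in> KP"
        using less.prems(1) m(1) eK Qadj_of_rat[of 0 \<theta>]
        by (auto simp: KP_def p'_def coeff_monom_mult intro!: Qadj_diff Qadj_mult)
      moreover have "poly p' b = 0" using less.prems(2) m(3) by (simp add: p'_def)
      moreover have "p' = 0 \<or> degree p' < degree p"
      proof (rule eq_zero_or_degree_less)
        have "degree (monom e (degree p - degree m) * m) = degree p"
          using e0 m(2) deg by (simp add: degree_mult_eq degree_monom_eq)
        then show "degree p' \<le> degree p" unfolding p'_def by (intro degree_diff_le) auto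
        show "coeff p' (degree p) = 0"
          using deg m(2) by (simp add: p'_def coeff_monom_mult e_def)
      qed
      ultimately have "m dvd p'" using less.hyps by auto
      then have "m dvd p' + monom e (degree p - degree m) * m" by simp
      then show ?thesis by (simp add: p'_def)
    qed simp
  qed
  have mg: "m dvd map_poly of_rat g"
    using g by (intro dvd KP_rat) (simp add: minpoly_def ev1_def)
  have "m dvd pcompose (map_poly of_rat f) [:\<theta>, - c:]"
    using f by (intro dvd KP_pcompose) (simp add: poly_pcompose \<theta>_def minpoly_def ev1_def)
  then have root: "z = b" if "poly m z = 0" for z
  proof -
    have "poly (pcompose (map_poly of_rat f) [:\<theta>, - c:]) z = 0" "poly (map_poly of_rat g) z = 0"
      using \<open>m dvd pcompose _ _\<close> mg that by (metis dvdE mult_eq_0_iff poly_mult)+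
    then have AB: "\<theta> - c * z \<in> A" "z \<in> B"
      by (simp_all add: A_def B_def ev1_def poly_pcompose algebra_simps)
    show "z = b"
    proof (rule ccontr)
      assume "z \<noteq> b"
      then have "c = (\<theta> - c * z - a) / (b - z)" by (simp add: \<theta>_def field_simps)
      with AB have "c \<in> (\<lambda>(a', b'). (a' - a) / (b - b')) ` (A \<times> B)" by force
      with n show False by (simp add: c_def)
    qed
  qed
  have "{z. poly m z = 0} = {b}" using root m(3) by blast
  then have "card {z. poly m z = 0} = 1" by simp
  from single_root_poly[OF this] obtain s where
    s: "m = smult (lead_coeff m) ([:- s, 1:] ^ degree m)" "poly m s = 0" .
  have sb: "s = b" using root s(2) by blast
  have "degree m \<noteq> 0"
  proof
    assume "degree m = 0"
    then obtain d where "m = [:d:]" by (rule degree_eq_zeroE)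
    with m(2,3) show False by simp
  qed
  moreover have "\<not> degree m \<ge> 2"
  proof
    assume "degree m \<ge> 2"
    then have "[:- b, 1:] ^ 2 dvd m"
      by (subst s(1), unfold sb) (intro dvd_smult le_imp_power_dvd)
    then have "[:- b, 1:] ^ 2 dvd map_poly of_rat g" using mg by (rule dvd_trans)
    then obtain q where q: "map_poly of_rat g = [:- b, 1:] ^ 2 * q" by (elim dvdE)
    define L where "L = [:- b, 1:]"
    have "poly L b = 0" by (simp add: L_def)
    then have "poly (pderiv (map_poly of_rat g)) b = 0"
      unfolding q L_def[symmetric] by (simp add: pderiv_mult power2_eq_square)
    with minpoly_simple[OF g] show False by (simp add: pderiv_map_of_rat ev1_def)
  qed
  ultimately have d1: "degree m = 1" by linarith
  have "coeff m 0 = - (lead_coeff m * b)"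
    by (subst s(1), unfold d1 sb) simp
  then have "b = (of_rat 0 - coeff m 0) * inverse (lead_coeff m)" using m(2) by simp
  then have bK: "b \<in> ?K"
    using m(1) by (metis (mono_tags, lifting) KP_def mem_Collect_eq Qadj_diff Qadj_mult Qadj_inverse[OF alg] Qadj_of_rat)
  moreover have "a = \<theta> - c * b" by (simp add: \<theta>_def)
  then have "a \<in> ?K" using bK cK Qadj_self[of \<theta>] by (metis Qadj_diff Qadj_mult)
  ultimately show ?thesis by blast
qed

lemma Qadj_finite_set:
  fixes S :: "'a::{alg_closed_field, field_char_0} set"
  assumes alg: "algebraic_type TYPE('a)" and "finite S"
  shows "\<exists>\<theta>. S \<subseteq> Qadj \<theta>"
  using assms(2)
proof (induction S)
  case (insert b S)
  then obtain \<theta> where \<theta>: "S \<subseteq> Qadj \<theta>" by blast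
  obtain \<theta>' where "\<theta> \<in> Qadj \<theta>'" "b \<in> Qadj \<theta>'" using Qadj_pair[OF alg] by blast
  with \<theta> Qadj_trans show ?case by blast
qed simp

subsection \<open>Descent of a unique section to the rationals\<close>

text \<open>The outer variable of \<open>p\<close> is the parameter of the curve, the inner one
  stands for the primitive element. Replacing \<theta> by a conjugate only changes the value given
  to the inner variable.\<close>

definition specialize :: "'a::field_char_0 \<Rightarrow> rat poly poly \<Rightarrow> 'a poly" where
  "specialize \<theta> p = map_poly (\<lambda>q. evq q \<theta>) p"

lemma rhom_specialize: "rhom (specialize \<theta>)"
  unfolding specialize_def by (rule rhom.map_poly_rhom[OF rhom_evq])

lemma coeff_specialize: "coeff (specialize \<theta> p) i = evq (coeff p i) \<theta>"
  by (simp add: specialize_def coeff_map_poly)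

lemma specialize_gens: "specialize \<theta> (const2 a) = [:of_rat a:]" "specialize \<theta> Y2 = [:0, 1:]"
  by (simp_all add: specialize_def const2_def Y2_def map_poly_pCons rhom.one[OF rhom_evq])

lemma specialize_subst2: "specialize \<theta> (subst2 F A B) = curve (rat_extend F) (specialize \<theta> A) (specialize \<theta> B)"
  unfolding curve_rat_extend subst2_conv
  by (simp add: rhom_ev2_natural[OF rhom_const2 rhom_specialize] specialize_gens)

lemma evq_smult: "evq (smult c p) u = of_rat c * evq p u"
  by (induction p) (simp_all add: of_rat_mult algebra_simps)

lemma poly_specialize: "poly (specialize \<theta> p) (of_rat t) = evq (poly p [:t:]) \<theta>"
  by (induction p)
    (simp_all add: specialize_def map_poly_pCons rhom.add[OF rhom_evq] evq_smult)

text \<open>Each coefficient is a rational polynomial in \<theta>, reduced modulo \<open>m\<close>.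
  Zero coefficients are lifted to 0 so that the lifts form a polynomial.\<close>

lemma lift_to_specialize:
  assumes m: "minpoly m \<theta>" and X: "\<And>i. coeff X i \<in> Qadj \<theta>"
  shows "\<exists>p. X = specialize \<theta> p \<and> (\<forall>i. degree (coeff p i) < degree m)"
proof -
  have "\<exists>q. evq q \<theta> = coeff X i \<and> degree q < degree m \<and> (coeff X i = 0 \<longrightarrow> q = 0)" for i
  proof (cases "coeff X i = 0")
    case True
    then show ?thesis using minpoly_degree[OF m] by (intro exI[of _ 0]) simp
  next
    case False
    obtain q where q: "coeff X i = evq q \<theta>" using X[of i] by (auto simp: Qadj_def)
    have "evq (q mod m) \<theta> = evq q \<theta> - evq (q div m) \<theta> * evq m \<theta>"
      by (simp flip: rhom.mult[OF rhom_evq] rhom.diff[OF rhom_evq] add: minus_div_mult_eq_mod)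
    then have "evq (q mod m) \<theta> = coeff X i" using m q by (simp add: minpoly_def)
    moreover have "degree (q mod m) < degree m"
      using degree_mod_less[of m q] m minpoly_degree[OF m] by (auto simp: minpoly_def)
    ultimately show ?thesis using False by blast
  qed
  then obtain c where c: "\<And>i. evq (c i) \<theta> = coeff X i" "\<And>i. degree (c i) < degree m"
    "\<And>i. coeff X i = 0 \<Longrightarrow> c i = 0" by metis
  define p where "p = (\<Sum>i\<le>degree X. monom (c i) i)"
  have p: "coeff p i = c i" for i
    using c(3)[of i] by (auto simp: p_def coeff_sum coeff_eq_0)
  then have "X = specialize \<theta> p" by (intro poly_eqI) (simp add: coeff_specialize c)
  with c(2) p show ?thesis by auto
qed

text \<open>For a coefficient q of \<open>p\<close> with value \<xi> at \<theta>, invariance makes q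
  - \<xi> vanish at all roots of \<open>m\<close>. These are \<open>degree m\<close> many, since
  they are simple, and q has smaller degree. Hence q is the constant \<xi>, which is
  rational.\<close>

lemma conjugation_invariant_rational:
  fixes \<theta> :: "'a::{alg_closed_field, field_char_0}"
  assumes m: "minpoly m \<theta>" and deg: "\<And>i. degree (coeff p i) < degree m"
    and inv: "\<And>\<theta>'. evq m \<theta>' = 0 \<Longrightarrow> specialize \<theta>' p = specialize \<theta> p"
  shows "specialize \<theta> p = map_poly of_rat (map_poly (\<lambda>q. coeff q 0) p)"
proof (rule poly_eqI)
  fix i
  define q where "q = coeff p i"
  define \<xi> where "\<xi> = evq q \<theta>"
  let ?m = "map_poly of_rat m :: 'a poly" and ?q = "map_poly of_rat q - [:\<xi>:]"
  have m0: "m \<noteq> 0" using m by (simp add: minpoly_def)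
  have "card {z. poly ?m z = 0} = degree ?m"
  proof (rule card_roots_eq_degree)
    show "?m \<noteq> 0" using m0 by (simp add: map_poly_eq_0_iff)
    show "\<not> (poly ?m a = 0 \<and> poly (pderiv ?m) a = 0)" for a
      using minpoly_simple[OF minpoly_conjugate[OF m]] by (auto simp: ev1_def pderiv_map_of_rat)
  qed
  moreover have "degree ?m = degree m" by (rule degree_map_poly) auto
  ultimately have card: "card {z. poly ?m z = 0} = degree m" by simp
  have "?q = 0"
  proof (rule ccontr)
    assume q0: "?q \<noteq> 0"
    have "{z. poly ?m z = 0} \<subseteq> {z. poly ?q z = 0}"
    proof safe
      fix z assume "poly ?m z = 0"
      then have "specialize z p = specialize \<theta> p" by (intro inv) (simp add: ev1_def)
      then have "evq q z = \<xi>" unfolding q_def \<xi>_def coeff_specialize[symmetric] by simp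
      then show "poly ?q z = 0" by (simp add: ev1_def)
    qed
    then have "degree m \<le> card {z. poly ?q z = 0}"
      unfolding card[symmetric] by (intro card_mono poly_roots_finite q0)
    also have "\<dots> \<le> degree ?q" using q0 by (rule card_poly_roots_bound)
    also have "\<dots> \<le> degree q" by (intro degree_diff_le) (auto simp: map_poly_degree_leq)
    finally show False using deg[of i] by (simp add: q_def)
  qed
  then have "coeff (map_poly of_rat q) 0 = \<xi>" by (metis coeff_pCons_0 eq_iff_diff_eq_0)
  then show "coeff (specialize \<theta> p) i = coeff (map_poly of_rat (map_poly (\<lambda>q. coeff q 0) p)) i"
    by (simp add: coeff_specialize \<xi>_def q_def coeff_map_poly)
qed

lemma rational_section:
  fixes F :: "rat poly poly"
  assumes alg: "algebraic_type TYPE('a::{alg_closed_field, field_char_0})"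
    and uniq: "\<exists>!(X, Y). curve (rat_extend F) X Y = [:0, 1 :: 'a:] \<and> poly X (of_rat t) = of_rat x \<and> poly Y (of_rat t) = of_rat y"
  shows "\<exists>X Y. curve F X Y = [:0, 1:] \<and> poly X t = x \<and> poly Y t = y"
proof -
  define S where "S X Y \<longleftrightarrow> curve (rat_extend F) X Y = [:0, 1 :: 'a:] \<and> poly X (of_rat t) = of_rat x
    \<and> poly Y (of_rat t) = of_rat y" for X Y
  obtain X Y where XY: "S X Y" using uniq unfolding S_def by auto
  have unique: "X' = X \<and> Y' = Y" if "S X' Y'" for X' Y'
    using uniq that XY unfolding S_def by auto
  have "finite (range (coeff X) \<union> range (coeff Y))"
  proof -
    have "coeff p i \<in> insert 0 (coeff p ` {..degree p})" for p :: "'a poly" and i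
      by (cases "i \<le> degree p") (auto simp: coeff_eq_0)
    then have "range (coeff p) \<subseteq> insert 0 (coeff p ` {..degree p})" for p :: "'a poly"
      by blast
    then show ?thesis by (meson finite_UnI finite_imageI finite_atMost finite_insert finite_subset)
  qed
  from Qadj_finite_set[OF alg this] obtain \<theta> where \<theta>: "range (coeff X) \<union> range (coeff Y) \<subseteq> Qadj \<theta>" by blast
  obtain m where m: "minpoly m \<theta>" using minpoly_exists[OF alg] by blast
  obtain p where p: "X = specialize \<theta> p" "\<And>i. degree (coeff p i) < degree m"
    using lift_to_specialize[OF m, of X] \<theta> by blast
  obtain q where q: "Y = specialize \<theta> q" "\<And>i. degree (coeff q i) < degree m"
    using lift_to_specialize[OF m, of Y] \<theta> by blast
  have "specialize \<theta>' p = X \<and> specialize \<theta>' q = Y" if \<theta>': "evq m \<theta>' = 0" for \<theta>'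
  proof (rule unique)
    \<comment> \<open>A rational polynomial relation satisfied by \<theta> is divisible by
      \<open>m\<close> and hence holds at every conjugate. Both the equation F(p, q) = s and the
      prescribed values at t are relations of this kind.\<close>
    have tr: "evq r \<theta>' = 0" if "evq r \<theta> = 0" for r
      using minpoly_dvd[OF m that] \<theta>' by (auto simp: rhom.mult[OF rhom_evq] elim!: dvdE)
    have "specialize \<theta> (subst2 F p q - Y2) = 0"
      using XY by (simp add: rhom.diff[OF rhom_specialize] specialize_subst2 specialize_gens S_def p(1) q(1))
    then have "evq (coeff (subst2 F p q - Y2) i) \<theta> = 0" for i
      by (metis coeff_0 coeff_specialize)
    then have "specialize \<theta>' (subst2 F p q - Y2) = 0"
      using tr by (intro poly_eqI) (simp add: coeff_specialize del: coeff_diff)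
    then have "curve (rat_extend F) (specialize \<theta>' p) (specialize \<theta>' q) = [:0, 1:]"
      by (simp add: rhom.diff[OF rhom_specialize] specialize_subst2 specialize_gens)
    moreover have "poly (specialize \<theta>' r) (of_rat t) = of_rat w"
      if "poly (specialize \<theta> r) (of_rat t) = of_rat w" for r w
    proof -
      have "evq (poly r [:t:] - [:w:]) \<theta> = 0"
        using that by (simp add: poly_specialize rhom.diff[OF rhom_evq])
      from tr[OF this] show ?thesis by (simp add: poly_specialize rhom.diff[OF rhom_evq])
    qed
    ultimately show "S (specialize \<theta>' p) (specialize \<theta>' q)"
      using XY by (simp add: S_def p(1) q(1))
  qed
  then have inv: "specialize \<theta>' p = specialize \<theta> p" "specialize \<theta>' q = specialize \<theta> q" if "evq m \<theta>' = 0" for \<theta>'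
    using that p(1) q(1) by auto
  define X0 where "X0 = map_poly (\<lambda>q. coeff q 0) p"
  define Y0 where "Y0 = map_poly (\<lambda>q. coeff q 0) q"
  have X: "X = map_poly of_rat X0"
    unfolding p(1) X0_def by (rule conjugation_invariant_rational[OF m p(2) inv(1)])
  have Y: "Y = map_poly of_rat Y0"
    unfolding q(1) Y0_def by (rule conjugation_invariant_rational[OF m q(2) inv(2)])
  have hom: "rhom (map_poly of_rat :: rat poly \<Rightarrow> 'a poly)"
    by (rule rhom.map_poly_rhom[OF rhom_of_rat])
  have "map_poly of_rat (curve F X0 Y0) = ev2 (\<lambda>a. [:of_rat a:]) F X Y"
    unfolding curve_def rhom_ev2_natural[OF rhom_const hom] X Y by (simp add: map_poly_pCons)
  also have "\<dots> = curve (rat_extend F) X Y" by (rule curve_rat_extend[symmetric])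
  also have "\<dots> = map_poly of_rat [:0, 1:]" using XY by (simp add: S_def map_poly_pCons)
  finally have "curve F X0 Y0 = [:0, 1:]"
    by (metis (no_types, lifting) coeff_map_poly of_rat_0 of_rat_eq_iff poly_eqI)
  moreover have ev: "poly (map_poly of_rat r) (of_rat t :: 'a) = of_rat (poly r t)" for r
    by (induction r) (simp_all add: map_poly_pCons of_rat_add of_rat_mult)
  have "poly X0 t = x" "poly Y0 t = y"
    using XY by (simp_all add: S_def X Y ev)
  ultimately show ?thesis by blast
qed

subsection \<open>Congruences along a rational curve\<close>

lemma rat_denominator: "\<exists>d::nat. d > 0 \<and> (r :: rat) * of_nat d \<in> \<int>"
proof -
  obtain a b where ab: "quotient_of r = (a, b)" by force
  then have b: "b > 0" "r = of_int a / of_int b"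
    using quotient_of_denom_pos quotient_of_div by blast+
  then have "r * of_nat (nat b) = of_int a" by simp
  then show ?thesis using b(1) by (intro exI[of _ "nat b"]) auto
qed

text \<open>Write the change of a + u p(u) as u (p(u) - p(t)) + (u - t) p(t). The denominator d of t
  enters the modulus N d of the induction hypothesis, so the first term lies in N times the
  integers; the denominator e of p(t) enters the step M N e, which does the same for the
  second.\<close>

lemma rat_poly_congruence:
  fixes p :: "rat poly" and t :: rat
  shows "N > 0 \<Longrightarrow> \<exists>M::nat. M > 0 \<and> (\<forall>k::int. (poly p (t + of_nat M * of_int k) - poly p t) / of_nat N \<in> \<int>)"
proof (induction p arbitrary: N)
  case 0
  then show ?case by (intro exI[of _ 1]) simp
next
  case (pCons a p)
  obtain d :: nat where d: "d > 0" "t * of_nat d \<in> \<int>" using rat_denominator by blast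
  obtain e :: nat where e: "e > 0" "poly p t * of_nat e \<in> \<int>" using rat_denominator by blast
  have "N * d > 0" using pCons.prems d by simp
  from pCons.IH[OF this] obtain M :: nat where M: "M > 0"
    "\<And>k::int. (poly p (t + of_nat M * of_int k) - poly p t) / of_nat (N * d) \<in> \<int>" by blast
  show ?case
  proof (intro exI[of _ "M * (N * e)"] conjI allI)
    show "M * (N * e) > 0" using M(1) e(1) pCons.prems by simp
    fix k :: int
    define u where "u = t + of_nat (M * (N * e)) * of_int k"
    define w where "w = (poly p u - poly p t) / of_nat (N * d)"
    have "u = t + of_nat M * of_int (int (N * e) * k)" by (simp add: u_def)
    then have w: "w \<in> \<int>" unfolding w_def using M(2)[of "int (N * e) * k"] by simp
    have "u * of_nat d = t * of_nat d + of_int (int (M * (N * e)) * k * int d)"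
      by (simp add: u_def algebra_simps)
    then have ud: "u * of_nat d \<in> \<int>" using d(2) by (metis Ints_add Ints_of_int)
    have "poly (pCons a p) u - poly (pCons a p) t = u * (poly p u - poly p t) + (u - t) * poly p t"
      by (simp add: algebra_simps)
    also have "poly p u - poly p t = w * of_nat (N * d)"
      using pCons.prems d(1) by (simp add: w_def)
    also have "u * (w * of_nat (N * d)) + (u - t) * poly p t
        = of_nat N * (u * of_nat d * w + of_int (int M * k) * (poly p t * of_nat e))"
      by (simp add: u_def algebra_simps)
    finally have "(poly (pCons a p) u - poly (pCons a p) t) / of_nat N
        = u * of_nat d * w + of_int (int M * k) * (poly p t * of_nat e)"
      using pCons.prems by simp
    also have "\<dots> \<in> \<int>"
      by (rule Ints_add[OF Ints_mult[OF ud w] Ints_mult[OF Ints_of_int e(2)]])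
    finally show "(poly (pCons a p) (t + of_nat (M * (N * e)) * of_int k) - poly (pCons a p) t) / of_nat N \<in> \<int>"
      by (simp add: u_def)
  qed
qed

lemma negative_values_near:
  fixes F :: "rat poly poly"
  assumes sec: "curve F X Y = [:0, 1:]" "poly X t = x" "poly Y t = y" and N: "N > 0"
  shows "\<exists>x' y'. eval2 F x' y' < 0 \<and> (x' - x) / of_nat N \<in> \<int> \<and> (y' - y) / of_nat N \<in> \<int>"
proof -
  obtain M :: nat where M: "M > 0" "\<And>k::int. (poly X (t + of_nat M * of_int k) - poly X t) / of_nat N \<in> \<int>"
    using rat_poly_congruence[OF N] by blast
  obtain M' :: nat where M': "M' > 0" "\<And>k::int. (poly Y (t + of_nat M' * of_int k) - poly Y t) / of_nat N \<in> \<int>"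
    using rat_poly_congruence[OF N] by blast
  obtain n :: nat where n: "t < of_nat n" using reals_Archimedean2 by blast
  \<comment> \<open>The product of both moduli serves \<open>X\<close> and \<open>Y\<close> at once,
    and being at least 1 it lets n > t ensure that s is negative.\<close>
  define s where "s = t - of_nat (M * M') * of_nat n"
  have "of_nat n \<le> (of_nat (M * M') * of_nat n :: rat)"
    using M(1) M'(1) by (simp flip: of_nat_mult)
  then have "s < 0" using n by (simp add: s_def)
  have s1: "s = t + of_nat M * of_int (- int (M' * n))" and s2: "s = t + of_nat M' * of_int (- int (M * n))"
    by (simp_all add: s_def)
  have "(poly X s - x) / of_nat N \<in> \<int>" "(poly Y s - y) / of_nat N \<in> \<int>"
    using M(2)[of "- int (M' * n)"] M'(2)[of "- int (M * n)"] sec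
    unfolding s1[symmetric] s2[symmetric] by simp_all
  moreover have "eval2 F (poly X s) (poly Y s) = s" using sec(1) by (simp flip: poly_curve)
  ultimately show ?thesis using \<open>s < 0\<close> by metis
qed

theorem weak_approximation_negative_values:
  fixes F :: "rat poly poly" and \<Omega> :: "'a::{alg_closed_field, field_char_0} poly poly"
  assumes alg: "algebraic_type TYPE('a)" and \<Omega>: "\<Omega> \<noteq> 0"
    and uniq: "\<And>x y. eval2 \<Omega> x y \<noteq> 0 \<Longrightarrow> \<exists>!(X, Y). curve (rat_extend F) X Y = [:0, 1:] \<and>
      poly X (eval2 (rat_extend F) x y) = x \<and> poly Y (eval2 (rat_extend F) x y) = y"
  shows "weak_approximation {(x, y). eval2 F x y < 0}"
  unfolding weak_approximation_def
proof (intro allI impI)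
  fix x0 y0 :: rat and N :: nat
  assume N: "N > 0"
  \<comment> \<open>Shifting both coordinates by multiples of N preserves the required congruences
    and leaves infinitely many choices in each coordinate, so \<open>\<Omega>\<close> is nonzero at
    one of the shifted points.\<close>
  have inf: "infinite (range (\<lambda>k::nat. of_rat (r + of_nat N * of_nat k) :: 'a))" for r
    using N by (intro range_inj_infinite) (auto simp: inj_on_def)
  obtain k l :: nat where kl: "eval2 \<Omega> (of_rat (x0 + of_nat N * of_nat k)) (of_rat (y0 + of_nat N * of_nat l)) \<noteq> 0"
    using eval2_nonzero_exists[OF \<Omega> inf[of x0] inf[of y0]] by blast
  define x1 where "x1 = x0 + of_nat N * of_nat k"
  define y1 where "y1 = y0 + of_nat N * of_nat l"
  have "\<exists>!(X, Y). curve (rat_extend F) X Y = [:0, 1 :: 'a:] \<and> poly X (of_rat (eval2 F x1 y1)) = of_rat x1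
      \<and> poly Y (of_rat (eval2 F x1 y1)) = of_rat y1"
    using uniq[OF kl] by (simp only: eval2_rat_extend x1_def y1_def)
  from rational_section[OF alg this] obtain X Y where
    "curve F X Y = [:0, 1:]" "poly X (eval2 F x1 y1) = x1" "poly Y (eval2 F x1 y1) = y1" by blast
  from negative_values_near[OF this N] obtain x y where
    xy: "eval2 F x y < 0" "(x - x1) / of_nat N \<in> \<int>" "(y - y1) / of_nat N \<in> \<int>" by blast
  have "(x - x0) / of_nat N = (x - x1) / of_nat N + of_nat k" "(y - y0) / of_nat N = (y - y1) / of_nat N + of_nat l"
    using N by (simp_all add: x1_def y1_def field_simps)
  then have "(x - x0) / of_nat N \<in> \<int>" "(y - y0) / of_nat N \<in> \<int>"
    using xy by (metis Ints_add Ints_of_nat)+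
  with xy(1) show "\<exists>(x, y)\<in>{(x, y). eval2 F x y < 0}. (x - x0) / of_nat N \<in> \<int> \<and> (y - y0) / of_nat N \<in> \<int>"
    by blast
qed

subsection \<open>The field of algebraic numbers\<close>

abbreviation qscale :: "rat \<Rightarrow> 'a::field_char_0 \<Rightarrow> 'a" where
  "qscale q z \<equiv> of_rat q * z"

interpretation Qvs: vector_space "qscale :: rat \<Rightarrow> 'a::field_char_0 \<Rightarrow> 'a"
  by unfold_locales (simp_all add: of_rat_add of_rat_mult algebra_simps)

text \<open>Two equal powers give an equation z^i = z^j. Otherwise the powers up to exponent
  \<open>card T\<close> are one more than a spanning set has elements, and a linear dependence among
  them is a polynomial equation.\<close>

lemma algebraic_if_powers_in_span:
  fixes z :: "'a::field_char_0"
  assumes T: "finite T" "\<And>n. z ^ n \<in> Qvs.span T"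
  shows "algebraic z"
proof (cases "inj_on (\<lambda>i. z ^ i) {..card T}")
  case False
  then obtain i j where ij: "i \<noteq> j" "z ^ i = z ^ j" by (auto simp: inj_on_def)
  show ?thesis
  proof (rule algebraicI)
    show "monom 1 i - monom 1 j \<noteq> (0 :: 'a poly)"
      using ij(1) by (auto simp: poly_eq_iff)
    show "coeff (monom 1 i - monom 1 j) k \<in> (\<int> :: 'a set)" for k by simp
    show "poly (monom 1 i - monom 1 j) z = 0" using ij(2) by (simp add: poly_monom)
  qed
next
  case True
  define S where "S = (\<lambda>i. z ^ i) ` {..card T}"
  have fin: "finite S" by (simp add: S_def)
  have "card S = Suc (card T)" using True by (simp add: S_def card_image)
  then have "Qvs.dependent S"
    using Qvs.independent_span_bound[OF T(1), of S] T(2) by (auto simp: S_def)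
  then obtain u w where u: "w \<in> S" "u w \<noteq> 0" "(\<Sum>v\<in>S. qscale (u v) v) = 0"
    unfolding Qvs.dependent_finite[OF fin] by auto
  from u(1) obtain k where k: "k \<le> card T" "w = z ^ k" by (auto simp: S_def)
  define p where "p = (\<Sum>i\<le>card T. monom (of_rat (u (z ^ i)) :: 'a) i)"
  have p: "coeff p i = (if i \<le> card T then of_rat (u (z ^ i)) else 0)" for i
    by (auto simp: p_def coeff_sum)
  show ?thesis
  proof (rule algebraicI')
    show "coeff p i \<in> \<rat>" for i by (simp add: p)
    show "p \<noteq> 0" using p[of k] k u(2) by auto
    have "poly p z = (\<Sum>v\<in>S. qscale (u v) v)"
      unfolding S_def sum.reindex[OF True] by (simp add: p_def poly_sum poly_monom)
    then show "poly p z = 0" using u(3) by simp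
  qed
qed

text \<open>Subrings containing the rationals and of finite dimension over them; \<open>T\<close>
  spans but need not lie in \<open>R\<close>. All their elements are algebraic, so closure
  properties of algebraic numbers reduce to adjoining elements to such rings.\<close>

definition finite_ext :: "'a::field_char_0 set \<Rightarrow> bool" where
  "finite_ext R \<longleftrightarrow> range of_rat \<subseteq> R \<and> (\<forall>x\<in>R. \<forall>y\<in>R. x - y \<in> R \<and> x * y \<in> R)
     \<and> (\<exists>T. finite T \<and> R \<subseteq> Qvs.span T)"

lemma finite_extD:
  assumes "finite_ext R"
  shows "of_rat q \<in> R" "x \<in> R \<Longrightarrow> y \<in> R \<Longrightarrow> x - y \<in> R" "x \<in> R \<Longrightarrow> y \<in> R \<Longrightarrow> x * y \<in> R"
    "x \<in> R \<Longrightarrow> y \<in> R \<Longrightarrow> x + y \<in> R" "0 \<in> R" "1 \<in> R"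
proof -
  note R = assms[unfolded finite_ext_def]
  show r: "of_rat q \<in> R" for q using R by auto
  show d: "x - y \<in> R" if "x \<in> R" "y \<in> R" for x y using R that by blast
  show "x * y \<in> R" if "x \<in> R" "y \<in> R" using R that by blast
  show z: "0 \<in> R" using r[of 0] by simp
  show "1 \<in> R" using r[of 1] by simp
  show "x + y \<in> R" if "x \<in> R" "y \<in> R" using d[OF that(1) d[OF z that(2)]] by simp
qed

lemma finite_ext_sum: "finite_ext R \<Longrightarrow> (\<And>i. i \<in> A \<Longrightarrow> f i \<in> R) \<Longrightarrow> sum f A \<in> R"
  by (induction A rule: infinite_finite_induct) (auto intro: finite_extD)

lemma finite_ext_algebraic:
  assumes R: "finite_ext R" and x: "x \<in> R"
  shows "algebraic x"
proof -
  obtain T where T: "finite T" "R \<subseteq> Qvs.span T" using R unfolding finite_ext_def by blast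
  have "x ^ n \<in> R" for n by (induction n) (auto intro: finite_extD[OF R] x)
  then show ?thesis using T algebraic_if_powers_in_span by blast
qed

lemma finite_ext_rat: "finite_ext (range of_rat)"
  unfolding finite_ext_def
proof (intro conjI exI)
  show "finite {1 :: 'a}" by simp
  show "range of_rat \<subseteq> Qvs.span {1 :: 'a}"
  proof safe
    fix q
    have "qscale q 1 \<in> Qvs.span {1 :: 'a}" by (intro Qvs.span_scale Qvs.span_base) simp
    then show "of_rat q \<in> Qvs.span {1 :: 'a}" by simp
  qed
qed (auto simp flip: of_rat_diff of_rat_mult)

text \<open>The ring R[\<xi>]: division by the monic \<open>p\<close> lowers the degree of a
  polynomial without leaving \<open>R\<close>, so products of a spanning set of \<open>R\<close>
  with bounded powers of \<xi> span R[\<xi>] over the rationals.\<close>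

lemma finite_ext_adjoin:
  fixes \<xi> :: "'a::field_char_0"
  assumes R: "finite_ext R" and p: "\<And>i. coeff p i \<in> R" "lead_coeff p = 1" "poly p \<xi> = 0"
  shows "\<exists>R'. finite_ext R' \<and> insert \<xi> R \<subseteq> R'"
proof -
  define RP where "RP = {q :: 'a poly. \<forall>i. coeff q i \<in> R}"
  define n where "n = degree p"
  obtain T where T: "finite T" "R \<subseteq> Qvs.span T" using R unfolding finite_ext_def by blast
  define T' where "T' = (\<lambda>(t, i). t * \<xi> ^ i) ` (T \<times> {..n})"
  have span_mult: "x * \<xi> ^ i \<in> Qvs.span T'" if "x \<in> Qvs.span T" "i \<le> n" for x i
    using that(1)
  proof (induction rule: Qvs.span_induct_alt)
    case base
    then show ?case by (simp add: Qvs.span_zero)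
  next
    case (step c x y)
    then have "x * \<xi> ^ i \<in> T'" using that(2) by (auto simp: T'_def)
    then have "qscale c (x * \<xi> ^ i) + y * \<xi> ^ i \<in> Qvs.span T'"
      by (rule Qvs.span_add[OF Qvs.span_scale[OF Qvs.span_base] step(2)])
    then show ?case by (simp add: algebra_simps)
  qed
  have red: "poly q \<xi> \<in> Qvs.span T'" if "q \<in> RP" for q
    using that
  proof (induction "degree q" arbitrary: q rule: less_induct)
    case less
    show ?case
    proof (cases "degree q < n")
      case True
      have "poly q \<xi> = (\<Sum>i\<le>degree q. coeff q i * \<xi> ^ i)" by (rule poly_altdef)
      also have "\<dots> \<in> Qvs.span T'"
        using True less.prems T(2) by (intro Qvs.span_sum span_mult) (auto simp: RP_def)
      finally show ?thesis .
    next
      case False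
      define q' where "q' = q - monom (lead_coeff q) (degree q - n) * p"
      have q': "poly q' \<xi> = poly q \<xi>" by (simp add: q'_def p(3))
      have "q' \<in> RP"
        using less.prems p(1) finite_extD[OF R] by (auto simp: RP_def q'_def coeff_monom_mult)
      have "q' = 0 \<or> degree q' < degree q"
      proof (rule eq_zero_or_degree_less)
        have "degree (monom (lead_coeff q) (degree q - n) * p) \<le> (degree q - n) + n"
          unfolding n_def by (rule order.trans[OF degree_mult_le add_mono[OF degree_monom_le order.refl]])
        then show "degree q' \<le> degree q" unfolding q'_def using False by (intro degree_diff_le) auto
        show "coeff q' (degree q) = 0"
          using False p(2) by (simp add: q'_def coeff_monom_mult n_def)
      qed
      then show ?thesis
      proof
        assume "q' = 0"
        then show ?thesis using q' Qvs.span_zero[of T'] by simp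
      next
        assume "degree q' < degree q"
        from less.hyps[OF this \<open>q' \<in> RP\<close>] q' show ?thesis by simp
      qed
    qed
  qed
  define R' where "R' = (\<lambda>q. poly q \<xi>) ` RP"
  have RP: "q - r \<in> RP" "q * r \<in> RP" if "q \<in> RP" "r \<in> RP" for q r
    using that finite_extD[OF R] by (auto simp: RP_def coeff_mult intro!: finite_ext_sum[OF R])
  have const: "[:x:] \<in> RP" if "x \<in> R" for x
    using that finite_extD[OF R] by (auto simp: RP_def coeff_pCons split: nat.splits)
  then have sub: "R \<subseteq> R'" unfolding R'_def by force
  have "[:0, 1:] \<in> RP"
    using finite_extD[OF R] by (auto simp: RP_def coeff_pCons split: nat.splits)
  then have "\<xi> \<in> R'" unfolding R'_def by force
  moreover have "finite_ext R'"
    unfolding finite_ext_def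
  proof (intro conjI ballI exI[of _ T'])
    show "range of_rat \<subseteq> R'" using sub finite_extD(1)[OF R] by auto
    show "finite T'" using T(1) by (simp add: T'_def)
    show "R' \<subseteq> Qvs.span T'" using red by (auto simp: R'_def)
    fix x y assume "x \<in> R'" "y \<in> R'"
    then show "x - y \<in> R'" "x * y \<in> R'"
      unfolding R'_def using RP by (auto simp flip: poly_diff poly_mult)
  qed
  ultimately show ?thesis using sub by blast
qed

lemma finite_ext_adjoin_algebraic:
  assumes R: "finite_ext R" and a: "algebraic a"
  shows "\<exists>R'. finite_ext R' \<and> insert a R \<subseteq> R'"
proof -
  obtain p where p: "\<And>i. coeff p i \<in> \<rat>" "p \<noteq> 0" "poly p a = 0"
    using a unfolding algebraic_altdef by blast
  show ?thesis
  proof (rule finite_ext_adjoin[OF R])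
    show "coeff (smult (inverse (lead_coeff p)) p) i \<in> R" for i
    proof -
      have "coeff (smult (inverse (lead_coeff p)) p) i \<in> \<rat>" using p(1) by simp
      then show ?thesis using finite_extD(1)[OF R] by (metis Rats_cases)
    qed
  qed (use p in simp_all)
qed

lemma finite_ext_adjoin_set:
  assumes "finite S" "\<And>a. a \<in> S \<Longrightarrow> algebraic a"
  shows "\<exists>R. finite_ext R \<and> S \<subseteq> R"
  using assms
proof (induction S)
  case empty
  then show ?case using finite_ext_rat by blast
next
  case (insert a S)
  then obtain R where "finite_ext R" "S \<subseteq> R" by auto
  with finite_ext_adjoin_algebraic[of R a] insert.prems show ?case by blast
qed

lemma algebraic_diff_mult:
  assumes "algebraic a" "algebraic b"
  shows "algebraic (a - b)" "algebraic (a * b)"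
proof -
  obtain R where R: "finite_ext R" "{a, b} \<subseteq> R"
    using finite_ext_adjoin_set[of "{a, b}"] assms by auto
  then show "algebraic (a - b)" "algebraic (a * b)"
    using finite_ext_algebraic[OF R(1)] finite_extD[OF R(1)] by auto
qed

lemma algebraic_add:
  assumes "algebraic a" "algebraic b"
  shows "algebraic (a + b)"
  using algebraic_diff_mult(1)[OF assms(1) algebraic_minus[OF assms(2)]] by simp

text \<open>After division by the leading coefficient the polynomial is monic with algebraic
  coefficients. These generate a finite extension, and adjoining the root keeps it finite.\<close>

lemma algebraic_root_of_algebraic_poly:
  assumes p: "\<And>i. algebraic (coeff p i)" "p \<noteq> 0" "poly p \<xi> = 0"
  shows "algebraic \<xi>"
proof -
  define q where "q = smult (inverse (lead_coeff p)) p"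
  have "range (coeff q) \<subseteq> insert 0 (coeff q ` {..degree q})"
    using le_degree[of q] by (auto simp: image_iff)
  then have "finite (range (coeff q))" by (rule finite_subset) simp
  moreover have "algebraic a" if "a \<in> range (coeff q)" for a
    using that p(1) by (auto simp: q_def intro!: algebraic_diff_mult algebraic_inverse)
  ultimately obtain R where R: "finite_ext R" "range (coeff q) \<subseteq> R"
    using finite_ext_adjoin_set by blast
  obtain R' where "finite_ext R'" "insert \<xi> R \<subseteq> R'"
    using finite_ext_adjoin[OF R(1), of q \<xi>] R(2) p(2,3) by (auto simp: q_def)
  then show ?thesis using finite_ext_algebraic by blast
qed

section \<open>The algebraic numbers as a type, with the class instances asked for by the abstract
  argument\<close>

typedef qbar = "{z :: complex. algebraic z}"
  morphisms of_qbar to_qbar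
  by (intro exI[of _ 0]) simp

setup_lifting type_definition_qbar

instantiation qbar :: field
begin

lift_definition zero_qbar :: qbar is 0 by simp
lift_definition one_qbar :: qbar is 1 by simp
lift_definition plus_qbar :: "qbar \<Rightarrow> qbar \<Rightarrow> qbar" is "(+)" by (rule algebraic_add)
lift_definition minus_qbar :: "qbar \<Rightarrow> qbar \<Rightarrow> qbar" is "(-)" by (rule algebraic_diff_mult)
lift_definition uminus_qbar :: "qbar \<Rightarrow> qbar" is "uminus" by (rule algebraic_minus)
lift_definition times_qbar :: "qbar \<Rightarrow> qbar \<Rightarrow> qbar" is "(*)" by (rule algebraic_diff_mult)
lift_definition inverse_qbar :: "qbar \<Rightarrow> qbar" is "inverse" by (rule algebraic_inverse)
lift_definition divide_qbar :: "qbar \<Rightarrow> qbar \<Rightarrow> qbar" is "(/)"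
  by (simp add: divide_inverse algebraic_diff_mult algebraic_inverse)

instance
  by standard (transfer; simp add: algebra_simps divide_inverse)+

end

lemma rhom_of_qbar: "rhom of_qbar"
  by standard (transfer; simp)+

lemma of_qbar_eq_iff [simp]: "of_qbar x = of_qbar y \<longleftrightarrow> x = y"
  by (rule of_qbar_inject)

lemma of_qbar_eq_0_iff [simp]: "of_qbar x = 0 \<longleftrightarrow> x = 0"
  using of_qbar_eq_iff[of x 0] rhom.zero[OF rhom_of_qbar] by (simp del: of_qbar_eq_iff)

instance qbar :: field_char_0
proof
  show "inj (of_nat :: nat \<Rightarrow> qbar)"
  proof (rule injI)
    fix m n assume "(of_nat m :: qbar) = of_nat n"
    then have "of_qbar (of_nat m) = of_qbar (of_nat n)" by simp
    then show "m = n" by (simp add: rhom.of_nat[OF rhom_of_qbar])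
  qed
qed

lemma of_qbar_poly: "of_qbar (poly p z) = poly (map_poly of_qbar p) (of_qbar z)"
  by (induction p) (simp_all add: map_poly_pCons rhom.add[OF rhom_of_qbar] rhom.mult[OF rhom_of_qbar]
      rhom.zero[OF rhom_of_qbar])

instance qbar :: alg_closed_field
proof (rule alg_closedI)
  fix p :: "qbar poly"
  assume "degree p > 0"
  have deg: "degree (map_poly of_qbar p) = degree p" by (rule degree_map_poly) simp
  with \<open>degree p > 0\<close> obtain \<xi> where \<xi>: "poly (map_poly of_qbar p) \<xi> = 0"
    using alg_closed_imp_poly_has_root[of "map_poly of_qbar p"] by auto
  have "algebraic \<xi>"
  proof (rule algebraic_root_of_algebraic_poly[OF _ _ \<xi>])
    show "algebraic (coeff (map_poly of_qbar p) i)" for i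
      using of_qbar by (simp add: coeff_map_poly rhom.zero[OF rhom_of_qbar])
    show "map_poly of_qbar p \<noteq> 0" using deg \<open>degree p > 0\<close> by auto
  qed
  then obtain z where "\<xi> = of_qbar z" by (metis mem_Collect_eq of_qbar_cases)
  then have "of_qbar (poly p z) = 0" using \<xi> by (simp add: of_qbar_poly)
  then show "\<exists>x. poly p x = 0" by auto
qed

text \<open>The trivial Euclidean structure of a field, in which all nonzero elements are units. It
  leads to the class \<open>field_gcd\<close>.\<close>

instantiation qbar ::
  "{unique_euclidean_ring, normalization_euclidean_semiring, normalization_semidom_multiplicative}"
begin

definition [simp]: "normalize_qbar = (normalize_field :: qbar \<Rightarrow> _)"
definition [simp]: "unit_factor_qbar = (unit_factor_field :: qbar \<Rightarrow> _)"
definition [simp]: "modulo_qbar = (mod_field :: qbar \<Rightarrow> _)"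
definition [simp]: "euclidean_size_qbar = (euclidean_size_field :: qbar \<Rightarrow> _)"
definition [simp]: "division_segment (x :: qbar) = 1"

instance
  by standard (simp_all add: dvd_field_iff field_split_simps split: if_splits)

end

instantiation qbar :: euclidean_ring_gcd
begin

definition gcd_qbar :: "qbar \<Rightarrow> qbar \<Rightarrow> qbar" where "gcd_qbar = Euclidean_Algorithm.gcd"
definition lcm_qbar :: "qbar \<Rightarrow> qbar \<Rightarrow> qbar" where "lcm_qbar = Euclidean_Algorithm.lcm"
definition Gcd_qbar :: "qbar set \<Rightarrow> qbar" where "Gcd_qbar = Euclidean_Algorithm.Gcd"
definition Lcm_qbar :: "qbar set \<Rightarrow> qbar" where "Lcm_qbar = Euclidean_Algorithm.Lcm"

instance by standard (simp_all add: gcd_qbar_def lcm_qbar_def Gcd_qbar_def Lcm_qbar_def)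

end

instance qbar :: field_gcd ..

lemma of_qbar_of_rat: "of_qbar (of_rat q) = of_rat q"
proof -
  obtain a b where ab: "quotient_of q = (a, b)" by force
  then have q: "b > 0" "q = of_int a / of_int b"
    using quotient_of_denom_pos quotient_of_div by blast+
  have of_int: "of_qbar (of_int k) = of_int k" for k
    by (cases k) (simp_all add: rhom.of_nat[OF rhom_of_qbar] rhom.minus[OF rhom_of_qbar]
        rhom.add[OF rhom_of_qbar] rhom.one[OF rhom_of_qbar] rhom.diff[OF rhom_of_qbar])
  have "of_rat q * of_int b = (of_int a :: qbar)"
    using q(1) by (simp add: q(2) of_rat_divide)
  from arg_cong[OF this, of of_qbar] have "of_qbar (of_rat q) * of_int b = of_int a"
    by (simp only: rhom.mult[OF rhom_of_qbar] of_int)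
  then show ?thesis using q(1) by (simp add: q(2) of_rat_divide field_simps)
qed

lemma algebraic_type_qbar: "algebraic_type TYPE(qbar)"
  unfolding algebraic_type_def
proof
  fix z :: qbar
  obtain p where p: "\<And>i. coeff p i \<in> \<rat>" "p \<noteq> 0" "poly p (of_qbar z) = 0"
    using of_qbar[of z] unfolding mem_Collect_eq algebraic_altdef by blast
  define q where "q = map_poly (inv of_rat) p"
  have inv: "inv of_rat (of_rat a :: complex) = a" for a by (rule inv_f_f) (simp add: inj_on_def)
  have c: "of_rat (coeff q i) = coeff p i" for i
    using p(1)[of i] inv[of 0] inv by (auto simp: q_def coeff_map_poly elim!: Rats_cases)
  then have "map_poly of_rat q = p" by (intro poly_eqI) (simp add: coeff_map_poly)
  have "of_qbar (evq q z) = poly (map_poly of_rat q) (of_qbar z)"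
    unfolding ev1_def of_qbar_poly
    by (simp add: map_poly_map_poly o_def of_qbar_of_rat rhom.zero[OF rhom_of_qbar])
  then have "evq q z = 0" using p(3) \<open>map_poly of_rat q = p\<close> by simp
  moreover have "q \<noteq> 0" using p(2) \<open>map_poly of_rat q = p\<close> by auto
  ultimately show "\<exists>p. p \<noteq> 0 \<and> evq p z = 0" by blast
qed

subsection \<open>Transfer to the algebraic numbers\<close>

text \<open>A subring closed under exact division. The property passes from coefficients to
  polynomials, and it is what keeps cofactors over the algebraic numbers when a divisibility is
  known only over the complex numbers.\<close>

definition quotient_closed :: "'a::idom set \<Rightarrow> bool" where
  "quotient_closed R \<longleftrightarrow> 0 \<in> R \<and> (\<forall>x\<in>R. \<forall>y\<in>R. x - y \<in> R \<and> x * y \<in> R)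
     \<and> (\<forall>x\<in>R. \<forall>y. x \<noteq> 0 \<longrightarrow> x * y \<in> R \<longrightarrow> y \<in> R)"

definition polys_over :: "'a::zero set \<Rightarrow> 'a poly set" where
  "polys_over R = {p. \<forall>i. coeff p i \<in> R}"

lemma quotient_closed_sum:
  assumes "quotient_closed R" "\<And>i. i \<in> A \<Longrightarrow> f i \<in> R"
  shows "sum f A \<in> R"
proof -
  have "x + y \<in> R" if "x \<in> R" "y \<in> R" for x y
  proof -
    have "0 - y \<in> R" using assms(1) that unfolding quotient_closed_def by blast
    then have "x - (0 - y) \<in> R" using assms(1) that unfolding quotient_closed_def by blast
    then show ?thesis by simp
  qed
  moreover have "0 \<in> R" using assms(1) by (simp add: quotient_closed_def)
  ultimately show ?thesis
    using assms(2) by (induction A rule: infinite_finite_induct) auto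
qed

text \<open>The cofactor is recovered from the top: its leading coefficient times that of
  \<open>p\<close> is the leading coefficient of the product, hence it lies in \<open>R\<close>. The
  leading term is then subtracted.\<close>

lemma quotient_closed_polys_over:
  assumes R: "quotient_closed R"
  shows "quotient_closed (polys_over R)"
proof -
  have zero: "0 \<in> R" and diff: "\<And>x y. x \<in> R \<Longrightarrow> y \<in> R \<Longrightarrow> x - y \<in> R"
    and mult: "\<And>x y. x \<in> R \<Longrightarrow> y \<in> R \<Longrightarrow> x * y \<in> R"
    and quot: "\<And>x y. x \<in> R \<Longrightarrow> x \<noteq> 0 \<Longrightarrow> x * y \<in> R \<Longrightarrow> y \<in> R"
    using R unfolding quotient_closed_def by blast+
  have pzero: "0 \<in> polys_over R" using zero by (simp add: polys_over_def)
  have pdiff: "p - q \<in> polys_over R" if "p \<in> polys_over R" "q \<in> polys_over R" for p q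
    using that diff by (simp add: polys_over_def)
  have pmult: "p * q \<in> polys_over R" if "p \<in> polys_over R" "q \<in> polys_over R" for p q
  proof -
    have "(\<Sum>i\<le>n. coeff p i * coeff q (n - i)) \<in> R" for n
      using that by (intro quotient_closed_sum[OF R] mult) (simp_all add: polys_over_def)
    then show ?thesis by (simp add: polys_over_def coeff_mult)
  qed
  have monom: "monom c k \<in> polys_over R" if "c \<in> R" for c k
    using that zero by (auto simp: polys_over_def)
  have "q \<in> polys_over R" if p: "p \<in> polys_over R" "p \<noteq> 0" and "p * q \<in> polys_over R" for p q
    using that(3)
  proof (induction "degree q" arbitrary: q rule: less_induct)
    case less
    show ?case
    proof (cases "q = 0")
      case True
      then show ?thesis using pzero by simp
    next
      case False
      have "lead_coeff p * lead_coeff q = coeff (p * q) (degree p + degree q)"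
        by (simp add: coeff_mult_degree_sum)
      also have "\<dots> \<in> R" using less.prems by (simp add: polys_over_def)
      finally have "lead_coeff p * lead_coeff q \<in> R" .
      moreover have "lead_coeff p \<in> R" "lead_coeff p \<noteq> 0" using p by (simp_all add: polys_over_def)
      ultimately have "lead_coeff q \<in> R" using quot by blast
      then have m: "monom (lead_coeff q) (degree q) \<in> polys_over R" by (rule monom)
      define q' where "q' = q - monom (lead_coeff q) (degree q)"
      have q: "q = q' - (0 - monom (lead_coeff q) (degree q))" by (simp add: q'_def)
      have "p * q' = p * q - p * monom (lead_coeff q) (degree q)"
        by (simp add: q'_def algebra_simps)
      then have pq': "p * q' \<in> polys_over R" using less.prems p(1) m pdiff pmult by simp
      have "q' = 0 \<or> degree q' < degree q"
        by (rule eq_zero_or_degree_less) (auto simp: q'_def intro!: degree_diff_le degree_monom_le)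
      then have "q' \<in> polys_over R"
        using less.hyps[OF _ pq'] pzero by blast
      from pdiff[OF this pdiff[OF pzero m]] show ?thesis unfolding q[symmetric] .
    qed
  qed
  then show ?thesis
    unfolding quotient_closed_def using pdiff pmult pzero by blast
qed

lemma coeffs_in_conv: "coeffs_in S p \<longleftrightarrow> p \<in> polys_over (polys_over S)"
  by (simp add: coeffs_in_def polys_over_def)

lemma quotient_closed_Qbar: "quotient_closed Qbar"
proof -
  have "y \<in> Qbar" if "x \<in> Qbar" "x \<noteq> 0" "x * y \<in> Qbar" for x y
  proof -
    have a: "algebraic x" "algebraic (x * y)" using that by (simp_all add: Qbar_def)
    have "algebraic (inverse x * (x * y))"
      by (rule algebraic_diff_mult(2)[OF algebraic_inverse[OF a(1)] a(2)])
    moreover have "inverse x * (x * y) = y" using that(2) by simp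
    ultimately show ?thesis by (simp add: Qbar_def)
  qed
  moreover have "0 \<in> Qbar" "\<forall>x\<in>Qbar. \<forall>y\<in>Qbar. x - y \<in> Qbar \<and> x * y \<in> Qbar"
    by (simp_all add: Qbar_def algebraic_diff_mult)
  ultimately show ?thesis unfolding quotient_closed_def by blast
qed

section \<open>Embedding of polynomials over \<open>qbar\<close> into those over the complex
  numbers\<close>

abbreviation qbar_extend :: "qbar poly poly \<Rightarrow> complex poly poly" where
  "qbar_extend \<equiv> map_poly (map_poly of_qbar)"

lemma rhom_qbar_extend: "rhom qbar_extend"
  by (intro rhom.map_poly_rhom rhom_of_qbar)

lemma Qbar_range: "Qbar = range of_qbar"
  by (metis Qbar_def type_definition.Rep_range type_definition_qbar)

lemma of_qbar_0 [simp]: "of_qbar 0 = 0"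
  by (rule rhom.zero[OF rhom_of_qbar])

lemma coeff_qbar_extend: "coeff (coeff (qbar_extend p) i) j = of_qbar (coeff (coeff p i) j)"
  by (simp add: coeff_map_poly)

lemma qbar_extend_eq_iff: "qbar_extend p = qbar_extend q \<longleftrightarrow> p = q"
proof
  assume "qbar_extend p = qbar_extend q"
  then have "coeff (coeff p i) j = coeff (coeff q i) j" for i j
    by (metis coeff_qbar_extend of_qbar_eq_iff)
  then show "p = q" by (intro poly_eqI)
qed simp

lemma coeffs_in_Qbar_iff: "coeffs_in Qbar p \<longleftrightarrow> (\<exists>q. p = qbar_extend q)"
proof
  assume p: "coeffs_in Qbar p"
  define q where "q = map_poly (map_poly to_qbar) p"
  have to0: "to_qbar 0 = 0" by (metis of_qbar_0 of_qbar_inverse)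
  have "of_qbar (to_qbar (coeff (coeff p i) j)) = coeff (coeff p i) j" for i j
    using p by (intro to_qbar_inverse) (simp add: coeffs_in_def Qbar_def)
  then have "p = qbar_extend q"
    by (intro poly_eqI) (simp add: coeff_qbar_extend q_def coeff_map_poly to0)
  then show "\<exists>q. p = qbar_extend q" by blast
next
  assume "\<exists>q. p = qbar_extend q"
  then show "coeffs_in Qbar p" by (auto simp: coeffs_in_def coeff_qbar_extend Qbar_range)
qed

lemma qbar_extend_dvd_iff: "qbar_extend p dvd qbar_extend q \<longleftrightarrow> p dvd q"
proof
  assume "qbar_extend p dvd qbar_extend q"
  then obtain r where r: "qbar_extend q = qbar_extend p * r" by (elim dvdE)
  show "p dvd q"
  proof (cases "p = 0")
    case True
    then have "qbar_extend q = qbar_extend 0" using r by simp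
    then have "q = 0" unfolding qbar_extend_eq_iff .
    then show ?thesis by simp
  next
    case False
    have "quotient_closed (polys_over (polys_over Qbar))"
      by (intro quotient_closed_polys_over quotient_closed_Qbar)
    moreover have "qbar_extend p \<in> polys_over (polys_over Qbar)" "qbar_extend p * r \<in> polys_over (polys_over Qbar)"
      unfolding r[symmetric] coeffs_in_conv[symmetric] coeffs_in_Qbar_iff by blast+
    moreover have "qbar_extend p \<noteq> 0" using False qbar_extend_eq_iff[of p 0] by simp
    ultimately have "r \<in> polys_over (polys_over Qbar)" unfolding quotient_closed_def by blast
    then obtain r' where "r = qbar_extend r'" unfolding coeffs_in_conv[symmetric] coeffs_in_Qbar_iff by blast
    with r have "qbar_extend q = qbar_extend (p * r')" by (simp add: rhom.mult[OF rhom_qbar_extend])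
    then have "q = p * r'" unfolding qbar_extend_eq_iff .
    then show ?thesis by simp
  qed
qed (rule rhom.dvd[OF rhom_qbar_extend])

lemma qbar_extend_subst2: "qbar_extend (subst2 p A B) = subst2 (qbar_extend p) (qbar_extend A) (qbar_extend B)"
  unfolding subst2_conv ev2_map_poly[OF rhom_const2 rhom_of_qbar]
    rhom_ev2_natural[OF rhom_const2 rhom_qbar_extend] map_poly_gens(1)[OF rhom_of_qbar] ..

lemma eval2_qbar_extend: "eval2 (qbar_extend p) (of_qbar x) (of_qbar y) = of_qbar (eval2 p x y)"
  unfolding eval2_conv ev2_map_poly[OF rhom_id rhom_of_qbar]
    rhom_ev2_natural[OF rhom_id rhom_of_qbar] ..

lemma pderiv_map_of_qbar: "pderiv (map_poly of_qbar p) = map_poly of_qbar (pderiv p)"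
  by (rule poly_eqI) (simp add: coeff_pderiv coeff_map_poly rhom.mult[OF rhom_of_qbar]
      rhom.add[OF rhom_of_qbar] rhom.one[OF rhom_of_qbar] rhom.of_nat[OF rhom_of_qbar])

lemma dx2_qbar_extend: "dx2 (qbar_extend p) = qbar_extend (dx2 p)"
  by (rule poly_eqI) (simp add: coeff_dx2 coeff_map_poly pderiv_map_of_qbar)

lemma dy2_qbar_extend: "dy2 (qbar_extend p) = qbar_extend (dy2 p)"
proof (rule poly_eqI)
  fix i
  have "map_poly of_qbar (of_nat n) = of_nat n" for n
    by (rule rhom.of_nat[OF rhom.map_poly_rhom[OF rhom_of_qbar]])
  from this[of "Suc i"] show "coeff (dy2 (qbar_extend p)) i = coeff (qbar_extend (dy2 p)) i"
    by (simp add: dy2_def coeff_pderiv coeff_map_poly rhom.mult[OF rhom.map_poly_rhom[OF rhom_of_qbar]]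
        del: of_nat_Suc)
qed

lemma coeffs_in_qbar_extend: "coeffs_in Qbar (qbar_extend p)"
  unfolding coeffs_in_Qbar_iff by blast

text \<open>The divisibility part of \<open>plane_curve_iso\<close>, separated from the choice of
  coefficients so that it can be transported along \<open>qbar_extend\<close> by itself.\<close>

definition mutually_inverse :: "'a::comm_ring_1 poly poly \<Rightarrow> 'a poly poly \<Rightarrow> 'a poly poly \<Rightarrow>
    'a poly poly \<Rightarrow> 'a poly poly \<Rightarrow> 'a poly poly \<Rightarrow> bool" where
  "mutually_inverse F H A B C D \<longleftrightarrow> H dvd subst2 F A B \<and> F dvd subst2 H C D \<and>
      F dvd (subst2 A C D - X2) \<and> F dvd (subst2 B C D - Y2) \<and>
      H dvd (subst2 C A B - X2) \<and> H dvd (subst2 D A B - Y2)"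

lemma mutually_inverse_qbar_extend:
  "mutually_inverse (qbar_extend F) (qbar_extend H) (qbar_extend A) (qbar_extend B) (qbar_extend C) (qbar_extend D)
    \<longleftrightarrow> mutually_inverse F H A B C D"
proof -
  have "qbar_extend p - X2 = qbar_extend (p - X2)" "qbar_extend p - Y2 = qbar_extend (p - Y2)" for p
    by (simp_all add: rhom.diff[OF rhom_qbar_extend] map_poly_gens[OF rhom_of_qbar])
  then show ?thesis
    unfolding mutually_inverse_def qbar_extend_subst2[symmetric] by (simp only: qbar_extend_dvd_iff)
qed

lemma plane_curve_iso_Qbar_iff:
  "plane_curve_iso Qbar (qbar_extend F) (qbar_extend H) \<longleftrightarrow> plane_curve_iso UNIV F H"
proof
  assume "plane_curve_iso Qbar (qbar_extend F) (qbar_extend H)"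
  then obtain A B C D where co: "coeffs_in Qbar A" "coeffs_in Qbar B" "coeffs_in Qbar C" "coeffs_in Qbar D"
    and M: "mutually_inverse (qbar_extend F) (qbar_extend H) A B C D"
    unfolding plane_curve_iso_def mutually_inverse_def[symmetric] by (elim exE conjE)
  from co[unfolded coeffs_in_Qbar_iff] obtain A' B' C' D' where
    "A = qbar_extend A'" "B = qbar_extend B'" "C = qbar_extend C'" "D = qbar_extend D'"
    by (elim exE)
  with M have "mutually_inverse F H A' B' C' D'" by (simp only: mutually_inverse_qbar_extend)
  then show "plane_curve_iso UNIV F H"
    unfolding plane_curve_iso_def mutually_inverse_def[symmetric]
    by (intro exI[of _ A'] exI[of _ B'] exI[of _ C'] exI[of _ D']) simp
next
  assume "plane_curve_iso UNIV F H"
  then obtain A B C D where "mutually_inverse F H A B C D"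
    unfolding plane_curve_iso_def mutually_inverse_def[symmetric] by (elim exE conjE)
  then have "mutually_inverse (qbar_extend F) (qbar_extend H) (qbar_extend A) (qbar_extend B)
      (qbar_extend C) (qbar_extend D)"
    by (simp only: mutually_inverse_qbar_extend)
  then show "plane_curve_iso Qbar (qbar_extend F) (qbar_extend H)"
    unfolding plane_curve_iso_def mutually_inverse_def[symmetric]
    by (intro exI[of _ "qbar_extend A"] exI[of _ "qbar_extend B"] exI[of _ "qbar_extend C"]
        exI[of _ "qbar_extend D"]) (simp add: coeffs_in_qbar_extend)
qed

text \<open>Restriction of (A, B) to the line y = 0 parametrizes the fibre, and \<open>C\<close> is
  the inverse coordinate. As \<open>D\<close> vanishes modulo G - a, the relations x = A(C, D) and y
  = B(C, D) there become x = A(C, 0) and y = B(C, 0), which makes every h a polynomial in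
  \<open>C\<close>.\<close>

lemma iso_A1_param:
  fixes G :: "'a::idom poly poly"
  assumes "plane_curve_iso UNIV (G - const2 a) A1_poly"
  shows "\<exists>X Y C. param G a X Y C"
proof -
  obtain A B C D where 1: "Y2 dvd subst2 (G - const2 a) A B" and 2: "G - const2 a dvd D"
    and 3: "G - const2 a dvd subst2 A C D - X2" "G - const2 a dvd subst2 B C D - Y2"
    and 4: "Y2 dvd subst2 C A B - X2"
    using assms unfolding plane_curve_iso_def A1_poly_def subst2_gens by (elim exE conjE)
  define X where "X = curve A [:0, 1:] 0"
  define Y where "Y = curve B [:0, 1:] 0"
  have restrict: "curve p [:0, 1:] 0 = 0" if "Y2 dvd p" for p :: "'a poly poly"
    using rhom.dvd[OF rhom_curve that, of "[:0, 1:]" 0] by simp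
  have "curve G X Y = [:a:]"
    using restrict[OF 1] by (simp add: curve_simps curve_subst2 X_def Y_def)
  moreover have "curve C X Y = [:0, 1:]"
    using restrict[OF 4] by (simp add: curve_simps curve_subst2 X_def Y_def)
  moreover have "G - const2 a dvd h - ucomp (curve h X Y) C" for h
  proof -
    let ?A = "subst2 A C 0" and ?B = "subst2 B C 0"
    have CD: "G - const2 a dvd subst2 p C D - subst2 p C 0" for p
      using 2 by (intro subst2_cong_dvd) simp_all
    have AB: "G - const2 a dvd X2 - ?A" "G - const2 a dvd Y2 - ?B"
      using dvd_diff[OF CD[of A] 3(1)] dvd_diff[OF CD[of B] 3(2)] by simp_all
    have "subst2 h ?A ?B = ucomp (curve h X Y) C"
    proof (rule rhom2_eqI[where p = h])
      have gen: "ucomp (curve p [:0, 1:] 0) C = subst2 p C 0" for p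
        by (rule rhom2_eqI[where p = p])
          (auto intro: rhom_comp[OF rhom_ucomp rhom_curve] rhom_subst2)
      show "subst2 X2 ?A ?B = ucomp (curve X2 X Y) C" "subst2 Y2 ?A ?B = ucomp (curve Y2 X Y) C"
        by (simp_all add: X_def Y_def gen)
    qed (auto intro: rhom_comp[OF rhom_ucomp rhom_curve] rhom_subst2)
    with subst2_cong_dvd[OF AB, of h] show ?thesis by simp
  qed
  ultimately show ?thesis unfolding param_def by blast
qed

theorem mainTheorem17:
  fixes F :: "rat poly poly" and G :: "complex poly poly"
  assumes smooth: "smooth_plane_curve (ratpoly_to_complex F)"
    and not_A1: "\<not> plane_curve_iso Qbar (ratpoly_to_complex F) A1_poly"
    and not_A1star: "\<not> plane_curve_iso Qbar (ratpoly_to_complex F) A1star_poly"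
    and G_Qbar: "coeffs_in Qbar G"
    and fibres: "\<exists>E. finite E \<and> (\<forall>a\<in>Qbar. (a = 0 \<or> a \<notin> E) \<longrightarrow>
          plane_curve_iso Qbar (G - const2 a) A1_poly \<and>
          card {(x, y). x \<in> Qbar \<and> y \<in> Qbar \<and> eval2 (ratpoly_to_complex F) x y = 0
                 \<and> eval2 G x y = a} = 1)"
  shows "weak_approximation {(x, y). eval2 F x y < 0}"
proof -
  obtain E where E: "finite E" "\<And>a. a \<in> Qbar \<Longrightarrow> a \<notin> E \<Longrightarrow> plane_curve_iso Qbar (G - const2 a) A1_poly"
    "\<And>a. a \<in> Qbar \<Longrightarrow> a \<notin> E \<Longrightarrow> card {(x, y). x \<in> Qbar \<and> y \<in> Qbar \<and>
       eval2 (ratpoly_to_complex F) x y = 0 \<and> eval2 G x y = a} = 1"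
    using fibres by blast
  obtain G' where G: "G = qbar_extend G'" using G_Qbar coeffs_in_Qbar_iff by blast
  define F' :: "qbar poly poly" where "F' = rat_extend F"
  have F: "ratpoly_to_complex F = qbar_extend F'"
    by (intro poly_eqI) (simp add: ratpoly_to_complex_def F'_def coeff_map_poly of_qbar_of_rat)
  define E' where "E' = {a. of_qbar a \<in> E}"
  have gens: "qbar_extend Y2 = Y2" "qbar_extend X2 = X2" "qbar_extend (const2 a) = const2 (of_qbar a)" for a
    by (rule map_poly_gens[OF rhom_of_qbar])+
  have A1: "A1_poly = qbar_extend A1_poly" by (simp add: A1_poly_def gens)
  have A1star: "A1star_poly = qbar_extend A1star_poly"
    by (simp add: A1star_poly_def gens rhom.diff[OF rhom_qbar_extend] rhom.mult[OF rhom_qbar_extend]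
        rhom.one[OF rhom_qbar_extend])
  interpret once_met_pencil G' E' F'
  proof
    show "finite E'"
      unfolding E'_def using finite_vimageI[OF E(1), of of_qbar] by (simp add: vimage_def inj_on_def)
    show "\<exists>X Y C. param G' a X Y C" if "a \<notin> E'" for a
    proof (rule iso_A1_param)
      have "plane_curve_iso Qbar (G - const2 (of_qbar a)) A1_poly"
        using that by (intro E(2)) (auto simp: E'_def Qbar_range)
      also have "G - const2 (of_qbar a) = qbar_extend (G' - const2 a)"
        by (simp add: G rhom.diff[OF rhom_qbar_extend] gens)
      finally show "plane_curve_iso UNIV (G' - const2 a) A1_poly"
        unfolding A1 plane_curve_iso_Qbar_iff .
    qed
    show "smooth_points F'"
      unfolding smooth_points_def
    proof (intro allI impI)
      fix x y assume "eval2 F' x y = 0"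
      then have "eval2 (ratpoly_to_complex F) (of_qbar x) (of_qbar y) = 0"
        by (simp add: F eval2_qbar_extend)
      moreover have "of_qbar x \<in> Qbar" "of_qbar y \<in> Qbar" by (simp_all add: Qbar_range)
      ultimately have "eval2 (dx2 (ratpoly_to_complex F)) (of_qbar x) (of_qbar y) \<noteq> 0
          \<or> eval2 (dy2 (ratpoly_to_complex F)) (of_qbar x) (of_qbar y) \<noteq> 0"
        using smooth unfolding smooth_plane_curve_def by blast
      then show "eval2 (dx2 F') x y \<noteq> 0 \<or> eval2 (dy2 F') x y \<noteq> 0"
        by (simp add: F dx2_qbar_extend dy2_qbar_extend eval2_qbar_extend)
    qed
    show "card {(x, y). eval2 F' x y = 0 \<and> eval2 G' x y = a} = 1" if "a \<notin> E'" for a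
    proof -
      have "{(x, y). x \<in> Qbar \<and> y \<in> Qbar \<and> eval2 (ratpoly_to_complex F) x y = 0 \<and> eval2 G x y = of_qbar a}
        = (\<lambda>(x, y). (of_qbar x, of_qbar y)) ` {(x, y). eval2 F' x y = 0 \<and> eval2 G' x y = a}"
        by (auto simp: F G eval2_qbar_extend Qbar_range image_iff)
      moreover have "inj_on (\<lambda>(x, y). (of_qbar x, of_qbar y)) S" for S
        by (auto simp: inj_on_def)
      ultimately show ?thesis
        using E(3)[of "of_qbar a"] that by (simp add: card_image E'_def Qbar_range)
    qed
    show "\<not> plane_curve_iso UNIV F' A1_poly"
      using not_A1 unfolding F A1 plane_curve_iso_Qbar_iff .
    show "\<not> plane_curve_iso UNIV F' A1star_poly"
      using not_A1star unfolding F A1star plane_curve_iso_Qbar_iff .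
  qed
  obtain \<Omega> where \<Omega>: "\<Omega> \<noteq> 0" "\<And>x y. eval2 \<Omega> x y \<noteq> 0 \<Longrightarrow>
     \<exists>!(X, Y). curve F' X Y = [:0, 1:] \<and> poly X (eval2 F' x y) = x \<and> poly Y (eval2 F' x y) = y"
    using unique_section by blast
  show ?thesis
    using weak_approximation_negative_values[OF algebraic_type_qbar \<Omega>[unfolded F'_def]] .
qed

end
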